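(* Let $b\ge 2$ be an integer and let $g:\mathbb{N}\to\mathbb{C}$ be a strongly $b$-multiplicative function with $|g(n)|=1$ for all $n\in\mathbb{N}$. Then, as $N\to\infty$, \[ \sum_{n< N} \mu(n)\, g(n^2) = o(N), \] where $\mu$ is the M\"obius function.
   Context: $\mathbb{N}$ denotes the set of non-negative integers. A function $g:\mathbb{N}\to\mathbb{C}$ is strongly $b$-multiplicative if $g(kb+a)=g(k)g(a)$ for all $a,k\in\mathbb{N}$ with $0\le a<b$. *)

theory Defs
  imports
    Complex_Main
    "HOL-Computational_Algebra.Squarefree"
    "HOL-Library.Landau_Symbols"
begin

(* Since squarefree 0 is false, moebius_mu 0 = 0. *)
definition moebius_mu :: "nat \<Rightarrow> int" where
  "moebius_mu n = (if squarefree n then (-1) ^ card (prime_factors n) else 0)"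

definition strongly_multiplicative :: "nat \<Rightarrow> (nat \<Rightarrow> complex) \<Rightarrow> bool" where
  "strongly_multiplicative b g \<longleftrightarrow> (\<forall>k a. a < b \<longrightarrow> g (k * b + a) = g k * g a)"

end

theory Submission
  imports
    Defs
    "HOL-Complex_Analysis.Complex_Analysis"
    "HOL-Number_Theory.Residues"
    "HOL-Real_Asymp.Real_Asymp"
begin

text \<open>
  Write \<open>h(n) = g(p\<^sup>2 n) cnj (g(q\<^sup>2 n))\<close>. By the criterion of Katai it suffices that
  \<open>\<Sum>\<^bsub>n<N\<^esub> h(n\<^sup>2) = o(N)\<close> for distinct primes \<open>p\<close>, \<open>q\<close> not dividing \<open>b\<close>.

  Padding by zero digits resets the carries, so either \<open>h\<close> is a linear phase or its exponential sums
  over blocks of \<open>w\<close> digits are \<open>o(b\<^sup>w)\<close>, uniformly in the frequency. In the second case one application of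
  van der Corput's inequality removes the high digits of \<open>n\<^sup>2\<close>. Write \<open>n = u + b\<^sup>\<mu> s\<close>, where \<open>b\<^sup>\<mu>\<close> is
  smaller than \<open>N\<close> by a large constant factor. Then the digits of \<open>n\<^sup>2\<close> at places below \<open>\<mu>\<close> do not depend on \<open>s\<close>, and the
  remaining bounded window of digits is that of \<open>\<lfloor>u\<^sup>2 / b\<^sup>\<mu>\<rfloor> + 2 u s\<close>. A second differencing, now in \<open>s\<close>, and an upper bound for the
  number of \<open>u\<close> in a given cell reduce the matter to the mean of the autocorrelations of \<open>h\<close> modulo
  \<open>b\<^sup>w\<close>, which is controlled by the largest Fourier coefficient.

  If \<open>h\<close> is a linear phase, shifting overlapping digit blocks gives \<open>g(m + 1) = g(1) g(m)\<close>, hence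
  \<open>g(n) = \<zeta>\<^sup>n\<close> with \<open>\<zeta>\<^bsup>b-1\<^esup> = 1\<close>, and \<open>g(n\<^sup>2)\<close> is periodic. That case is the prime number theorem for
  arithmetic progressions in the form \<open>\<Sum>\<^bsub>n<N\<^esub> \<mu>(n) \<theta>(n) = o(N)\<close> for Dirichlet characters \<open>\<theta>\<close>, which
  follows from Newman's Tauberian theorem and the nonvanishing of L-functions on \<open>Re s = 1\<close>.
\<close>

section \<open>The criterion of Katai\<close>

text \<open>The square of an n with L digits has about 2L digits, so no digit block of n^2 is an
  independent variable. Everything is therefore forced into a window whose width \<open>w\<close> is
  fixed before \<open>N\<close> grows, and the obstacle is the carries that cross its two ends. They
  are never computed: a carry entering from below takes boundedly many values and all of them are
  summed over, which is why exponential sums must be small uniformly in the incoming carries; a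
  carry leaving at the top is made rare by \<open>d\<close> guard digits. Parameters are fixed in
  the order \<open>d\<close>, then the length \<open>S\<close> of the second differencing, then
  \<open>w\<close>, and \<open>N\<close> last. A linear phase is a genuine exception to the
  correlation estimate, not to the theorem: if \<open>g n\<close> is \<zeta>^n with \<zeta>^(b-1) =
  1, and p and q agree modulo b - 1, then the correlation of the two dilates is identically 1. In
  that case \<mu> has to be paired with the periodic function directly. Primes dividing
  \<open>b\<close> are excluded because multiplication by p^2 must permute residues modulo powers of
  \<open>b\<close>, both when escaping carries are counted and when \<open>g\<close> is recovered
  from its dilates.\<close>

definition sublinear :: "(nat \<Rightarrow> complex) \<Rightarrow> bool" where
  "sublinear S \<longleftrightarrow> (\<forall>\<epsilon>>0. \<forall>\<^sub>F N in sequentially. cmod (S N) \<le> \<epsilon> * real N)"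

lemma sublinearI:
  assumes "\<And>\<epsilon>. \<epsilon> > 0 \<Longrightarrow> \<forall>\<^sub>F N in sequentially. cmod (S N) \<le> \<epsilon> * real N"
  shows "sublinear S"
  using assms by (simp add: sublinear_def)

lemma sublinearD:
  assumes "sublinear S" "\<epsilon> > 0"
  shows "\<forall>\<^sub>F N in sequentially. cmod (S N) \<le> \<epsilon> * real N"
  using assms by (simp add: sublinear_def)

lemma sublinear_imp_smallo:
  assumes "sublinear S"
  shows "S \<in> o(\<lambda>N. of_nat N)"
  by (rule landau_o.smallI) (use sublinearD[OF assms] in simp)

text \<open>Cauchy-Schwarz against the constant 1, in the form that turns a mean square bound into a
  bound for the mean; it closes the variance bound and most differencing steps below.\<close>

lemma sum_nat_mult_le_sqrt:
  fixes f :: "nat \<Rightarrow> real"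
  assumes "(\<Sum>n<N. (f n)\<^sup>2) \<le> real N * x" "x \<ge> 0"
  shows "(\<Sum>n<N. f n) \<le> real N * sqrt x"
proof -
  have "(\<Sum>n<N. 1 * f n)\<^sup>2 \<le> (\<Sum>n<N. 1\<^sup>2) * (\<Sum>n<N. (f n)\<^sup>2)"
    by (rule Cauchy_Schwarz_ineq_sum)
  also have "\<dots> \<le> real N * (real N * x)"
    using assms by (intro mult_mono) (auto intro: sum_nonneg)
  also have "\<dots> = (real N * sqrt x)\<^sup>2"
    using assms by (simp add: power2_eq_square)
  finally show ?thesis
    using assms by (simp add: abs_le_square_iff[symmetric])
qed

lemma cmod_sum_power2:
  "complex_of_real ((cmod (\<Sum>i\<in>A. z i))\<^sup>2) = (\<Sum>i\<in>A. \<Sum>j\<in>A. z i * cnj (z j))"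
  by (simp add: complex_norm_square sum_product del: of_real_power)

section \<open>Values of the Moebius function\<close>

lemma moebius_mu_1 [simp]: "moebius_mu (Suc 0) = 1"
  by (simp add: moebius_mu_def)

lemma abs_moebius_mu_le: "\<bar>moebius_mu n\<bar> \<le> 1"
  by (simp add: moebius_mu_def power_abs)

lemma cmod_moebius_mu_le: "cmod (of_int (moebius_mu n)) \<le> 1"
  using abs_moebius_mu_le[of n] by (metis norm_of_int of_int_1 of_int_le_iff of_int_abs)

lemma moebius_mu_mult_prime:
  assumes "prime p"
  shows "moebius_mu (p * n) = (if p dvd n then 0 else - moebius_mu n)"
proof (cases "p dvd n")
  case True
  then have "p\<^sup>2 dvd p * n"
    by (simp add: power2_eq_square)
  then have "\<not> squarefree (p * n)"
    using assms not_prime_unit squarefreeD by blast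
  then show ?thesis
    using True by (simp add: moebius_mu_def)
next
  case False
  then have n: "n \<noteq> 0" and cop: "coprime p n"
    using assms by (auto intro: prime_imp_coprime intro!: Nat.gr0I)
  have "squarefree (p * n) \<longleftrightarrow> squarefree n"
    using cop assms by (blast intro: squarefree_mult_coprime squarefree_prime dest: squarefree_multD(2))
  moreover have "prime_factors (p * n) = insert p (prime_factors n)"
    using assms n by (auto simp: prime_factors_product prime_prime_factors)
  moreover have "p \<notin> prime_factors n"
    using False by auto
  ultimately show ?thesis
    using False by (simp add: moebius_mu_def)
qed

text \<open>The right side is \<open>N / m\<close> rounded up, because the multiples of
  \<open>m\<close> below \<open>N\<close> include 0. Hence the lower bound \<open>N / m\<close> in
  the next lemma carries no error term.\<close>

lemma sum_of_bool_dvd: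
  assumes "m > 0"
  shows "(\<Sum>n<N. of_bool (m dvd n)) = real ((N + m - 1) div m)"
proof (induction N)
  case (Suc N)
  have "(Suc N + m - 1) div m = (N + m - 1) div m + of_bool (m dvd N)"
  proof -
    define a where "a = N + m - 1"
    have "Suc N + m - 1 = Suc a" "Suc a mod m = N mod m"
      using assms by (auto simp: a_def Suc_diff_Suc)
    then show ?thesis
      unfolding a_def[symmetric] by (simp add: div_Suc dvd_eq_mod_eq_0)
  qed
  with Suc show ?case by simp
qed (use assms in simp)

lemma sum_of_bool_dvd_bounds:
  assumes "m > 0"
  shows "real N / real m \<le> (\<Sum>n<N. of_bool (m dvd n))" "(\<Sum>n<N. of_bool (m dvd n)) \<le> real N / real m + 1"
proof -
  have "N \<le> m * ((N + m - 1) div m)"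
    using mult_div_mod_eq[of m "N + m - 1"] mod_less_divisor[OF assms, of "N + m - 1"] assms by linarith
  then have "real N \<le> real m * real ((N + m - 1) div m)"
    by (metis of_nat_le_iff of_nat_mult)
  then show "real N / real m \<le> (\<Sum>n<N. of_bool (m dvd n))"
    unfolding sum_of_bool_dvd[OF assms] using assms by (simp add: field_simps)
  have "m * ((N + m - 1) div m) \<le> N + m"
    by (meson diff_le_self le_trans times_div_less_eq_dividend)
  then have "real m * real ((N + m - 1) div m) \<le> real N + real m"
    by (metis of_nat_add of_nat_le_iff of_nat_mult)
  then show "(\<Sum>n<N. of_bool (m dvd n)) \<le> real N / real m + 1"
    unfolding sum_of_bool_dvd[OF assms] using assms by (simp add: field_simps)
qed

text \<open>Distinct primes have joint density \<open>1 / (p * q)\<close> by coprimality, so the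
  main terms of the expanded square add up to \<open>N * L^2\<close> and cancel against the rest.
  What survives is the diagonal \<open>N * L\<close> and a counting error of at most 1 per pair; as
  \<open>Q\<close> is fixed before \<open>N\<close>, that error is negligible.\<close>

lemma turan_kubilius:
  assumes "finite Q" "\<And>p. p \<in> Q \<Longrightarrow> prime p"
  defines "L \<equiv> (\<Sum>p\<in>Q. 1 / real p)"
  shows "(\<Sum>n<N. ((\<Sum>p\<in>Q. of_bool (p dvd n)) - L)\<^sup>2) \<le> real N * L + (real (card Q))\<^sup>2 + real (card Q)"
proof -
  let ?d = "\<lambda>p n. of_bool (p dvd n) :: real"
  let ?k = "real (card Q)"
  have pos: "p > 0" if "p \<in> Q" for p
    using assms(2)[OF that] by (rule prime_gt_0_nat)
  have L0: "L \<ge> 0"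
    unfolding L_def by (rule sum_nonneg) simp
  have pair: "(\<Sum>n<N. ?d p n * ?d q n) \<le> (real N * (1 / p * (1 / q)) + 1) + (if p = q then real N * (1 / p) + 1 else 0)"
    if "p \<in> Q" "q \<in> Q" for p q
  proof (cases "p = q")
    case True
    have "(\<Sum>n<N. ?d p n * ?d q n) = (\<Sum>n<N. ?d p n)"
      using True by (intro sum.cong) auto
    also have "\<dots> \<le> real N / p + 1"
      using sum_of_bool_dvd_bounds(2) pos that by blast
    also have "\<dots> \<le> (real N * (1 / p * (1 / p)) + 1) + (real N * (1 / p) + 1)"
      by simp
    finally show ?thesis
      using True by simp
  next
    case False
    then have cop: "coprime p q"
      using assms(2) that by (simp add: primes_coprime)
    have "(\<Sum>n<N. ?d p n * ?d q n) = (\<Sum>n<N. ?d (p * q) n)"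
      using cop by (intro sum.cong) (auto simp: divides_mult intro: dvd_mult_left dvd_mult_right)
    also have "\<dots> \<le> real N / (p * q) + 1"
      using sum_of_bool_dvd_bounds(2)[of "p * q" N] pos that by auto
    finally show ?thesis
      using False by simp
  qed
  have 1: "(\<Sum>n<N. (\<Sum>p\<in>Q. ?d p n)\<^sup>2) \<le> real N * L\<^sup>2 + ?k\<^sup>2 + real N * L + ?k"
  proof -
    have "(\<Sum>n<N. (\<Sum>p\<in>Q. ?d p n)\<^sup>2) = (\<Sum>n<N. \<Sum>p\<in>Q. \<Sum>q\<in>Q. ?d p n * ?d q n)"
      by (simp add: power2_eq_square sum_product)
    also have "\<dots> = (\<Sum>p\<in>Q. \<Sum>n<N. \<Sum>q\<in>Q. ?d p n * ?d q n)"
      by (rule sum.swap)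
    also have "\<dots> = (\<Sum>p\<in>Q. \<Sum>q\<in>Q. \<Sum>n<N. ?d p n * ?d q n)"
      by (intro sum.cong refl sum.swap)
    also have "\<dots> \<le> (\<Sum>p\<in>Q. \<Sum>q\<in>Q. (real N * (1 / p * (1 / q)) + 1) + (if p = q then real N * (1 / p) + 1 else 0))"
      by (intro sum_mono pair)
    also have "\<dots> = real N * (\<Sum>p\<in>Q. \<Sum>q\<in>Q. 1 / p * (1 / q)) + ?k\<^sup>2 + (real N * L + ?k)"
      using assms(1) by (simp add: sum.distrib sum_distrib_left L_def sum.delta power2_eq_square)
    also have "(\<Sum>p\<in>Q. \<Sum>q\<in>Q. 1 / p * (1 / q)) = L\<^sup>2"
      unfolding L_def power2_eq_square sum_product by simp
    finally show ?thesis by simp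
  qed
  have 2: "(\<Sum>n<N. \<Sum>p\<in>Q. ?d p n) \<ge> real N * L"
  proof -
    have "real N * L = (\<Sum>p\<in>Q. real N / p)"
      by (simp add: L_def sum_distrib_left)
    also have "\<dots> \<le> (\<Sum>p\<in>Q. \<Sum>n<N. ?d p n)"
      by (intro sum_mono sum_of_bool_dvd_bounds(1) pos)
    also have "\<dots> = (\<Sum>n<N. \<Sum>p\<in>Q. ?d p n)"
      by (rule sum.swap)
    finally show ?thesis .
  qed
  have "(\<Sum>n<N. ((\<Sum>p\<in>Q. ?d p n) - L)\<^sup>2) =
      (\<Sum>n<N. (\<Sum>p\<in>Q. ?d p n)\<^sup>2 + L\<^sup>2 - 2 * L * (\<Sum>p\<in>Q. ?d p n))"
    by (intro sum.cong refl) (simp add: power2_diff)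
  also have "\<dots> = (\<Sum>n<N. (\<Sum>p\<in>Q. ?d p n)\<^sup>2) + N * L\<^sup>2 - 2 * L * (\<Sum>n<N. \<Sum>p\<in>Q. ?d p n)"
    by (simp add: sum.distrib sum_subtractf sum_distrib_left)
  also have "\<dots> \<le> (real N * L\<^sup>2 + ?k\<^sup>2 + real N * L + ?k) + N * L\<^sup>2 - 2 * L * (real N * L)"
    using 1 mult_left_mono[OF 2, of "2 * L"] L0 by linarith
  also have "\<dots> = real N * L + ?k\<^sup>2 + ?k"
    by (simp add: power2_eq_square algebra_simps)
  finally show ?thesis .
qed

lemma sum_inverse_squares_le:
  fixes Q :: "nat set"
  assumes "finite Q" "0 \<notin> Q"
  shows "(\<Sum>p\<in>Q. 1 / real p ^ 2) \<le> 2"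
proof -
  have s: "(\<lambda>n. 1 / real (Suc n) ^ 2) sums (pi\<^sup>2 / 6)"
    using inverse_squares_sums by (simp add: add.commute)
  have "(\<Sum>p\<in>Q. 1 / real p ^ 2) = (\<Sum>n\<in>(\<lambda>p. p - 1) ` Q. 1 / real (Suc n) ^ 2)"
  proof (rule sum.reindex_bij_witness[of _ Suc "\<lambda>p. p - 1"])
    fix p assume "p \<in> Q"
    then have "p \<noteq> 0" using assms by metis
    then show "Suc (p - 1) = p" "p - 1 \<in> (\<lambda>p. p - 1) ` Q" "1 / real (Suc (p - 1)) ^ 2 = 1 / real p ^ 2"
      using \<open>p \<in> Q\<close> by auto
  next
    fix n assume "n \<in> (\<lambda>p. p - 1) ` Q"
    then obtain p where "p \<in> Q" "n = p - 1" by blast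
    moreover have "p \<noteq> 0" using \<open>p \<in> Q\<close> assms by metis
    ultimately show "Suc n - 1 = n" "Suc n \<in> Q" by auto
  qed
  also have "\<dots> \<le> (\<Sum>n. 1 / real (Suc n) ^ 2)"
    using s assms(1) by (intro sum_le_suminf) (auto simp: sums_iff)
  also have "\<dots> = pi\<^sup>2 / 6"
    using s by (simp add: sums_iff)
  also have "\<dots> \<le> 2"
  proof -
    have "pi < 3.2" using pi_approx by simp
    then have "pi\<^sup>2 \<le> 3.2\<^sup>2" by (intro power_mono) auto
    then show ?thesis by (simp add: power2_eq_square)
  qed
  finally show ?thesis .
qed

text \<open>Weighting n by its number of prime divisors in \<open>Q\<close> multiplies the sum by
  about \<open>L\<close>, up to the variance just bounded. Writing n = p * m makes the weighted sum
  bilinear; Cauchy-Schwarz over m removes \<mu> and leaves the correlations at p * m and q * m,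
  small for p \<noteq> q, while the diagonal contributes about \<open>L\<close>. The gain is
  \<open>sqrt L\<close> against \<open>L\<close>.\<close>

lemma katai:
  fixes f :: "nat \<Rightarrow> complex"
  assumes f: "\<And>n. cmod (f n) \<le> 1"
    and P: "\<And>p. p \<in> P \<Longrightarrow> prime p"
    and div: "\<And>x::real. \<exists>Q. finite Q \<and> Q \<subseteq> P \<and> x \<le> (\<Sum>p\<in>Q. 1 / real p)"
    and cor: "\<And>p q. p \<in> P \<Longrightarrow> q \<in> P \<Longrightarrow> p \<noteq> q \<Longrightarrow> sublinear (\<lambda>N. \<Sum>n<N. f (p * n) * cnj (f (q * n)))"
  shows "sublinear (\<lambda>N. \<Sum>n<N. of_int (moebius_mu n) * f n)"
proof (rule sublinearI)
  fix \<epsilon> :: real assume "\<epsilon> > 0"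
  \<comment> \<open>The three error terms at the end add up to (3 + 2 + 2) * \<open>sqrt L\<close>,
    so \<open>L\<close> at least (7 / \<epsilon>)^2 makes them at most \<epsilon> *
    \<open>L\<close>.\<close>
  obtain Q where Q: "finite Q" "Q \<subseteq> P" "max 1 ((7 / \<epsilon>)\<^sup>2) \<le> (\<Sum>p\<in>Q. 1 / real p)"
    using div by blast
  define L where "L = (\<Sum>p\<in>Q. 1 / real p)"
  define k where "k = real (card Q)"
  have prime: "prime p" if "p \<in> Q" for p
    using that Q P by blast
  have pos: "p > 0" if "p \<in> Q" for p
    using prime[OF that] by (rule prime_gt_0_nat)
  have L1: "L \<ge> 1" and Le: "(7 / \<epsilon>)\<^sup>2 \<le> L"
    using Q(3) by (auto simp: L_def)
  have k0: "k > 0"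
    using L1 Q(1) by (auto simp: k_def L_def card_gt_0_iff)
  \<comment> \<open>There are at most k^2 pairs, so the off-diagonal correlations contribute at most
    \<open>N\<close> in total.\<close>
  define \<delta> where "\<delta> = 1 / k\<^sup>2"
  have "\<delta> > 0" using k0 by (simp add: \<delta>_def)
  define C where "C = (\<lambda>p q N. \<Sum>n<N. f (p * n) * cnj (f (q * n)))"
  \<comment> \<open>Uniformity over \<open>N' \<le> N\<close> is needed because the conditions p * m
    < N and q * m < N cut m at a point that depends on the pair.\<close>
  have C: "\<forall>\<^sub>F N in sequentially. \<forall>N'\<le>N. cmod (C p q N') \<le> \<delta> * real N"
    if "p \<in> Q" "q \<in> Q" "p \<noteq> q" for p q
  proof -
    have "\<forall>\<^sub>F N in sequentially. cmod (C p q N) \<le> \<delta> * real N"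
      using sublinearD[OF cor \<open>\<delta> > 0\<close>] that Q(2) by (auto simp: C_def)
    then obtain N0 where N0: "\<And>N. N \<ge> N0 \<Longrightarrow> cmod (C p q N) \<le> \<delta> * real N"
      by (auto simp: eventually_sequentially)
    have "\<forall>\<^sub>F N in sequentially. real N0 / \<delta> \<le> real N"
      by real_asymp
    then show ?thesis
    proof eventually_elim
      case (elim N)
      show ?case
      proof (intro allI impI)
        fix N' assume "N' \<le> N"
        show "cmod (C p q N') \<le> \<delta> * real N"
        proof (cases "N' \<ge> N0")
          case True
          have "cmod (C p q N') \<le> \<delta> * real N'"
            using N0 True by blast
          also have "\<dots> \<le> \<delta> * real N"
            using \<open>N' \<le> N\<close> \<open>\<delta> > 0\<close> by simp
          finally show ?thesis .
        next
          case False
          have "cmod (C p q N') \<le> (\<Sum>n<N'. 1)"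
            unfolding C_def using f by (intro sum_norm_le) (simp add: norm_mult mult_le_one)
          also have "\<dots> \<le> real N0"
            using False by simp
          also have "\<dots> \<le> \<delta> * real N"
            using elim \<open>\<delta> > 0\<close> by (simp add: field_simps)
          finally show ?thesis .
        qed
      qed
    qed
  qed
  have Call: "\<forall>\<^sub>F N in sequentially. \<forall>p\<in>Q. \<forall>q\<in>Q. p \<noteq> q \<longrightarrow> (\<forall>N'\<le>N. cmod (C p q N') \<le> \<delta> * real N)"
    using C Q(1) by (intro eventually_ball_finite ballI) (auto intro: eventually_mono)
  have "\<forall>\<^sub>F N in sequentially. k\<^sup>2 + k \<le> real N"
    by real_asymp
  with Call show "\<forall>\<^sub>F N in sequentially. cmod (\<Sum>n<N. of_int (moebius_mu n) * f n) \<le> \<epsilon> * real N"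
  proof eventually_elim
    case (elim N)
    let ?\<mu> = "\<lambda>n. complex_of_int (moebius_mu n)"
    define A where "A = (\<Sum>n<N. ?\<mu> n * f n)"
    let ?d = "\<lambda>p n. of_bool (p dvd n) :: real"
    have b1: "cmod (\<Sum>n<N. ?\<mu> n * f n * of_real ((\<Sum>p\<in>Q. ?d p n) - L)) \<le> real N * sqrt (L + 1)"
    proof -
      have "cmod (\<Sum>n<N. ?\<mu> n * f n * of_real ((\<Sum>p\<in>Q. ?d p n) - L)) \<le> (\<Sum>n<N. \<bar>(\<Sum>p\<in>Q. ?d p n) - L\<bar>)"
      proof (rule sum_norm_le)
        fix n
        have "cmod (?\<mu> n * f n) \<le> 1"
          using f cmod_moebius_mu_le by (simp add: norm_mult mult_le_one)
        then show "cmod (?\<mu> n * f n * of_real ((\<Sum>p\<in>Q. ?d p n) - L)) \<le> \<bar>(\<Sum>p\<in>Q. ?d p n) - L\<bar>"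
          unfolding norm_mult[of "?\<mu> n * f n"] norm_of_real by (rule mult_left_le_one_le[rotated 2]) auto
      qed
      also have "\<dots> \<le> real N * sqrt (L + 1)"
      proof (rule sum_nat_mult_le_sqrt)
        have "k\<^sup>2 + k \<le> real N * 1" using elim by simp
        then show "(\<Sum>n<N. (\<bar>(\<Sum>p\<in>Q. ?d p n) - L\<bar>)\<^sup>2) \<le> real N * (L + 1)"
          using turan_kubilius[OF Q(1) prime, of N] unfolding L_def k_def power2_abs
          by (simp add: algebra_simps)
      qed (use L1 in simp)
      finally show ?thesis .
    qed
    define G where "G = (\<lambda>m. \<Sum>p\<in>Q. of_bool (p * m < N) * f (p * m))"
    have b2: "cmod (\<Sum>m<N. ?\<mu> m * G m) \<le> real N * sqrt (L + 2)"
    proof -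
      have "cmod (\<Sum>m<N. ?\<mu> m * G m) \<le> (\<Sum>m<N. cmod (G m))"
        by (rule sum_norm_le) (use cmod_moebius_mu_le in \<open>simp add: norm_mult mult_left_le_one_le del: norm_of_int\<close>)
      also have "\<dots> \<le> real N * sqrt (L + 2)"
      proof (rule sum_nat_mult_le_sqrt)
        have "complex_of_real (\<Sum>m<N. (cmod (G m))\<^sup>2) = (\<Sum>m<N. \<Sum>p\<in>Q. \<Sum>q\<in>Q.
            of_bool (p * m < N \<and> q * m < N) * (f (p * m) * cnj (f (q * m))))"
          unfolding of_real_sum G_def cmod_sum_power2
          by (intro sum.cong refl) auto
        also have "\<dots> = (\<Sum>p\<in>Q. \<Sum>m<N. \<Sum>q\<in>Q.
            of_bool (p * m < N \<and> q * m < N) * (f (p * m) * cnj (f (q * m))))"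
          by (rule sum.swap)
        also have "\<dots> = (\<Sum>p\<in>Q. \<Sum>q\<in>Q. \<Sum>m<N.
            of_bool (p * m < N \<and> q * m < N) * (f (p * m) * cnj (f (q * m))))"
          by (intro sum.cong refl sum.swap)
        finally have eq: "complex_of_real (\<Sum>m<N. (cmod (G m))\<^sup>2) = \<dots>" .
        have pair: "cmod (\<Sum>m<N. of_bool (p * m < N \<and> q * m < N) * (f (p * m) * cnj (f (q * m))))
            \<le> \<delta> * N + (if p = q then N / p + 1 else 0)" if pq: "p \<in> Q" "q \<in> Q" for p q
        proof -
          define M where "M = max p q"
          have M: "M > 0" using pos pq by (simp add: M_def max_def)
          define N' where "N' = (N + M - 1) div M"
          have iff: "p * m < N \<and> q * m < N \<longleftrightarrow> m < N'" for m
          proof -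
            have "p * m < N \<and> q * m < N \<longleftrightarrow> M * m < N"
              by (auto simp: M_def max_def) (meson le_less_trans mult_le_mono1 nat_le_linear)+
            also have "\<dots> \<longleftrightarrow> m < N'"
              unfolding N'_def Suc_le_eq[symmetric, of m] less_eq_div_iff_mult_less_eq[OF M]
              using M by (auto simp: mult.commute)
            finally show ?thesis .
          qed
          have N'N: "N' \<le> N"
          proof -
            have "N \<le> p * N" using pos[OF pq(1)] by (cases p) auto
            then show ?thesis using iff[of N] by linarith
          qed
          have "{m. m < N \<and> m < N'} = {..<N'}"
            using N'N by auto
          then have "(\<Sum>m<N. of_bool (p * m < N \<and> q * m < N) * (f (p * m) * cnj (f (q * m)))) = C p q N'"
            unfolding C_def iff
            by (intro sum.mono_neutral_cong_right) (use N'N in auto)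
          moreover have "cmod (C p q N') \<le> \<delta> * N + (if p = q then N / p + 1 else 0)"
          proof (cases "p = q")
            case False
            then show ?thesis using elim(1) pq N'N by auto
          next
            case True
            have "cmod (C p q N') \<le> (\<Sum>n<N'. 1)"
              unfolding C_def using f by (intro sum_norm_le) (simp add: norm_mult mult_le_one)
            also have "\<dots> = (\<Sum>n<N. ?d p n)"
              using sum_of_bool_dvd[of M N] M True by (simp add: N'_def M_def)
            also have "\<dots> \<le> N / p + 1"
              using pos pq by (intro sum_of_bool_dvd_bounds(2)) auto
            finally show ?thesis
              using True \<open>\<delta> > 0\<close> by (simp add: add_increasing)
          qed
          ultimately show ?thesis by simp
        qed
        have "(\<Sum>m<N. (cmod (G m))\<^sup>2) = cmod (complex_of_real (\<Sum>m<N. (cmod (G m))\<^sup>2))"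
          unfolding norm_of_real by (simp add: sum_nonneg)
        also have "\<dots> \<le> (\<Sum>p\<in>Q. \<Sum>q\<in>Q. \<delta> * N + (if p = q then N / p + 1 else 0))"
          unfolding eq by (intro sum_norm_le pair)
        also have "\<dots> = k\<^sup>2 * (\<delta> * N) + N * L + k"
          using Q(1) by (simp add: sum.distrib k_def L_def sum_distrib_left power2_eq_square)
        also have "\<dots> \<le> real N * (L + 2)"
        proof -
          have "k \<le> real N" using elim(2) by (smt (verit) zero_le_power2)
          then show ?thesis using k0 by (simp add: \<delta>_def algebra_simps)
        qed
        finally show "(\<Sum>m<N. (cmod (G m))\<^sup>2) \<le> real N * (L + 2)" .
      qed (use L1 in simp)
      finally show ?thesis .
    qed
    \<comment> \<open>The rule \<mu>(p * m) = - \<mu>(m) fails when p divides m, where the left side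
      is 0. \<open>E\<close> collects these m; then p^2 divides p * m, so they are controlled by the
      sum of 1 / p^2.\<close>
    define E where "E = (\<Sum>p\<in>Q. \<Sum>m<N. of_bool (p * m < N \<and> p dvd m) * (?\<mu> m * f (p * m)))"
    have reidx: "(\<Sum>n<N. of_bool (p dvd n) * F n) = (\<Sum>m<N. of_bool (p * m < N) * F (p * m))"
      if "p \<in> Q" for p and F :: "nat \<Rightarrow> complex"
    proof -
      have "(\<Sum>n<N. of_bool (p dvd n) * F n) = sum F {n. n < N \<and> p dvd n}"
        by (intro sum.mono_neutral_cong_right) auto
      also have "\<dots> = (\<Sum>m | p * m < N. F (p * m))"
        by (rule sum.reindex_bij_witness[of _ "\<lambda>m. p * m" "\<lambda>n. n div p"]) (use pos[OF that] in auto)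
      also have "\<dots> = (\<Sum>m<N. of_bool (p * m < N) * F (p * m))"
      proof (intro sum.mono_neutral_cong_left)
        show "{m. p * m < N} \<subseteq> {..<N}"
          using pos[OF that] by (cases p) auto
      qed auto
      finally show ?thesis .
    qed
    have "(\<Sum>n<N. ?\<mu> n * f n * of_real (\<Sum>p\<in>Q. ?d p n)) = (\<Sum>n<N. \<Sum>p\<in>Q. of_bool (p dvd n) * (?\<mu> n * f n))"
      unfolding of_real_sum sum_distrib_left by (intro sum.cong refl) auto
    also have "\<dots> = (\<Sum>p\<in>Q. \<Sum>n<N. of_bool (p dvd n) * (?\<mu> n * f n))"
      by (rule sum.swap)
    also have "\<dots> = (\<Sum>p\<in>Q. \<Sum>m<N. of_bool (p * m < N) * (?\<mu> (p * m) * f (p * m)))"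
      by (intro sum.cong refl reidx)
    also have "\<dots> = (\<Sum>p\<in>Q. \<Sum>m<N. of_bool (p * m < N \<and> p dvd m) * (?\<mu> m * f (p * m)) -
         ?\<mu> m * (of_bool (p * m < N) * f (p * m)))"
      by (intro sum.cong refl) (simp add: moebius_mu_mult_prime[OF prime])
    also have "\<dots> = E - (\<Sum>p\<in>Q. \<Sum>m<N. ?\<mu> m * (of_bool (p * m < N) * f (p * m)))"
      by (simp add: E_def sum_subtractf)
    also have "(\<Sum>p\<in>Q. \<Sum>m<N. ?\<mu> m * (of_bool (p * m < N) * f (p * m))) = (\<Sum>m<N. ?\<mu> m * G m)"
      unfolding G_def sum_distrib_left by (rule sum.swap)
    finally have main: "(\<Sum>n<N. ?\<mu> n * f n * of_real (\<Sum>p\<in>Q. ?d p n)) = E - (\<Sum>m<N. ?\<mu> m * G m)" .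
    have b3: "cmod E \<le> 3 * real N"
    proof -
      have "cmod E \<le> (\<Sum>p\<in>Q. real N * (1 / real p ^ 2) + 1)"
        unfolding E_def
      proof (rule sum_norm_le)
        fix p assume p: "p \<in> Q"
        have "cmod (\<Sum>m<N. of_bool (p * m < N \<and> p dvd m) * (?\<mu> m * f (p * m))) \<le> (\<Sum>m<N. of_bool (p * m < N \<and> p dvd m))"
          using f cmod_moebius_mu_le by (intro sum_norm_le) (auto simp: norm_mult mult_le_one)
        also have "\<dots> = real (card {m. m < N \<and> p * m < N \<and> p dvd m})"
          by (simp add: sum.If_cases of_bool_def Collect_conj_eq lessThan_def)
        also have "\<dots> = real (card ((\<lambda>m. p * m) ` {m. m < N \<and> p * m < N \<and> p dvd m}))"
          using pos[OF p] by (subst card_image) (auto simp: inj_on_def)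
        also have "\<dots> \<le> real (card {n. n < N \<and> p\<^sup>2 dvd n})"
          by (intro of_nat_mono card_mono) (auto simp: power2_eq_square)
        also have "\<dots> = (\<Sum>n<N. ?d (p\<^sup>2) n)"
          by (simp add: sum.If_cases of_bool_def Collect_conj_eq lessThan_def)
        also have "\<dots> \<le> real N / real (p\<^sup>2) + 1"
          using pos[OF p] by (intro sum_of_bool_dvd_bounds(2)) auto
        finally show "cmod (\<Sum>m<N. of_bool (p * m < N \<and> p dvd m) * (?\<mu> m * f (p * m))) \<le> real N * (1 / real p ^ 2) + 1"
          by simp
      qed
      also have "\<dots> = real N * (\<Sum>p\<in>Q. 1 / real p ^ 2) + k"
        by (simp add: sum.distrib sum_distrib_left k_def)
      also have "\<dots> \<le> real N * 2 + real N"
      proof (rule add_mono)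
        show "real N * (\<Sum>p\<in>Q. 1 / real p ^ 2) \<le> real N * 2"
          using sum_inverse_squares_le[OF Q(1)] pos by (intro mult_left_mono) auto
        show "k \<le> real N" using elim(2) by (smt (verit) zero_le_power2)
      qed
      finally show ?thesis by simp
    qed
    have "of_real L * A = (\<Sum>n<N. ?\<mu> n * f n * of_real (\<Sum>p\<in>Q. ?d p n)) -
        (\<Sum>n<N. ?\<mu> n * f n * of_real ((\<Sum>p\<in>Q. ?d p n) - L))"
      unfolding A_def sum_distrib_left sum_subtractf[symmetric]
      by (intro sum.cong refl) (simp add: algebra_simps)
    then have LA: "of_real L * A = E - (\<Sum>m<N. ?\<mu> m * G m) -
        (\<Sum>n<N. ?\<mu> n * f n * of_real ((\<Sum>p\<in>Q. ?d p n) - L))"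
      unfolding main .
    have tri: "cmod (x - y - z) \<le> cmod x + cmod y + cmod z" for x y z
      using norm_triangle_ineq4[of "x - y" z] norm_triangle_ineq4[of x y] by linarith
    have "cmod (of_real L * A) \<le> cmod E + cmod (\<Sum>m<N. ?\<mu> m * G m) +
        cmod (\<Sum>n<N. ?\<mu> n * f n * of_real ((\<Sum>p\<in>Q. ?d p n) - L))"
      unfolding LA by (rule tri)
    also have "\<dots> \<le> 3 * real N + real N * sqrt (L + 2) + real N * sqrt (L + 1)"
      using b1 b2 b3 by linarith
    also have "\<dots> \<le> real N * (7 * sqrt L)"
    proof -
      have "sqrt (L + 2) \<le> 2 * sqrt L" "sqrt (L + 1) \<le> 2 * sqrt L" "1 \<le> sqrt L"
        using L1 by (auto intro!: real_le_lsqrt simp: power_mult_distrib)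
      then have "3 + sqrt (L + 2) + sqrt (L + 1) \<le> 7 * sqrt L" by linarith
      from mult_left_mono[OF this, of "real N"] show ?thesis by (simp add: algebra_simps)
    qed
    finally have "L * cmod A \<le> real N * (7 * sqrt L)"
      using L1 by (simp add: norm_mult)
    moreover have "7 * sqrt L \<le> L * \<epsilon>"
    proof -
      have "7 / \<epsilon> \<le> sqrt L"
        using Le by (rule real_le_rsqrt)
      then have "7 \<le> sqrt L * \<epsilon>"
        using \<open>\<epsilon> > 0\<close> by (simp add: field_simps)
      from mult_right_mono[OF this, of "sqrt L"] have "7 * sqrt L \<le> (sqrt L * sqrt L) * \<epsilon>"
        using L1 by (simp add: mult_ac)
      then show ?thesis
        using L1 by simp
    qed
    then have "real N * (7 * sqrt L) \<le> real N * (L * \<epsilon>)"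
      by (rule mult_left_mono) simp
    ultimately have "L * cmod A \<le> L * (\<epsilon> * real N)"
      by (simp add: mult_ac)
    then show ?case
      using L1 unfolding A_def by simp
  qed
qed

section \<open>Van der Corput and Weyl sums\<close>

lemma cmod_sum_cnj_commute:
  "cmod (\<Sum>w\<in>A. f w * cnj (g w)) = cmod (\<Sum>w\<in>A. g w * cnj (f w))"
proof -
  have "(\<Sum>w\<in>A. f w * cnj (g w)) = cnj (\<Sum>w\<in>A. g w * cnj (f w))"
    by (simp add: mult.commute)
  then show ?thesis by (simp only: complex_mod_cnj)
qed

text \<open>The averaging half of the inequality: shifting by r changes the sum by at most 2 * r,
  and over r < R these losses add up to at most R^2. As \<open>z\<close> is defined on all naturals,
  the inner sums run over full ranges without truncation at the boundary.\<close>

lemma van_der_corput: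
  fixes z :: "nat \<Rightarrow> complex"
  assumes z: "\<And>n. cmod (z n) \<le> 1"
  shows "real R * cmod (\<Sum>w<W. z w) \<le> (\<Sum>w<W. cmod (\<Sum>r<R. z (w + r))) + (real R)\<^sup>2"
proof -
  have diff: "cmod ((\<Sum>w<W. z w) - (\<Sum>w<W. z (w + r))) \<le> 2 * real r" for r
  proof (induction r)
    case (Suc r)
    have "(\<Sum>w<W. z (w + r)) - (\<Sum>w<W. z (w + Suc r)) = z r - z (W + r)"
      using sum_lessThan_telescope'[of "\<lambda>w. z (w + r)" W] by (simp add: sum_subtractf)
    then have "(\<Sum>w<W. z w) - (\<Sum>w<W. z (w + Suc r)) =
        ((\<Sum>w<W. z w) - (\<Sum>w<W. z (w + r))) + (z r - z (W + r))"
      by (simp add: algebra_simps)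
    also have "cmod \<dots> \<le> 2 * real r + (cmod (z r) + cmod (z (W + r)))"
      using Suc by (intro norm_triangle_le add_mono norm_triangle_ineq4) 
    also have "\<dots> \<le> 2 * real (Suc r)"
      using z[of r] z[of "W + r"] by simp
    finally show ?case .
  qed simp
  have "real R * cmod (\<Sum>w<W. z w) = cmod (\<Sum>r<R. \<Sum>w<W. z w)"
    by (simp add: norm_mult)
  also have "(\<Sum>r<R. \<Sum>w<W. z w) = (\<Sum>r<R. (\<Sum>w<W. z w) - (\<Sum>w<W. z (w + r))) + (\<Sum>w<W. \<Sum>r<R. z (w + r))"
    by (subst (2) sum.swap) (simp add: sum_subtractf)
  also have "cmod \<dots> \<le> (\<Sum>r<R. 2 * real r) + (\<Sum>w<W. cmod (\<Sum>r<R. z (w + r)))"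
    by (intro norm_triangle_le add_mono sum_norm_le diff order_refl)
  also have "(\<Sum>r<R. 2 * real r) \<le> (real R)\<^sup>2"
    by (induction R) (auto simp: power2_eq_square algebra_simps)
  finally show ?thesis by simp
qed

text \<open>The other half of every differencing: expanding the square separates the diagonal from
  the correlations. It is applied with r as a shift, as a frequency, and as the index along a
  progression.\<close>

lemma sum_cmod_power2_le:
  fixes z :: "'a \<Rightarrow> 'b \<Rightarrow> complex"
  assumes "finite R" "\<And>r. r \<in> R \<Longrightarrow> cmod (\<Sum>w\<in>W. z w r * cnj (z w r)) \<le> x"
    and "\<And>r r'. r \<in> R \<Longrightarrow> r' \<in> R \<Longrightarrow> r \<noteq> r' \<Longrightarrow> cmod (\<Sum>w\<in>W. z w r * cnj (z w r')) \<le> y" "y \<ge> 0"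
  shows "(\<Sum>w\<in>W. (cmod (\<Sum>r\<in>R. z w r))\<^sup>2) \<le> real (card R) * x + (real (card R))\<^sup>2 * y"
proof -
  have "complex_of_real (\<Sum>w\<in>W. (cmod (\<Sum>r\<in>R. z w r))\<^sup>2) = (\<Sum>w\<in>W. \<Sum>r\<in>R. \<Sum>r'\<in>R. z w r * cnj (z w r'))"
    unfolding of_real_sum cmod_sum_power2 ..
  also have "\<dots> = (\<Sum>r\<in>R. \<Sum>w\<in>W. \<Sum>r'\<in>R. z w r * cnj (z w r'))"
    by (rule sum.swap)
  also have "\<dots> = (\<Sum>r\<in>R. \<Sum>r'\<in>R. \<Sum>w\<in>W. z w r * cnj (z w r'))"
    by (intro sum.cong refl sum.swap)
  finally have eq: "complex_of_real (\<Sum>w\<in>W. (cmod (\<Sum>r\<in>R. z w r))\<^sup>2) = \<dots>" .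
  have "(\<Sum>w\<in>W. (cmod (\<Sum>r\<in>R. z w r))\<^sup>2) = cmod (complex_of_real (\<Sum>w\<in>W. (cmod (\<Sum>r\<in>R. z w r))\<^sup>2))"
    unfolding norm_of_real by (simp add: sum_nonneg)
  also have "\<dots> \<le> (\<Sum>r\<in>R. \<Sum>r'\<in>R. (if r = r' then x else 0) + y)"
    unfolding eq
  proof (intro sum_norm_le)
    fix r r' assume "r \<in> R" "r' \<in> R"
    then show "cmod (\<Sum>w\<in>W. z w r * cnj (z w r')) \<le> (if r = r' then x else 0) + y"
      using assms(2)[of r] assms(3)[of r r'] assms(4) by (auto simp: add_increasing2)
  qed
  also have "\<dots> = real (card R) * x + (real (card R))\<^sup>2 * y"
    using assms(1) by (simp add: sum.distrib power2_eq_square algebra_simps)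
  finally show ?thesis .
qed

lemma sublinear_van_der_corput:
  fixes z :: "nat \<Rightarrow> complex"
  assumes z: "\<And>n. cmod (z n) \<le> 1"
    and cor: "\<And>r. r > 0 \<Longrightarrow> sublinear (\<lambda>N. \<Sum>n<N. z n * cnj (z (n + r)))"
  shows "sublinear (\<lambda>N. \<Sum>n<N. z n)"
proof (rule sublinearI)
  fix \<epsilon> :: real assume "\<epsilon> > 0"
  \<comment> \<open>\<open>R\<close> at least 8 / \<epsilon>^2 is what makes
    \<open>sqrt (2 * R)\<close> at most \<open>R * \<epsilon> / 2\<close> at the end.\<close>
  obtain R0 :: nat where R0: "8 / \<epsilon>\<^sup>2 \<le> real R0"
    using real_arch_simple by blast
  define R where "R = Suc R0"
  have R: "real R \<ge> 8 / \<epsilon>\<^sup>2" "R > 0"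
    using R0 by (auto simp: R_def)
  define \<delta> where "\<delta> = 1 / (2 * real R)"
  have \<delta>: "\<delta> > 0" using R by (simp add: \<delta>_def)
  have "\<forall>\<^sub>F N in sequentially. \<forall>r\<in>{0<..R}. cmod (\<Sum>n<N. z n * cnj (z (n + r))) \<le> \<delta> * real N"
    by (intro eventually_ball_finite ballI sublinearD[OF cor \<delta>]) auto
  moreover have "\<forall>\<^sub>F N in sequentially. 4 * (real R)\<^sup>2 + 2 * real R / \<epsilon> \<le> real N"
    by real_asymp
  ultimately show "\<forall>\<^sub>F N in sequentially. cmod (\<Sum>n<N. z n) \<le> \<epsilon> * real N"
  proof eventually_elim
    case (elim N)
    \<comment> \<open>Only r' - r matters, up to moving the start of the summation by r at a cost of
      2 * r. This cost and the correlation at shift r' - r each take half of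
      \<open>N / R\<close>.\<close>
    have gt: "cmod (\<Sum>w<N. z (w + r) * cnj (z (w + r'))) \<le> real N / real R" if "r < r'" "r' < R" for r r'
    proof -
      define Z where "Z = (\<lambda>n. z n * cnj (z (n + (r' - r))))"
      have Z1: "cmod (Z n) \<le> 1" for n
        using z by (simp add: Z_def norm_mult mult_le_one)
      have shift: "cmod ((\<Sum>w<N. Z (w + k)) - (\<Sum>w<N. Z w)) \<le> 2 * real k" for k
      proof (induction k)
        case (Suc k)
        have "(\<Sum>w<N. Z (w + Suc k)) - (\<Sum>w<N. Z w) =
            ((\<Sum>w<N. Z (w + k)) - (\<Sum>w<N. Z w)) + (Z (N + k) - Z k)"
          using sum_lessThan_telescope[of "\<lambda>w. Z (w + k)" N] by (simp add: sum_subtractf algebra_simps)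
        also have "cmod \<dots> \<le> 2 * real k + (cmod (Z (N + k)) + cmod (Z k))"
          using Suc by (intro norm_triangle_le add_mono norm_triangle_ineq4) 
        also have "\<dots> \<le> 2 * real (Suc k)"
          using Z1[of k] Z1[of "N + k"] by simp
        finally show ?case .
      qed simp
      have "(\<Sum>w<N. z (w + r) * cnj (z (w + r'))) = (\<Sum>w<N. Z (w + r))"
        using that by (simp add: Z_def algebra_simps)
      also have "\<dots> = ((\<Sum>w<N. Z (w + r)) - (\<Sum>w<N. Z w)) + (\<Sum>w<N. Z w)"
        by simp
      also have "cmod \<dots> \<le> 2 * real r + \<delta> * real N"
      proof (intro norm_triangle_le add_mono)
        show "cmod (\<Sum>w<N. Z w) \<le> \<delta> * real N"
          unfolding Z_def using bspec[OF elim(1), of "r' - r"] that by simp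
      qed (rule shift)
      also have "2 * real r \<le> real N / (2 * real R)"
      proof -
        have "4 * real r * real R \<le> 4 * (real R)\<^sup>2"
          using that by (simp add: power2_eq_square mult_right_mono)
        also have "\<dots> \<le> real N"
          by (rule order_trans[OF _ elim(2)]) (use \<open>\<epsilon> > 0\<close> in simp)
        finally show ?thesis using R by (simp add: field_simps)
      qed
      finally show ?thesis using R by (simp add: \<delta>_def field_simps)
    qed
    have "(\<Sum>w<N. (cmod (\<Sum>r<R. z (w + r)))\<^sup>2) \<le> real (card {..<R}) * real N + (real (card {..<R}))\<^sup>2 * (real N / real R)"
    proof (rule sum_cmod_power2_le)
      fix r
      have "cmod (\<Sum>w<N. z (w + r) * cnj (z (w + r))) \<le> (\<Sum>w<N. 1)"
        by (intro sum_norm_le) (simp add: norm_mult z mult_le_one)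
      then show "cmod (\<Sum>w<N. z (w + r) * cnj (z (w + r))) \<le> real N" by simp
    next
      fix r r' assume r: "r \<in> {..<R}" "r' \<in> {..<R}" "r \<noteq> r'"
      show "cmod (\<Sum>w<N. z (w + r) * cnj (z (w + r'))) \<le> real N / real R"
      proof (cases "r < r'")
        case False
        then have "r' < r" using r by simp
        then show ?thesis
          using gt[of r' r] r by (subst cmod_sum_cnj_commute) auto
      qed (use gt r in auto)
    qed auto
    also have "\<dots> = real N * (2 * real R)"
      using R by (simp add: power2_eq_square)
    finally have "(\<Sum>w<N. cmod (\<Sum>r<R. z (w + r))) \<le> real N * sqrt (2 * real R)"
      by (rule sum_nat_mult_le_sqrt) simp
    then have "real R * cmod (\<Sum>w<N. z w) \<le> real N * sqrt (2 * real R) + (real R)\<^sup>2"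
      using van_der_corput[of z R N] z by simp
    also have "\<dots> \<le> real R * (\<epsilon> * real N)"
    proof -
      have "8 \<le> real R * \<epsilon>\<^sup>2" using R \<open>\<epsilon> > 0\<close> by (simp add: field_simps)
      then have "8 * real R \<le> real R * (real R * \<epsilon>\<^sup>2)"
        using mult_left_mono[of 8 "real R * \<epsilon>\<^sup>2" "real R"] by (simp add: mult_ac)
      then have "sqrt (2 * real R) \<le> real R * \<epsilon> / 2"
        using \<open>\<epsilon> > 0\<close> by (intro real_le_lsqrt) (auto simp: power2_eq_square field_simps)
      then have 1: "real N * sqrt (2 * real R) \<le> real N * (real R * \<epsilon> / 2)"
        by (rule mult_left_mono) simp
      have "2 * real R / \<epsilon> \<le> real N"
        using elim(2) by (smt (verit) zero_le_power2)
      then have "real R \<le> \<epsilon> * real N / 2"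
        using \<open>\<epsilon> > 0\<close> by (simp add: field_simps)
      then have "real R * real R \<le> real R * (\<epsilon> * real N / 2)"
        by (rule mult_left_mono) simp
      then show ?thesis using 1 by (simp add: power2_eq_square algebra_simps)
    qed
    finally show ?case using R(2) by simp
  qed
qed

section \<open>Additive characters and Weyl sums over squares\<close>

definition unit_exp :: "real \<Rightarrow> complex" where
  "unit_exp x = cis (2 * pi * x)"

lemma unit_exp_add: "unit_exp (x + y) = unit_exp x * unit_exp y"
  by (simp add: unit_exp_def cis_mult algebra_simps)

lemma unit_exp_diff: "unit_exp (x - y) = unit_exp x * cnj (unit_exp y)"
  by (simp add: unit_exp_def cis_mult cis_cnj algebra_simps)

lemma unit_exp_0 [simp]: "unit_exp 0 = 1"
  by (simp add: unit_exp_def)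

lemma cmod_unit_exp [simp]: "cmod (unit_exp x) = 1"
  by (simp add: unit_exp_def)

lemma unit_exp_power: "unit_exp (real n * x) = unit_exp x ^ n"
  by (simp add: unit_exp_def Complex.DeMoivre mult_ac)

lemma unit_exp_of_int [simp]: "unit_exp (of_int k) = 1"
  by (simp add: unit_exp_def cis_multiple_2pi)

lemma unit_exp_eq_1_iff: "unit_exp x = 1 \<longleftrightarrow> x \<in> \<int>"
proof
  assume "unit_exp x = 1"
  then have "cos (2 * pi * x) = 1"
    by (simp add: unit_exp_def complex_eq_iff)
  then obtain n :: int where "2 * pi * x = of_int n * 2 * pi"
    using cos_one_2pi_int by blast
  then have "x = of_int n" by simp
  then show "x \<in> \<int>" by simp
qed (auto elim: Ints_cases)

lemma sum_unit_exp_eq_0: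
  assumes "W > 0" "\<not> int W dvd m"
  shows "(\<Sum>w<W. unit_exp (of_int m * real w / real W)) = 0"
proof -
  define x where "x = unit_exp (of_int m / real W)"
  have pow: "unit_exp (of_int m * real w / real W) = x ^ w" for w
    unfolding x_def unit_exp_power[symmetric] by (simp add: mult.commute)
  have "x \<noteq> 1"
  proof
    assume "x = 1"
    then obtain k where "of_int m / real W = of_int k"
      unfolding x_def unit_exp_eq_1_iff by (auto elim: Ints_cases)
    then have "of_int m = real_of_int (k * int W)"
      using assms(1) by (simp add: field_simps)
    then have "m = k * int W" by linarith
    then show False using assms(2) by simp
  qed
  moreover have "x ^ W = 1"
    unfolding pow[symmetric] using assms(1) by simp
  ultimately show ?thesis
    unfolding pow by (simp add: sum_gp_strict)
qed

text \<open>Differencing the phase k * w^2 / W leaves the linear phase 2 * k * (r - r') * w / W over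
  a complete period. As 0 < 2 * k * |r - r'| < W this sum vanishes exactly, so only the diagonal
  survives; \<gamma> ends up in a unimodular constant.\<close>

lemma sum_quadratic_unit_exp_le:
  fixes \<gamma> :: real
  assumes "k > 0" "R > 0" "2 * k * R < W"
  shows "cmod (\<Sum>w<W. unit_exp (real k * ((real w)\<^sup>2 / real W + \<gamma> * real w))) \<le> real W / sqrt (real R) + real R"
proof -
  define z where "z = (\<lambda>w. unit_exp (real k * ((real w)\<^sup>2 / real W + \<gamma> * real w)))"
  have W: "W > 0" using assms by linarith
  have "(\<Sum>w<W. (cmod (\<Sum>r<R. z (w + r)))\<^sup>2) \<le> real (card {..<R}) * real W + (real (card {..<R}))\<^sup>2 * 0"
  proof (rule sum_cmod_power2_le)
    fix r
    have "cmod (\<Sum>w<W. z (w + r) * cnj (z (w + r))) \<le> (\<Sum>w<W. 1)"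
      by (intro sum_norm_le) (simp add: norm_mult z_def)
    then show "cmod (\<Sum>w<W. z (w + r) * cnj (z (w + r))) \<le> real W" by simp
  next
    fix r r' assume r: "r \<in> {..<R}" "r' \<in> {..<R}" "r \<noteq> r'"
    define m where "m = 2 * int k * (int r - int r')"
    define c where "c = real k * (((real r)\<^sup>2 - (real r')\<^sup>2) / real W + \<gamma> * (real r - real r'))"
    have "z (w + r) * cnj (z (w + r')) = unit_exp c * unit_exp (of_int m * real w / real W)" for w
      unfolding z_def unit_exp_diff[symmetric] unit_exp_add[symmetric] m_def c_def using W
      by (intro arg_cong[of _ _ unit_exp]) (simp add: field_simps power2_eq_square)
    then have "(\<Sum>w<W. z (w + r) * cnj (z (w + r'))) = unit_exp c * (\<Sum>w<W. unit_exp (of_int m * real w / real W))"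
      by (simp add: sum_distrib_left)
    moreover have "\<not> int W dvd m"
    proof
      assume "int W dvd m"
      moreover have "m \<noteq> 0" using r assms by (simp add: m_def)
      ultimately have "int W \<le> \<bar>m\<bar>" by (metis abs_of_nat dvd_imp_le_int)
      moreover have "\<bar>m\<bar> = 2 * int k * \<bar>int r - int r'\<bar>" by (simp add: m_def abs_mult)
      moreover have "\<dots> \<le> 2 * int k * int R"
        using r by (intro mult_left_mono) auto
      moreover have "\<dots> < int W" using assms(3) by (metis of_nat_less_iff of_nat_mult of_nat_numeral)
      ultimately show False by linarith
    qed
    ultimately show "cmod (\<Sum>w<W. z (w + r) * cnj (z (w + r'))) \<le> 0"
      using sum_unit_exp_eq_0[OF W] by simp
  qed auto
  then have "(\<Sum>w<W. cmod (\<Sum>r<R. z (w + r))) \<le> real W * sqrt (real R)"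
    by (intro sum_nat_mult_le_sqrt) (auto simp: mult.commute)
  moreover have "real R * cmod (\<Sum>w<W. z w) \<le> (\<Sum>w<W. cmod (\<Sum>r<R. z (w + r))) + (real R)\<^sup>2"
    by (rule van_der_corput) (simp add: z_def)
  ultimately have "real R * cmod (\<Sum>w<W. z w) \<le> real W * sqrt (real R) + (real R)\<^sup>2"
    by linarith
  also have "\<dots> = real R * (real W / sqrt (real R) + real R)"
    using assms(2) by (simp add: field_simps power2_eq_square)
  finally show ?thesis
    using assms(2) by (simp add: z_def)
qed

text \<open>A Fejer kernel majorises the cell; only this upper bound, not equidistribution itself, is needed.\<close>

lemma card_square_cell_le:
  assumes B: "B \<ge> 8" and W: "2 * B ^ 3 < W" and a: "a < B"
  shows "real (card {u. u < W * B \<and> u mod B = a \<and> (u\<^sup>2 div (W * B)) mod B = j}) \<le> 36 * real W / real B"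
proof -
  \<comment> \<open>For u = a + B * w this is u^2 / (W * B^2); the cell condition says that its
    fractional part lies in [j / B, (j + 1) / B).\<close>
  define \<xi> where "\<xi> = (\<lambda>w. (real (a + B * w))\<^sup>2 / (real W * (real B)\<^sup>2))"
  define T where "T = {w. w < W \<and> ((a + B * w)\<^sup>2 div (W * B)) mod B = j}"
  have "W > 0" "B > 0" using B W by auto
  have "{u. u < W * B \<and> u mod B = a \<and> (u\<^sup>2 div (W * B)) mod B = j} \<subseteq> (\<lambda>w. a + B * w) ` T"
  proof
    fix u assume u: "u \<in> {u. u < W * B \<and> u mod B = a \<and> (u\<^sup>2 div (W * B)) mod B = j}"
    then have "u = a + B * (u div B)" by (metis (mono_tags, lifting) mem_Collect_eq mod_mult_div_eq)
    moreover have "u div B < W" using u by (simp add: less_mult_imp_div_less)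
    ultimately show "u \<in> (\<lambda>w. a + B * w) ` T" using u by (auto simp: T_def intro!: image_eqI[of _ _ "u div B"])
  qed
  then have cT: "card {u. u < W * B \<and> u mod B = a \<and> (u\<^sup>2 div (W * B)) mod B = j} \<le> card T"
    by (intro surj_card_le) (auto simp: T_def)
  \<comment> \<open>With at most B / 8 frequencies, all phases of a point of the cell stay within an
    eighth of a turn, so each of the \<open>H\<close> terms has real part at least
    \<open>sqrt 2 / 2\<close>.\<close>
  define H where "H = B div 8"
  have "B \<le> 16 * H" and H: "H > 0" "8 * H \<le> B"
    using B unfolding H_def by presburger+
  then have H16: "real B / 16 \<le> real H"
    by linarith
  define y where "y = (\<lambda>w k. unit_exp (real k * (\<xi> w - real j / real B)))"
  define \<gamma> where "\<gamma> = 2 * real a / (real W * real B)"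
  have exp_k: "cmod (\<Sum>w<W. unit_exp (real k * \<xi> w)) \<le> 2 * real W / real B" if k: "k > 0" "k \<le> B" for k
  proof -
    have "unit_exp (real k * \<xi> w) = unit_exp (real k * ((real a)\<^sup>2 / (real W * (real B)\<^sup>2))) *
        unit_exp (real k * ((real w)\<^sup>2 / real W + \<gamma> * real w))" for w
      unfolding \<xi>_def \<gamma>_def unit_exp_add[symmetric] using \<open>W > 0\<close> \<open>B > 0\<close>
      by (intro arg_cong[of _ _ unit_exp]) (simp add: field_simps power2_eq_square)
    then have "cmod (\<Sum>w<W. unit_exp (real k * \<xi> w)) =
        cmod (\<Sum>w<W. unit_exp (real k * ((real w)\<^sup>2 / real W + \<gamma> * real w)))"
      by (simp add: sum_distrib_left[symmetric] norm_mult)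
    \<comment> \<open>Differencing length B^2 gives W / B + B^2, and W > 2 * B^3 absorbs the second
      term.\<close>
    also have "\<dots> \<le> real W / sqrt (real (B\<^sup>2)) + real (B\<^sup>2)"
    proof (rule sum_quadratic_unit_exp_le)
      have "2 * k * B\<^sup>2 \<le> 2 * B * B\<^sup>2" using k by simp
      also have "\<dots> < W" using W by (simp add: power3_eq_cube power2_eq_square)
      finally show "2 * k * B\<^sup>2 < W" .
    qed (use k \<open>B > 0\<close> in auto)
    also have "\<dots> \<le> real W / real B + real W / real B"
    proof -
      have "real (2 * B ^ 3) < real W" using W by (simp only: of_nat_less_iff)
      then have "real (B\<^sup>2) * real B \<le> real W" by (simp add: power3_eq_cube power2_eq_square)
      then show ?thesis using \<open>B > 0\<close> by (simp add: field_simps)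
    qed
    finally show ?thesis by simp
  qed
  have "(\<Sum>w<W. (cmod (\<Sum>k<H. y w k))\<^sup>2) \<le> real (card {..<H}) * real W + (real (card {..<H}))\<^sup>2 * (2 * real W / real B)"
  proof (rule sum_cmod_power2_le)
    fix k
    have "cmod (\<Sum>w<W. y w k * cnj (y w k)) \<le> (\<Sum>w<W. 1)"
      by (intro sum_norm_le) (simp add: norm_mult y_def)
    then show "cmod (\<Sum>w<W. y w k * cnj (y w k)) \<le> real W" by simp
  next
    have gt: "cmod (\<Sum>w<W. y w k * cnj (y w k')) \<le> 2 * real W / real B" if "k' < k" "k < H" for k k'
    proof -
      have "y w k * cnj (y w k') = unit_exp (- (real (k - k') * (real j / real B))) * unit_exp (real (k - k') * \<xi> w)" for w
        unfolding y_def unit_exp_diff[symmetric] unit_exp_add[symmetric] using that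
        by (intro arg_cong[of _ _ unit_exp]) (simp add: of_nat_diff algebra_simps diff_divide_distrib)
      then have "cmod (\<Sum>w<W. y w k * cnj (y w k')) = cmod (\<Sum>w<W. unit_exp (real (k - k') * \<xi> w))"
        by (simp add: sum_distrib_left[symmetric] norm_mult)
      then show ?thesis using exp_k[of "k - k'"] that H by auto
    qed
    fix k k' assume k: "k \<in> {..<H}" "k' \<in> {..<H}" "k \<noteq> k'"
    show "cmod (\<Sum>w<W. y w k * cnj (y w k')) \<le> 2 * real W / real B"
    proof (cases "k' < k")
      case False
      then have "k < k'" using k by simp
      then show ?thesis
        using gt[of k k'] k by (subst cmod_sum_cnj_commute) auto
    qed (use gt k in auto)
  qed auto
  then have up: "(\<Sum>w<W. (cmod (\<Sum>k<H. y w k))\<^sup>2) \<le> real H * real W + (real H)\<^sup>2 * (2 * real W / real B)"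
    by simp
  have low: "(real H)\<^sup>2 / 2 \<le> (cmod (\<Sum>k<H. y w k))\<^sup>2" if w: "w \<in> T" for w
  proof -
    define u where "u = a + B * w"
    define q where "q = u\<^sup>2 div (W * B) div B"
    define x where "x = u\<^sup>2 mod (W * B)"
    have "u\<^sup>2 = (W * B) * (B * q + j) + x"
      using w by (simp add: T_def u_def q_def x_def) (metis mod_mult_div_eq mult_div_mod_eq)
    then have "real (u\<^sup>2) = real W * real B * (real B * real q + real j) + real x"
      by (metis of_nat_add of_nat_mult)
    then have xi: "\<xi> w = real q + real j / real B + real x / (real W * (real B)\<^sup>2)"
      unfolding \<xi>_def u_def[symmetric] using \<open>W > 0\<close> \<open>B > 0\<close>
      by (simp add: field_simps power2_eq_square)
    define f where "f = real x / (real W * real B)"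
    have f: "0 \<le> f" "f < 1"
    proof -
      have "real x < real (W * B)"
        unfolding x_def using \<open>W > 0\<close> \<open>B > 0\<close> by (simp only: of_nat_less_iff) simp
      then show "f < 1" using \<open>W > 0\<close> \<open>B > 0\<close> by (simp add: f_def field_simps)
    qed (simp add: f_def)
    have yk: "y w k = unit_exp (real k * f / real B)" for k
    proof -
      have "real k * (\<xi> w - real j / real B) = of_int (int k * int q) + real k * f / real B"
        unfolding xi f_def by (simp add: algebra_simps power2_eq_square)
      then show ?thesis
        unfolding y_def by (simp only: unit_exp_add unit_exp_of_int mult_1)
    qed
    have "sqrt 2 / 2 \<le> Re (y w k)" if k: "k < H" for k
    proof -
      have "real k * f \<le> real k * 1" using f by (intro mult_left_mono) auto
      then have "8 * (real k * f) \<le> real B" using k H by linarith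
      then have "real k * f / real B \<le> 1 / 8" using \<open>B > 0\<close> by (simp add: field_simps)
      then have "2 * pi * (real k * f / real B) \<le> 2 * pi * (1 / 8)"
        by (intro mult_left_mono) auto
      then have "cos (pi / 4) \<le> cos (2 * pi * (real k * f / real B))"
        using f by (intro cos_monotone_0_pi_le) auto
      then show ?thesis
        unfolding yk unit_exp_def by (simp add: cos_45)
    qed
    then have "(\<Sum>k<H. sqrt 2 / 2) \<le> (\<Sum>k<H. Re (y w k))"
      by (intro sum_mono) auto
    then have "real H * (sqrt 2 / 2) \<le> Re (\<Sum>k<H. y w k)" by simp
    also have "\<dots> \<le> cmod (\<Sum>k<H. y w k)" by (rule complex_Re_le_cmod)
    finally have "(real H * (sqrt 2 / 2))\<^sup>2 \<le> (cmod (\<Sum>k<H. y w k))\<^sup>2"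
      by (intro power_mono) auto
    then show ?thesis by (simp add: power_mult_distrib power_divide)
  qed
  have "real (card T) * ((real H)\<^sup>2 / 2) = (\<Sum>w\<in>T. (real H)\<^sup>2 / 2)"
    by simp
  also have "\<dots> \<le> (\<Sum>w\<in>T. (cmod (\<Sum>k<H. y w k))\<^sup>2)"
    by (intro sum_mono low)
  also have "\<dots> \<le> (\<Sum>w<W. (cmod (\<Sum>k<H. y w k))\<^sup>2)"
    by (intro sum_mono2) (auto simp: T_def)
  also have "\<dots> \<le> real H * real W + (real H)\<^sup>2 * (2 * real W / real B)"
    by (rule up)
  also have "\<dots> = (2 * real W / real H + 4 * real W / real B) * ((real H)\<^sup>2 / 2)"
    using H(1) \<open>B > 0\<close> by (simp add: field_simps power2_eq_square)
  finally have "real (card T) \<le> 2 * real W / real H + 4 * real W / real B"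
    using H(1) by (simp only: mult_le_cancel_right_pos zero_less_power2 divide_pos_pos of_nat_0_less_iff
        zero_less_numeral zero_less_power)
  \<comment> \<open>\<open>B \<le> 16 * H\<close> turns 2 * W / H into 32 * W / B; together with 4 *
    W / B this is the constant 36.\<close>
  also have "2 * real W / real H \<le> 2 * real W / (real B / 16)"
    using H H16 \<open>B > 0\<close> by (intro divide_left_mono) auto
  finally show ?thesis
    using cT by (simp add: field_simps)
qed

section \<open>Correlations of periodic functions\<close>

lemma periodic_add_mult:
  fixes F :: "nat \<Rightarrow> 'a"
  assumes "\<And>j. F (j + B) = F j"
  shows "F (j + B * k) = F j"
proof (induction k)
  case (Suc k)
  then show ?case using assms[of "j + B * k"] by (simp add: algebra_simps)
qed simp

lemma periodic_mod:
  fixes F :: "nat \<Rightarrow> 'a"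
  assumes "\<And>j. F (j + B) = F j"
  shows "F (j mod B) = F j"
  using periodic_add_mult[of F B "j mod B" "j div B"] assms by simp

lemma sum_periodic_shift:
  fixes F :: "nat \<Rightarrow> 'a::cancel_comm_monoid_add"
  assumes "\<And>j. F (j + B) = F j"
  shows "(\<Sum>j<B. F (j + c)) = (\<Sum>j<B. F j)"
proof (induction c)
  case (Suc c)
  have "F c + (\<Sum>j<B. F (j + Suc c)) = (\<Sum>j<Suc B. F (j + c))"
    unfolding sum.lessThan_Suc_shift by simp
  also have "\<dots> = F c + (\<Sum>j<B. F (j + c))"
    using assms[of c] by (simp add: add.commute)
  finally show ?case using Suc by simp
qed simp

text \<open>\<open>m\<close> and \<open>B\<close> may share factors, and then a \<mapsto> m * a mod
  B is not injective. Recording the quotient as well, which is below \<open>m\<close>, restores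
  injectivity at the price of the factor \<open>m\<close>.\<close>

lemma sum_periodic_dilate_le:
  fixes f :: "nat \<Rightarrow> real"
  assumes per: "\<And>j. f (j + B) = f j" and f0: "\<And>j. f j \<ge> 0" and m: "m > 0"
  shows "(\<Sum>a<B. f (m * a)) \<le> real m * (\<Sum>z<B. f z)"
proof -
  let ?\<phi> = "\<lambda>a. ((m * a) mod B, (m * a) div B)"
  have inj: "inj_on ?\<phi> {..<B}"
  proof (rule inj_onI)
    fix a a' assume "?\<phi> a = ?\<phi> a'"
    then have "m * a = m * a'" by (metis Pair_inject mult_div_mod_eq)
    then show "a = a'" using m by simp
  qed
  have sub: "?\<phi> ` {..<B} \<subseteq> {..<B} \<times> {..<m}"
    using m by (auto simp: less_mult_imp_div_less)
  have "(\<Sum>a<B. f (m * a)) = (\<Sum>a<B. f (fst (?\<phi> a)))"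
    using periodic_mod[of f B] per by simp
  also have "\<dots> = (\<Sum>x\<in>?\<phi> ` {..<B}. f (fst x))"
    by (simp add: sum.reindex[OF inj])
  also have "\<dots> \<le> (\<Sum>x\<in>{..<B} \<times> {..<m}. f (fst x))"
    using sub f0 by (intro sum_mono2) auto
  also have "\<dots> = (\<Sum>z<B. \<Sum>q<m. f z)"
    by (simp only: sum.cartesian_product case_prod_unfold)
  also have "\<dots> = real m * (\<Sum>z<B. f z)"
    by (simp add: sum_distrib_left)
  finally show ?thesis .
qed

lemma parseval:
  assumes "B > 0"
  shows "(\<Sum>k<B. (cmod (\<Sum>j<B. x j * unit_exp (- (real j * real k / real B))))\<^sup>2) = real B * (\<Sum>j<B. (cmod (x j))\<^sup>2)"
proof -
  have orth: "(\<Sum>k<B. unit_exp ((real j' - real j) * real k / real B)) = (if j = j' then of_nat B else 0)"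
    if "j < B" "j' < B" for j j'
  proof (cases "j = j'")
    case False
    have "\<not> int B dvd (int j' - int j)"
    proof
      assume "int B dvd (int j' - int j)"
      then have "int B \<le> \<bar>int j' - int j\<bar>"
        using False by (metis abs_of_nat dvd_imp_le_int eq_iff_diff_eq_0 of_nat_eq_iff)
      then show False using that by linarith
    qed
    then show ?thesis using sum_unit_exp_eq_0[OF assms, of "int j' - int j"] False by simp
  qed simp
  have "complex_of_real (\<Sum>k<B. (cmod (\<Sum>j<B. x j * unit_exp (- (real j * real k / real B))))\<^sup>2) =
    (\<Sum>k<B. \<Sum>j<B. \<Sum>j'<B. x j * cnj (x j') * unit_exp ((real j' - real j) * real k / real B))"
    unfolding of_real_sum cmod_sum_power2
  proof (intro sum.cong refl)
    fix k j j'
    have "unit_exp ((real j' - real j) * real k / real B) =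
        unit_exp (- (real j * real k / real B) - (- (real j' * real k / real B)))"
      by (simp add: algebra_simps diff_divide_distrib)
    then show "x j * unit_exp (- (real j * real k / real B)) * cnj (x j' * unit_exp (- (real j' * real k / real B))) =
      x j * cnj (x j') * unit_exp ((real j' - real j) * real k / real B)"
      unfolding unit_exp_diff by (simp only: complex_cnj_mult mult_ac)
  qed
  also have "\<dots> = (\<Sum>j<B. \<Sum>k<B. \<Sum>j'<B. x j * cnj (x j') * unit_exp ((real j' - real j) * real k / real B))"
    by (rule sum.swap)
  also have "\<dots> = (\<Sum>j<B. \<Sum>j'<B. \<Sum>k<B. x j * cnj (x j') * unit_exp ((real j' - real j) * real k / real B))"
    by (intro sum.cong refl sum.swap)
  also have "\<dots> = (\<Sum>j<B. \<Sum>j'<B. if j = j' then x j * cnj (x j') * of_nat B else 0)"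
    by (intro sum.cong refl) (simp add: sum_distrib_left[symmetric] orth)
  also have "\<dots> = (\<Sum>j<B. x j * cnj (x j) * of_nat B)"
    by (intro sum.cong refl) simp
  also have "\<dots> = complex_of_real (real B * (\<Sum>j<B. (cmod (x j))\<^sup>2))"
    by (simp add: complex_norm_square sum_distrib_left mult.commute del: of_real_power)
  finally show ?thesis
    unfolding of_real_eq_iff .
qed

definition autocorrelation :: "nat \<Rightarrow> (nat \<Rightarrow> complex) \<Rightarrow> nat \<Rightarrow> complex" where
  "autocorrelation B \<psi> z = (\<Sum>j<B. \<psi> (j + z) * cnj (\<psi> j))"

lemma autocorrelation_periodic:
  assumes "\<And>j. \<psi> (j + B) = \<psi> j"
  shows "autocorrelation B \<psi> (z + B) = autocorrelation B \<psi> z"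
  unfolding autocorrelation_def using assms[of "j + z" for j] by (simp add: algebra_simps)

text \<open>The Fourier coefficients of the autocorrelation are the squared moduli of those of
  \<psi>. Parseval for both, with one squared modulus replaced by its maximum, bounds the mean
  square of the autocorrelation; Cauchy-Schwarz then bounds the mean.\<close>

lemma sum_cmod_autocorrelation_le:
  assumes B: "B > 0" and per: "\<And>j. \<psi> (j + B) = \<psi> j" and \<psi>: "\<And>j. cmod (\<psi> j) \<le> 1" and "\<delta> \<ge> 0"
    and fourier: "\<And>\<omega>. cmod (\<Sum>j<B. \<psi> j * unit_exp (\<omega> * real j)) \<le> \<delta> * real B"
  shows "(\<Sum>z<B. cmod (autocorrelation B \<psi> z)) \<le> \<delta> * (real B)\<^sup>2"
proof -
  define C where "C = (\<lambda>k. \<Sum>j<B. \<psi> j * unit_exp (- (real j * real k / real B)))"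
  have C: "complex_of_real ((cmod (C k))\<^sup>2) =
      (\<Sum>z<B. autocorrelation B \<psi> z * unit_exp (- (real z * real k / real B)))" for k
  proof -
    define F where "F = (\<lambda>j. \<psi> j * unit_exp (- (real j * real k / real B)))"
    have Fper: "F (j + B) = F j" for j
    proof -
      have "- (real (j + B) * real k / real B) = - (real j * real k / real B) + of_int (- int k)"
        using B by (simp add: field_simps)
      then have "unit_exp (- (real (j + B) * real k / real B)) = unit_exp (- (real j * real k / real B))"
        by (simp only: unit_exp_add unit_exp_of_int mult_1_right)
      then show ?thesis by (simp add: F_def per)
    qed
    have "complex_of_real ((cmod (C k))\<^sup>2) = (\<Sum>j<B. \<Sum>j'<B. F j * cnj (F j'))"
      unfolding C_def cmod_sum_power2 F_def ..
    also have "\<dots> = (\<Sum>j'<B. \<Sum>j<B. F j * cnj (F j'))"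
      by (rule sum.swap)
    also have "\<dots> = (\<Sum>j'<B. \<Sum>z<B. F (z + j') * cnj (F j'))"
      by (intro sum.cong refl sum_periodic_shift[symmetric]) (simp add: Fper)
    also have "\<dots> = (\<Sum>j'<B. \<Sum>z<B. \<psi> (j' + z) * cnj (\<psi> j') * unit_exp (- (real z * real k / real B)))"
    proof (intro sum.cong refl)
      fix j' z
      have "unit_exp (- (real z * real k / real B)) =
          unit_exp (- (real (z + j') * real k / real B) - (- (real j' * real k / real B)))"
        by (intro arg_cong[of _ _ unit_exp]) (simp add: add_divide_distrib distrib_right)
      then show "F (z + j') * cnj (F j') = \<psi> (j' + z) * cnj (\<psi> j') * unit_exp (- (real z * real k / real B))"
        unfolding unit_exp_diff by (simp only: F_def complex_cnj_mult mult_ac add.commute)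
    qed
    also have "\<dots> = (\<Sum>z<B. \<Sum>j'<B. \<psi> (j' + z) * cnj (\<psi> j') * unit_exp (- (real z * real k / real B)))"
      by (rule sum.swap)
    finally show ?thesis
      by (simp add: autocorrelation_def sum_distrib_right)
  qed
  have Cd: "cmod (C k) \<le> \<delta> * real B" for k
    using fourier[of "- (real k / real B)"] by (simp add: C_def mult.commute)
  have "real B * (\<Sum>z<B. (cmod (autocorrelation B \<psi> z))\<^sup>2) = (\<Sum>k<B. (cmod (complex_of_real ((cmod (C k))\<^sup>2)))\<^sup>2)"
    unfolding C parseval[OF B] ..
  also have "\<dots> = (\<Sum>k<B. (cmod (C k))\<^sup>2 * (cmod (C k))\<^sup>2)"
    by (simp add: power2_eq_square norm_mult)
  also have "\<dots> \<le> (\<Sum>k<B. (\<delta> * real B)\<^sup>2 * (cmod (C k))\<^sup>2)"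
    by (intro sum_mono mult_right_mono power_mono Cd) auto
  also have "\<dots> = (\<delta> * real B)\<^sup>2 * (real B * (\<Sum>j<B. (cmod (\<psi> j))\<^sup>2))"
    unfolding sum_distrib_left[symmetric] C_def parseval[OF B] ..
  also have "\<dots> \<le> (\<delta> * real B)\<^sup>2 * (real B * (\<Sum>j<B. 1))"
    using \<psi> by (intro mult_left_mono sum_mono) (auto simp: power_le_one)
  also have "\<dots> = real B * (real B * (\<delta> * real B)\<^sup>2)"
    by (simp add: mult_ac)
  finally have "(\<Sum>z<B. (cmod (autocorrelation B \<psi> z))\<^sup>2) \<le> real B * (\<delta> * real B)\<^sup>2"
    using B by simp
  then have "(\<Sum>z<B. cmod (autocorrelation B \<psi> z)) \<le> real B * sqrt ((\<delta> * real B)\<^sup>2)"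
    by (rule sum_nat_mult_le_sqrt) simp
  then show ?thesis
    using \<open>\<delta> \<ge> 0\<close> by (simp add: power2_eq_square[of "real B"] mult_ac)
qed

text \<open>Since y runs independently of j, expanding the square over t factors, for each a, into
  an autocorrelation of \<psi> at 2 * (t - t') * a and a sum over y that is at most \<open>B\<close>
  in modulus. All the saving comes from \<psi>.\<close>

lemma sum_correlations_le:
  assumes B: "B > 0" and \<delta>: "\<delta> \<ge> 0"
    and per: "\<And>j. \<psi> (j + B) = \<psi> j" "\<And>j. \<psi>' (j + B) = \<psi>' j"
    and \<psi>: "\<And>j. cmod (\<psi> j) \<le> 1" "\<And>j. cmod (\<psi>' j) \<le> 1"
    and fourier: "\<And>\<omega>. cmod (\<Sum>j<B. \<psi> j * unit_exp (\<omega> * real j)) \<le> \<delta> * real B"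
  shows "(\<Sum>a<B. \<Sum>j<B. \<Sum>y<B. cmod (\<Sum>t<S. \<psi> (j + 2 * a * t) * cnj (\<psi>' (y + 2 * (a + r) * t))))
    \<le> real B ^ 3 * sqrt (real S + 2 * real S ^ 3 * \<delta>)"
proof -
  let ?I = "{..<B} \<times> {..<B} \<times> {..<B}"
  define z where "z = (\<lambda>(a, j, y) t. \<psi> (j + 2 * a * t) * cnj (\<psi>' (y + 2 * (a + r) * t)))"
  let ?A = "autocorrelation B \<psi>"
  have gt: "cmod (\<Sum>x\<in>?I. z x t * cnj (z x t')) \<le> 2 * real S * \<delta> * real B ^ 3" if t: "t' < t" "t < S" for t t'
  proof -
    define m where "m = 2 * (t - t')"
    have A1: "(\<Sum>j<B. \<psi> (j + 2 * a * t) * cnj (\<psi> (j + 2 * a * t'))) = ?A (m * a)" for a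
    proof -
      define F where "F = (\<lambda>j. \<psi> (j + m * a) * cnj (\<psi> j))"
      have "F (j + B) = F j" for j
        using per(1)[of "j + m * a"] per(1)[of j] by (simp add: F_def algebra_simps)
      then have "(\<Sum>j<B. F (j + 2 * a * t')) = ?A (m * a)"
        unfolding autocorrelation_def F_def[symmetric] by (intro sum_periodic_shift)
      moreover have "j + 2 * a * t' + m * a = j + 2 * a * t" for j
        using t by (simp add: m_def) (metis add_mult_distrib2 le_add_diff_inverse less_imp_le mult.commute mult.assoc)
      ultimately show ?thesis by (simp add: F_def)
    qed
    define D where "D = (\<lambda>a. \<Sum>y<B. cnj (\<psi>' (y + 2 * (a + r) * t)) * \<psi>' (y + 2 * (a + r) * t'))"
    have D: "cmod (D a) \<le> real B" for a
    proof -
      have "cmod (D a) \<le> (\<Sum>y<B. 1)"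
        unfolding D_def using \<psi>(2) by (intro sum_norm_le) (simp add: norm_mult mult_le_one)
      then show ?thesis by simp
    qed
    have "(\<Sum>x\<in>?I. z x t * cnj (z x t')) = (\<Sum>a<B. \<Sum>j<B. \<Sum>y<B.
        (\<psi> (j + 2 * a * t) * cnj (\<psi> (j + 2 * a * t'))) * (cnj (\<psi>' (y + 2 * (a + r) * t)) * \<psi>' (y + 2 * (a + r) * t')))"
      by (simp add: sum.cartesian_product z_def case_prod_unfold mult_ac)
    also have "\<dots> = (\<Sum>a<B. ?A (m * a) * D a)"
      unfolding A1[symmetric] D_def by (simp only: sum_product)
    also have "cmod \<dots> \<le> (\<Sum>a<B. cmod (?A (m * a)) * real B)"
      by (intro sum_norm_le) (simp add: norm_mult mult_left_mono D)
    also have "\<dots> = real B * (\<Sum>a<B. cmod (?A (m * a)))"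
      by (simp add: sum_distrib_left mult.commute)
    also have "\<dots> \<le> real B * (real m * (\<Sum>z<B. cmod (?A z)))"
      using t by (intro mult_left_mono sum_periodic_dilate_le) (auto simp: m_def autocorrelation_periodic per)
    also have "\<dots> \<le> real B * (real m * (\<delta> * (real B)\<^sup>2))"
      by (intro mult_left_mono sum_cmod_autocorrelation_le B \<delta> fourier) (auto simp: per \<psi>)
    also have "\<dots> \<le> real B * (real (2 * S) * (\<delta> * (real B)\<^sup>2))"
      using t \<delta> by (intro mult_left_mono mult_right_mono) (auto simp: m_def)
    finally show ?thesis
      by (simp add: power3_eq_cube power2_eq_square mult_ac)
  qed
  have "(\<Sum>x\<in>?I. (cmod (\<Sum>t<S. z x t))\<^sup>2) \<le> real (card {..<S}) * real B ^ 3 + (real (card {..<S}))\<^sup>2 * (2 * real S * \<delta> * real B ^ 3)"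
  proof (rule sum_cmod_power2_le)
    fix t
    have "cmod (\<Sum>x\<in>?I. z x t * cnj (z x t)) \<le> (\<Sum>x\<in>?I. 1)"
      using \<psi> by (intro sum_norm_le) (auto simp: norm_mult z_def case_prod_unfold intro!: mult_le_one)
    then show "cmod (\<Sum>x\<in>?I. z x t * cnj (z x t)) \<le> real B ^ 3"
      by (simp add: card_cartesian_product power3_eq_cube)
  next
    fix t t' assume t: "t \<in> {..<S}" "t' \<in> {..<S}" "t \<noteq> t'"
    show "cmod (\<Sum>x\<in>?I. z x t * cnj (z x t')) \<le> 2 * real S * \<delta> * real B ^ 3"
    proof (cases "t' < t")
      case False
      then have "t < t'" using t by simp
      then show ?thesis
        using gt[of t t'] t by (subst cmod_sum_cnj_commute) auto
    qed (use gt t in auto)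
  qed (use \<delta> in auto)
  then have sq: "(\<Sum>x\<in>?I. (cmod (\<Sum>t<S. z x t))\<^sup>2) \<le> real B ^ 3 * (real S + 2 * real S ^ 3 * \<delta>)"
    by (simp add: power2_eq_square power3_eq_cube algebra_simps)
  define Y where "Y = (\<Sum>x\<in>?I. cmod (\<Sum>t<S. z x t))"
  have "(\<Sum>x\<in>?I. 1 * cmod (\<Sum>t<S. z x t))\<^sup>2 \<le> (\<Sum>x\<in>?I. 1\<^sup>2) * (\<Sum>x\<in>?I. (cmod (\<Sum>t<S. z x t))\<^sup>2)"
    by (rule Cauchy_Schwarz_ineq_sum)
  also have "\<dots> \<le> real B ^ 3 * (real B ^ 3 * (real S + 2 * real S ^ 3 * \<delta>))"
    using sq by (intro mult_mono) (auto simp: card_cartesian_product power3_eq_cube intro: sum_nonneg)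
  also have "\<dots> = (real B ^ 3 * sqrt (real S + 2 * real S ^ 3 * \<delta>))\<^sup>2"
  proof -
    have "(sqrt (real S + 2 * real S ^ 3 * \<delta>))\<^sup>2 = real S + 2 * real S ^ 3 * \<delta>"
      using \<delta> by simp
    then show ?thesis by (simp only: power_mult_distrib power2_eq_square[of "real B ^ 3"] mult.assoc)
  qed
  finally have "Y \<le> real B ^ 3 * sqrt (real S + 2 * real S ^ 3 * \<delta>)"
    unfolding Y_def mult_1 by (rule power2_le_imp_le) (use \<delta> in simp)
  then show ?thesis
    unfolding Y_def by (simp add: sum.cartesian_product z_def case_prod_unfold)
qed

section \<open>Functions of the digits\<close>

lemma sum_lessThan_times:
  fixes F :: "nat \<Rightarrow> 'a::comm_monoid_add"
  shows "(\<Sum>n<U * K. F n) = (\<Sum>u<U. \<Sum>s<K. F (u + U * s))"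
proof -
  have "(\<Sum>n<U * K. F n) = (\<Sum>s<K. sum F {s * U..<s * U + U})"
    by (simp only: sum.nat_group mult.commute)
  also have "\<dots> = (\<Sum>s<K. \<Sum>u<U. F (u + U * s))"
  proof (rule sum.cong[OF refl])
    fix s
    show "sum F {s * U..<s * U + U} = (\<Sum>u<U. F (u + U * s))"
      by (rule sum.reindex_bij_witness[of _ "\<lambda>u. u + U * s" "\<lambda>n. n - U * s"]) (auto simp: mult.commute)
  qed
  also have "\<dots> = (\<Sum>u<U. \<Sum>s<K. F (u + U * s))"
    by (rule sum.swap)
  finally show ?thesis .
qed

lemma cmod_one_add_unit:
  assumes "cmod z = 1"
  shows "(cmod (1 + z))\<^sup>2 + (cmod (1 - z))\<^sup>2 = 4"
proof -
  have "(Re z)\<^sup>2 + (Im z)\<^sup>2 = 1"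
    using assms by (metis cmod_power2 power_one)
  then show ?thesis
    unfolding cmod_power2 by (simp add: power2_eq_square algebra_simps)
qed

section \<open>Digit blocks, carries and their exponential sums\<close>

locale digit_function =
  fixes b :: nat and g :: "nat \<Rightarrow> complex"
  assumes base: "b \<ge> 2" and strong: "strongly_multiplicative b g" and unimodular [simp]: "\<And>n. cmod (g n) = 1"
begin

lemma g_nonzero [simp]: "g n \<noteq> 0"
  using unimodular[of n] by force

lemma g_mult_cnj [simp]: "g n * cnj (g n) = 1"
  by (simp add: complex_norm_square[symmetric])

lemma g_0 [simp]: "g 0 = 1"
proof -
  have "g (0 * b + 0) = g 0 * g 0"
    using strong[unfolded strongly_multiplicative_def, rule_format, of 0 0] base by simp
  then show ?thesis by simp
qed

lemma g_split: "x < b ^ w \<Longrightarrow> g (x + b ^ w * y) = g x * g y"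
proof (induction w arbitrary: x)
  case (Suc w)
  have step: "g (k * b + a) = g k * g a" if "a < b" for k a
    using strong that unfolding strongly_multiplicative_def by blast
  have "x mod b < b" using base by simp
  have "x div b < b ^ w"
    using Suc.prems by (simp add: less_mult_imp_div_less mult.commute)
  have "x + b ^ Suc w * y = (x div b + b ^ w * y) * b + x mod b"
    by (simp add: algebra_simps)
  then have "g (x + b ^ Suc w * y) = g (x div b) * g y * g (x mod b)"
    using step[OF \<open>x mod b < b\<close>] Suc.IH[OF \<open>x div b < b ^ w\<close>] by simp
  also have "\<dots> = g (x div b * b + x mod b) * g y"
    by (subst step[OF \<open>x mod b < b\<close>]) simp
  finally show ?case by simp
qed simp

lemma g_mod_div: "g n = g (n mod b ^ w) * g (n div b ^ w)"
  using g_split[of "n mod b ^ w" w "n div b ^ w"] base by simp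

text \<open>The offsets \<open>c\<close> and \<open>c'\<close> are the carries arriving from the
  lower digits of \<alpha> * n and \<beta> * n. Keeping them as parameters makes the family stable
  under splitting off low digits.\<close>

definition window :: "nat \<Rightarrow> nat \<Rightarrow> nat \<Rightarrow> nat \<Rightarrow> nat \<Rightarrow> nat \<Rightarrow> complex" where
  "window \<alpha> \<beta> w c c' j = g ((\<alpha> * j + c) mod b ^ w) * cnj (g ((\<beta> * j + c') mod b ^ w))"

lemma cmod_window [simp]: "cmod (window \<alpha> \<beta> w c c' j) = 1"
  by (simp add: window_def norm_mult)

lemma window_periodic: "window \<alpha> \<beta> w c c' (j + b ^ w) = window \<alpha> \<beta> w c c' j"
proof -
  have "(\<gamma> * (j + b ^ w) + c) mod b ^ w = (\<gamma> * j + c) mod b ^ w" for \<gamma> c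
  proof -
    have "\<gamma> * (j + b ^ w) + c = (\<gamma> * j + c) + b ^ w * \<gamma>" by (simp add: algebra_simps)
    then show ?thesis by (simp only: mod_mult_self2)
  qed
  then show ?thesis by (simp add: window_def)
qed

definition window_sum :: "nat \<Rightarrow> nat \<Rightarrow> nat \<Rightarrow> nat \<Rightarrow> nat \<Rightarrow> real \<Rightarrow> complex" where
  "window_sum \<alpha> \<beta> w c c' \<omega> = (\<Sum>j<b ^ w. window \<alpha> \<beta> w c c' j * unit_exp (\<omega> * real j))"

text \<open>A transfer relation: the low \<open>l\<close> digits x contribute a unimodular weight
  and hand their carries on to the remaining \<open>w\<close> digits, while the frequency is scaled
  by b^l.\<close>

lemma window_sum_split:
  "window_sum \<alpha> \<beta> (l + w) c c' \<omega> = (\<Sum>x<b ^ l. window \<alpha> \<beta> l c c' x * unit_exp (\<omega> * real x) *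
     window_sum \<alpha> \<beta> w ((\<alpha> * x + c) div b ^ l) ((\<beta> * x + c') div b ^ l) (\<omega> * real (b ^ l)))"
proof -
  have digit: "g ((\<gamma> * (x + b ^ l * n) + c) mod b ^ (l + w)) =
      g ((\<gamma> * x + c) mod b ^ l) * g ((\<gamma> * n + (\<gamma> * x + c) div b ^ l) mod b ^ w)" for \<gamma> x n c
  proof -
    have eq: "\<gamma> * (x + b ^ l * n) + c = (\<gamma> * x + c) + b ^ l * (\<gamma> * n)"
      by (simp add: algebra_simps)
    have "(\<gamma> * (x + b ^ l * n) + c) mod b ^ (l + w) =
        (\<gamma> * x + c) mod b ^ l + b ^ l * ((\<gamma> * n + (\<gamma> * x + c) div b ^ l) mod b ^ w)"
      unfolding eq power_add mod_mult2_eq using base by (simp add: add.commute)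
    then show ?thesis
      using base by (simp add: g_split)
  qed
  have "window_sum \<alpha> \<beta> (l + w) c c' \<omega> =
      (\<Sum>x<b ^ l. \<Sum>n<b ^ w. window \<alpha> \<beta> (l + w) c c' (x + b ^ l * n) * unit_exp (\<omega> * real (x + b ^ l * n)))"
    unfolding window_sum_def power_add sum_lessThan_times ..
  also have "\<dots> = (\<Sum>x<b ^ l. \<Sum>n<b ^ w. (window \<alpha> \<beta> l c c' x * unit_exp (\<omega> * real x)) *
      (window \<alpha> \<beta> w ((\<alpha> * x + c) div b ^ l) ((\<beta> * x + c') div b ^ l) n * unit_exp (\<omega> * real (b ^ l) * real n)))"
  proof (intro sum.cong refl)
    fix x n
    have "unit_exp (\<omega> * real (x + b ^ l * n)) = unit_exp (\<omega> * real x) * unit_exp (\<omega> * real (b ^ l) * real n)"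
      unfolding unit_exp_add[symmetric] by (simp add: algebra_simps)
    then show "window \<alpha> \<beta> (l + w) c c' (x + b ^ l * n) * unit_exp (\<omega> * real (x + b ^ l * n)) =
      (window \<alpha> \<beta> l c c' x * unit_exp (\<omega> * real x)) *
      (window \<alpha> \<beta> w ((\<alpha> * x + c) div b ^ l) ((\<beta> * x + c') div b ^ l) n * unit_exp (\<omega> * real (b ^ l) * real n))"
      unfolding window_def digit by simp
  qed
  finally show ?thesis
    unfolding window_sum_def sum_distrib_left .
qed

definition dilate_quotient :: "nat \<Rightarrow> nat \<Rightarrow> nat \<Rightarrow> complex" where
  "dilate_quotient \<alpha> \<beta> n = g (\<alpha> * n) * cnj (g (\<beta> * n))"

lemma cmod_dilate_quotient [simp]: "cmod (dilate_quotient \<alpha> \<beta> n) = 1"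
  by (simp add: dilate_quotient_def norm_mult)

lemma dilate_quotient_0 [simp]: "dilate_quotient \<alpha> \<beta> 0 = 1"
  by (simp add: dilate_quotient_def)

text \<open>Padding a digit block by zeros on both sides resets the carries, so a failure of
  \<^term>\<open>dilate_quotient \<alpha> \<beta>\<close> to be a linear phase produces a fixed loss of mass in every long block.\<close>

lemma window_sum_contraction:
  assumes \<alpha>: "\<alpha> > 0" and \<beta>: "\<beta> > 0"
    and nonlinear: "dilate_quotient \<alpha> \<beta> (Suc n) \<noteq> dilate_quotient \<alpha> \<beta> n * dilate_quotient \<alpha> \<beta> 1"
  obtains l :: nat and \<rho> :: real where "l > 0" "0 \<le> \<rho>" "\<rho> < 1"
    "\<And>w m c c' \<omega>. (\<And>c c' \<omega>. c < \<alpha> \<Longrightarrow> c' < \<beta> \<Longrightarrow> cmod (window_sum \<alpha> \<beta> w c c' \<omega>) \<le> m * real (b ^ w)) \<Longrightarrow>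
       c < \<alpha> \<Longrightarrow> c' < \<beta> \<Longrightarrow> cmod (window_sum \<alpha> \<beta> (l + w) c c' \<omega>) \<le> (\<rho> * m) * real (b ^ (l + w))"
proof -
  let ?h = "dilate_quotient \<alpha> \<beta>"
  \<comment> \<open>b^k is at least \<alpha> and \<beta>, so k low zero digits absorb every incoming
    carry. \<open>M\<close> exceeds all values reached from z \<le> n + 1, so a block of l digits
    with b^l > M passes on the carry 0.\<close>
  define k where "k = \<alpha> + \<beta>"
  define M where "M = b ^ k * ((\<alpha> + \<beta>) * Suc n) + b ^ k"
  define l where "l = M"
  have ltp: "m < b ^ m" for m
    using base power_gt_expt[of b m] by simp
  have k: "\<alpha> \<le> b ^ k" "\<beta> \<le> b ^ k"
    using ltp[of k] by (auto simp: k_def)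
  have l: "M < b ^ l" using ltp unfolding l_def .
  have "l > 0" using base by (simp add: l_def M_def)
  define D where "D = cmod (?h 1 - ?h (Suc n) * cnj (?h n))"
  have hh: "?h m * cnj (?h m) = 1" for m
    by (simp add: complex_norm_square[symmetric])
  have "D > 0"
  proof -
    have "?h 1 - ?h (Suc n) * cnj (?h n) \<noteq> 0"
    proof
      assume "?h 1 - ?h (Suc n) * cnj (?h n) = 0"
      then have "?h n * ?h 1 = ?h (Suc n) * (?h n * cnj (?h n))" by (simp add: mult_ac)
      then show False using nonlinear by (simp only: hh mult_1_right)
    qed
    then show ?thesis by (simp add: D_def)
  qed
  \<comment> \<open>As |1 + z|^2 + |1 - z|^2 = 4 for unimodular z, a length above 2 - \<gamma>
    forces |1 - z|^2 < 4 * \<gamma> \<le> (D / 2)^2.\<close>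
  define \<gamma> where "\<gamma> = min 1 (D\<^sup>2 / 16)"
  have \<gamma>: "0 < \<gamma>" "\<gamma> \<le> 1" "\<gamma> \<le> D\<^sup>2 / 16"
    using \<open>D > 0\<close> by (auto simp: \<gamma>_def)
  \<comment> \<open>Of the b^l blocks all but two are bounded trivially; the chosen pair contributes
    2 - \<gamma> instead of 2.\<close>
  define \<rho> where "\<rho> = 1 - \<gamma> / real (b ^ l)"
  have bl: "real (b ^ l) \<ge> 1" using base by simp
  have \<rho>: "0 \<le> \<rho>" "\<rho> < 1"
  proof -
    have "\<gamma> \<le> real (b ^ l)" using \<gamma> bl by linarith
    then have "\<gamma> / real (b ^ l) \<le> 1" using base by (subst divide_le_eq_1_pos) auto
    then show "0 \<le> \<rho>" by (simp only: \<rho>_def)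
    have "\<gamma> / real (b ^ l) > 0" using \<gamma> base by (intro divide_pos_pos) auto
    then show "\<rho> < 1" by (simp only: \<rho>_def)
  qed
  have close: "cmod (1 - z) < D / 2" if "cmod z = 1" "cmod (1 + z) > 2 - \<gamma>" for z
  proof -
    have "(2 - \<gamma>)\<^sup>2 < (cmod (1 + z))\<^sup>2"
      using that \<gamma> by (intro power_strict_mono) auto
    then have "(cmod (1 - z))\<^sup>2 < 4 - (2 - \<gamma>)\<^sup>2"
      using cmod_one_add_unit[OF that(1)] by linarith
    also have "\<dots> \<le> 4 * \<gamma>" by (simp add: power2_eq_square algebra_simps)
    also have "\<dots> \<le> (D / 2)\<^sup>2" using \<gamma> by (simp add: power_divide)
    finally show ?thesis
      by (rule power2_less_imp_less) (use \<open>D > 0\<close> in simp)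
  qed
  \<comment> \<open>If both sums had almost length 2, the phase would nearly cancel h(y + 1) / h(y)
    for y = 0 and for y = n, so h(1) and h(n + 1) / h(n) would differ by less than \<open>D\<close>.
    Thus at each frequency one of the two pairs loses; which one may depend on the
    frequency.\<close>
  have gap: "\<exists>y\<in>{0, n}. cmod (?h y + ?h (Suc y) * unit_exp \<phi>) \<le> 2 - \<gamma>" for \<phi>
  proof (rule ccontr)
    assume "\<not> ?thesis"
    then have *: "cmod (?h y + ?h (Suc y) * unit_exp \<phi>) > 2 - \<gamma>" if "y \<in> {0, n}" for y
      using that by force
    define \<zeta> where "\<zeta> = (\<lambda>y. ?h (Suc y) * cnj (?h y) * unit_exp \<phi>)"
    have \<zeta>: "cmod (1 - \<zeta> y) < D / 2" if "y \<in> {0, n}" for y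
    proof (rule close)
      show "cmod (\<zeta> y) = 1" by (simp add: \<zeta>_def norm_mult)
      have "?h y * (1 + \<zeta> y) = ?h y + ?h (Suc y) * (?h y * cnj (?h y)) * unit_exp \<phi>"
        by (simp add: \<zeta>_def algebra_simps)
      then have "?h y * (1 + \<zeta> y) = ?h y + ?h (Suc y) * unit_exp \<phi>"
        by (simp only: hh mult_1_right)
      then have "cmod (1 + \<zeta> y) = cmod (?h y + ?h (Suc y) * unit_exp \<phi>)"
        using norm_mult[of "?h y" "1 + \<zeta> y"] by simp
      then show "cmod (1 + \<zeta> y) > 2 - \<gamma>" using *[OF that] by simp
    qed
    have "D = cmod ((?h 1 - ?h (Suc n) * cnj (?h n)) * unit_exp \<phi>)"
      by (simp add: D_def norm_mult)
    also have "(?h 1 - ?h (Suc n) * cnj (?h n)) * unit_exp \<phi> = (1 - \<zeta> n) - (1 - \<zeta> 0)"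
      by (simp add: \<zeta>_def algebra_simps)
    also have "cmod \<dots> \<le> cmod (1 - \<zeta> n) + cmod (1 - \<zeta> 0)"
      by (rule norm_triangle_ineq4)
    also have "\<dots> < D" using \<zeta>[of n] \<zeta>[of 0] by simp
    finally show False by simp
  qed
  show thesis
  proof (rule that[OF \<open>l > 0\<close> \<rho>])
    fix w m c c' \<omega>
    assume bound: "\<And>c c' \<omega>. c < \<alpha> \<Longrightarrow> c' < \<beta> \<Longrightarrow> cmod (window_sum \<alpha> \<beta> w c c' \<omega>) \<le> m * real (b ^ w)"
      and c: "c < \<alpha>" "c' < \<beta>"
    define t where "t = (\<lambda>x. window \<alpha> \<beta> l c c' x * unit_exp (\<omega> * real x) *
     window_sum \<alpha> \<beta> w ((\<alpha> * x + c) div b ^ l) ((\<beta> * x + c') div b ^ l) (\<omega> * real (b ^ l)))"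
    have carry: "(\<gamma> * x + c) div b ^ l < \<gamma>" if "c < \<gamma>" "x < b ^ l" for \<gamma> x c
    proof -
      have "\<gamma> * x + c < \<gamma> * Suc x" using that by simp
      also have "\<dots> \<le> \<gamma> * b ^ l" using that by (intro mult_le_mono2) simp
      finally show ?thesis using base by (simp add: less_mult_imp_div_less)
    qed
    have t: "cmod (t x) \<le> m * real (b ^ w)" if "x < b ^ l" for x
      unfolding t_def using bound[OF carry[OF c(1) that] carry[OF c(2) that]] by (simp add: norm_mult)
    obtain y where y: "y \<in> {0, n}" "cmod (?h y + ?h (Suc y) * unit_exp (\<omega> * real (b ^ k))) \<le> 2 - \<gamma>"
      using gap by blast
    define T0 where "T0 = window_sum \<alpha> \<beta> w 0 0 (\<omega> * real (b ^ l))"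
    define \<kappa> where "\<kappa> = g c * cnj (g c')"
    have small: "\<gamma> * (b ^ k * z) + c < b ^ l" if "\<gamma> \<le> \<alpha> + \<beta>" "z \<le> Suc n" "c < b ^ k" for \<gamma> z c
    proof -
      have "\<gamma> * (b ^ k * z) \<le> (\<alpha> + \<beta>) * (b ^ k * Suc n)"
        using that by (intro mult_le_mono) auto
      then have "\<gamma> * (b ^ k * z) + c < M"
        using that(3) by (simp add: M_def algebra_simps)
      then show ?thesis using l by simp
    qed
    have tz: "t (b ^ k * z) = \<kappa> * (?h z * unit_exp (\<omega> * real (b ^ k) * real z)) * T0" if z: "z \<le> Suc n" for z
    proof -
      have gc: "g (\<gamma> * (b ^ k * z) + c) = g c * g (\<gamma> * z)" if "c < b ^ k" for \<gamma> c
        using g_split[OF that, of "\<gamma> * z"] by (simp add: algebra_simps)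
      have cb: "c < b ^ k" "c' < b ^ k" using c k by auto
      have "window \<alpha> \<beta> l c c' (b ^ k * z) = \<kappa> * ?h z"
        unfolding window_def \<kappa>_def dilate_quotient_def
        using small[of \<alpha> z c] small[of \<beta> z c'] cb z gc[OF cb(1)] gc[OF cb(2)] by simp
      moreover have "(\<alpha> * (b ^ k * z) + c) div b ^ l = 0" "(\<beta> * (b ^ k * z) + c') div b ^ l = 0"
        using small[of \<alpha> z c] small[of \<beta> z c'] cb z by auto
      ultimately show ?thesis
        unfolding t_def T0_def by (simp add: mult_ac)
    qed
    define x1 where "x1 = b ^ k * y"
    define x2 where "x2 = b ^ k * Suc y"
    have yn: "Suc y \<le> Suc n" using y by auto
    have x12: "x1 < b ^ l" "x2 < b ^ l" "x1 \<noteq> x2"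
      using small[of 1 y 0] small[of 1 "Suc y" 0] yn \<alpha> base by (auto simp: x1_def x2_def)
    have "t x1 + t x2 = \<kappa> * unit_exp (\<omega> * real (b ^ k) * real y) * (?h y + ?h (Suc y) * unit_exp (\<omega> * real (b ^ k))) * T0"
    proof -
      have "unit_exp (\<omega> * real (b ^ k) * real (Suc y)) = unit_exp (\<omega> * real (b ^ k) * real y) * unit_exp (\<omega> * real (b ^ k))"
        unfolding unit_exp_add[symmetric] by (simp add: algebra_simps)
      then show ?thesis
        unfolding x1_def x2_def using tz[of y] tz[of "Suc y"] yn by (simp add: algebra_simps)
    qed
    then have "cmod (t x1 + t x2) = cmod (?h y + ?h (Suc y) * unit_exp (\<omega> * real (b ^ k))) * cmod T0"
      by (simp add: norm_mult \<kappa>_def)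
    also have "\<dots> \<le> (2 - \<gamma>) * (m * real (b ^ w))"
      using y(2) bound[OF \<alpha> \<beta>] \<gamma> by (intro mult_mono) (auto simp: T0_def)
    finally have pair: "cmod (t x1 + t x2) \<le> (2 - \<gamma>) * (m * real (b ^ w))" .
    have "window_sum \<alpha> \<beta> (l + w) c c' \<omega> = (\<Sum>x<b ^ l. t x)"
      unfolding window_sum_split t_def ..
    also have "\<dots> = t x1 + t x2 + (\<Sum>x\<in>{..<b ^ l} - {x1, x2}. t x)"
      using x12 by (subst sum.subset_diff[of "{x1, x2}"]) (auto simp: add.commute)
    also have "cmod \<dots> \<le> (2 - \<gamma>) * (m * real (b ^ w)) + (\<Sum>x\<in>{..<b ^ l} - {x1, x2}. m * real (b ^ w))"
      by (rule norm_triangle_le, rule add_mono[OF pair], rule sum_norm_le, rule t) simp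
    also have "(\<Sum>x\<in>{..<b ^ l} - {x1, x2}. m * real (b ^ w)) = (real (b ^ l) - 2) * (m * real (b ^ w))"
    proof -
      have "card ({..<b ^ l} - {x1, x2}) = b ^ l - 2"
        using x12 by (subst card_Diff_subset) auto
      moreover have "card {x1, x2} \<le> card {..<b ^ l}"
        using x12 by (intro card_mono) auto
      ultimately show ?thesis
        using x12 by (simp add: of_nat_diff)
    qed
    also have "(2 - \<gamma>) * (m * real (b ^ w)) + (real (b ^ l) - 2) * (m * real (b ^ w)) = (\<rho> * m) * real (b ^ (l + w))"
      using base by (simp add: \<rho>_def power_add field_simps)
    finally show "cmod (window_sum \<alpha> \<beta> (l + w) c c' \<omega>) \<le> (\<rho> * m) * real (b ^ (l + w))" .
  qed
qed

text \<open>The contraction is uniform in carries and frequency and can be iterated, so the decay is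
  exponential in the number of blocks; leftover digits are bounded trivially.\<close>

lemma window_sum_decay:
  assumes \<alpha>: "\<alpha> > 0" and \<beta>: "\<beta> > 0"
    and nonlinear: "dilate_quotient \<alpha> \<beta> (Suc n) \<noteq> dilate_quotient \<alpha> \<beta> n * dilate_quotient \<alpha> \<beta> 1"
    and "\<delta> > 0"
  obtains w0 where "\<And>w c c' \<omega>. w \<ge> w0 \<Longrightarrow> c < \<alpha> \<Longrightarrow> c' < \<beta> \<Longrightarrow> cmod (window_sum \<alpha> \<beta> w c c' \<omega>) \<le> \<delta> * real (b ^ w)"
proof -
  obtain l :: nat and \<rho> :: real where l: "l > 0" and \<rho>: "0 \<le> \<rho>" "\<rho> < 1"
    and step: "\<And>w m c c' \<omega>. (\<And>c c' \<omega>. c < \<alpha> \<Longrightarrow> c' < \<beta> \<Longrightarrow> cmod (window_sum \<alpha> \<beta> w c c' \<omega>) \<le> m * real (b ^ w)) \<Longrightarrow>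
       c < \<alpha> \<Longrightarrow> c' < \<beta> \<Longrightarrow> cmod (window_sum \<alpha> \<beta> (l + w) c c' \<omega>) \<le> (\<rho> * m) * real (b ^ (l + w))"
    by (rule window_sum_contraction[OF \<alpha> \<beta> nonlinear]) blast
  have iter: "cmod (window_sum \<alpha> \<beta> (l * q + w) c c' \<omega>) \<le> \<rho> ^ q * real (b ^ (l * q + w))"
    if "c < \<alpha>" "c' < \<beta>" for q w c c' \<omega>
    using that
  proof (induction q arbitrary: c c' \<omega>)
    case 0
    have "cmod (window_sum \<alpha> \<beta> w c c' \<omega>) \<le> (\<Sum>j<b ^ w. 1)"
      unfolding window_sum_def by (intro sum_norm_le) (simp add: norm_mult)
    then show ?case by simp
  next
    case (Suc q)
    show ?case
      using step[OF Suc.IH Suc.prems] by (simp add: add.assoc)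
  qed
  obtain q where q: "\<rho> ^ q < \<delta>"
    using real_arch_pow_inv[OF \<open>\<delta> > 0\<close> \<rho>(2)] by blast
  show thesis
  proof (rule that[of "l * q"])
    fix w c c' \<omega> assume w: "l * q \<le> w" and c: "c < \<alpha>" "c' < \<beta>"
    have "cmod (window_sum \<alpha> \<beta> w c c' \<omega>) \<le> \<rho> ^ q * real (b ^ w)"
      using iter[OF c, of q "w - l * q"] w by simp
    also have "\<dots> \<le> \<delta> * real (b ^ w)" using q by (intro mult_right_mono) auto
    finally show "cmod (window_sum \<alpha> \<beta> w c c' \<omega>) \<le> \<delta> * real (b ^ w)" .
  qed
qed

text \<open>With h(n) = \<zeta>^n, the values of \<open>g\<close> at \<alpha> * n and \<beta> * n
  determine each other. Take x with \<alpha> * x just above b^k, while \<beta> * x < b^k. In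
  \<alpha> * (x + b^k * y) the leading 1 of \<alpha> * x is added to \<alpha> * y, whereas in
  \<beta> * (x + b^k * y) the two blocks stay disjoint. Comparing gives g(1 + \<alpha> * y) = g(1) *
  g(\<alpha> * y), and coprimality of \<alpha> and \<open>b\<close> lets \<alpha> * y end in the
  digits of any m.\<close>

lemma linear_dilate_quotient_imp_linear:
  assumes \<beta>: "\<beta> < \<alpha>" and cop: "coprime \<alpha> b"
    and linear: "\<And>n. dilate_quotient \<alpha> \<beta> (Suc n) = dilate_quotient \<alpha> \<beta> n * dilate_quotient \<alpha> \<beta> 1"
  shows "g (Suc m) = g 1 * g m"
proof -
  let ?h = "dilate_quotient \<alpha> \<beta>"
  define \<zeta> where "\<zeta> = ?h 1"
  have h: "?h n = \<zeta> ^ n" for n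
  proof (induction n)
    case (Suc n)
    then show ?case using linear[of n] by (simp only: \<zeta>_def power_Suc2)
  qed simp
  have gb: "g (b * n) = g n" for n
    using g_split[of 0 1 n] base by simp
  \<comment> \<open>Appending a zero digit does not change \<open>g\<close>, so h(b) = h(1). Below
    this collapses \<zeta>^(b^k * y) to \<zeta>^y.\<close>
  have "\<zeta> ^ b = \<zeta>"
  proof -
    have "?h b = ?h 1"
      using gb[of \<alpha>] gb[of \<beta>] by (simp add: dilate_quotient_def mult.commute)
    then show ?thesis by (simp add: h)
  qed
  then have \<zeta>pow: "\<zeta> ^ (b ^ k) = \<zeta>" for k
    by (induction k) (auto simp: power_mult)
  have ga: "g (\<alpha> * n) = g (\<beta> * n) * \<zeta> ^ n" for n
  proof -
    have "?h n * g (\<beta> * n) = g (\<alpha> * n) * (g (\<beta> * n) * cnj (g (\<beta> * n)))"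
      by (simp add: dilate_quotient_def mult_ac)
    then show ?thesis by (simp add: h mult.commute)
  qed
  define k where "k = \<alpha>\<^sup>2"
  have ltp: "m < b ^ m" for m
    using base power_gt_expt[of b m] by simp
  have bk: "\<alpha>\<^sup>2 < b ^ k" using ltp[of k] by (simp add: k_def)
  have \<alpha>: "\<alpha> > 0" using \<beta> by simp
  \<comment> \<open>The least x with \<alpha> * x \<ge> b^k. Since b^k > \<alpha>^2 it satisfies x
    \<ge> \<alpha>, which pushes \<beta> * x below b^k.\<close>
  define x where "x = (b ^ k + \<alpha> - 1) div \<alpha>"
  have x1: "b ^ k \<le> \<alpha> * x" and x2: "\<alpha> * x < b ^ k + \<alpha>"
  proof -
    have "\<alpha> * x + (b ^ k + \<alpha> - 1) mod \<alpha> = b ^ k + \<alpha> - 1"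
      unfolding x_def by simp
    moreover have "(b ^ k + \<alpha> - 1) mod \<alpha> < \<alpha>" using \<alpha> by simp
    ultimately show "b ^ k \<le> \<alpha> * x" "\<alpha> * x < b ^ k + \<alpha>" using \<alpha> by linarith+
  qed
  have "\<alpha> \<le> x"
  proof (rule ccontr)
    assume "\<not> \<alpha> \<le> x"
    then have "\<alpha> * x \<le> \<alpha> * \<alpha>" by simp
    then show False using x1 bk unfolding power2_eq_square by linarith
  qed
  have \<beta>x: "\<beta> * x < b ^ k"
  proof -
    have "Suc \<beta> * x \<le> \<alpha> * x" using \<beta> by (intro mult_le_mono1) simp
    then show ?thesis using x2 \<open>\<alpha> \<le> x\<close> by simp
  qed
  define v where "v = \<alpha> * x - b ^ k"
  have v: "\<alpha> * x = v + b ^ k * 1" "v < b ^ k"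
  proof -
    have "\<alpha> \<le> \<alpha>\<^sup>2" by (simp add: power2_eq_square)
    then show "\<alpha> * x = v + b ^ k * 1" "v < b ^ k"
      using x1 x2 bk by (auto simp: v_def)
  qed
  have succ: "g (1 + \<alpha> * y) = g 1 * g (\<alpha> * y)" for y
  proof -
    have "g v * g (1 + \<alpha> * y) = g (v + b ^ k * (1 + \<alpha> * y))"
      by (rule g_split[OF v(2), symmetric])
    also have "v + b ^ k * (1 + \<alpha> * y) = \<alpha> * (x + b ^ k * y)"
      using v(1) by (simp add: algebra_simps)
    also have "g \<dots> = g (\<beta> * x + b ^ k * (\<beta> * y)) * \<zeta> ^ (x + b ^ k * y)"
      unfolding ga by (simp add: algebra_simps)
    also have "\<dots> = (g (\<beta> * x) * \<zeta> ^ x) * (g (\<beta> * y) * \<zeta> ^ y)"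
      unfolding g_split[OF \<beta>x] by (simp add: power_add power_mult \<zeta>pow)
    also have "\<dots> = g (v + b ^ k * 1) * g (\<alpha> * y)"
      unfolding ga[symmetric] v(1) ..
    also have "\<dots> = g v * (g 1 * g (\<alpha> * y))"
      unfolding g_split[OF v(2)] by simp
    finally show ?thesis by simp
  qed
  \<comment> \<open>m + 1 still fits into \<open>K\<close> digits, so adding 1 to m + b^K * z sends
    no carry into z, and g(z) cancels.\<close>
  define K where "K = Suc m"
  have K: "Suc m < b ^ K" using ltp[of K] by (simp only: K_def)
  have "coprime \<alpha> (b ^ K)" using cop by simp
  then obtain y0 where "[\<alpha> * y0 = 1] (mod b ^ K)"
    using cong_solve_coprime_nat[of \<alpha> "b ^ K"] by auto
  then have "[\<alpha> * y0 * m = 1 * m] (mod b ^ K)" by (rule cong_scalar_right)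
  then have mod: "(\<alpha> * (y0 * m)) mod b ^ K = m"
    using K by (simp add: cong_def mult.assoc)
  define z where "z = (\<alpha> * (y0 * m)) div b ^ K"
  have "\<alpha> * (y0 * m) = m + b ^ K * z"
    using mod by (metis mod_mult_div_eq z_def)
  moreover have "g (m + b ^ K * z) = g m * g z"
    using K by (intro g_split) simp
  moreover have "g (Suc m + b ^ K * z) = g (Suc m) * g z"
    using K by (intro g_split) simp
  ultimately have "g (Suc m) * g z = g 1 * (g m * g z)"
    using succ[of "y0 * m"] by simp
  then show ?thesis by simp
qed

end

section \<open>Correlations along squares\<close>

text \<open>A function periodic modulo \<open>B\<close> in both arguments sees u only through its
  cell. Each of the B^2 cells holds at most 36 times its fair share W / B of the W * B values u, and
  \<open>Y \<ge> 0\<close> permits replacing every count by that bound.\<close>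

lemma sum_over_square_cells_le:
  fixes Y :: "nat \<Rightarrow> nat \<Rightarrow> real"
  assumes B: "B \<ge> 8" and W: "2 * B ^ 3 < W" and Y0: "\<And>j a. Y j a \<ge> 0"
    and per: "\<And>j a. Y (j + B) a = Y j a" "\<And>j a. Y j (a + B) = Y j a"
  shows "(\<Sum>u<W * B. Y (u\<^sup>2 div (W * B)) u) \<le> 36 * real W / real B * (\<Sum>a<B. \<Sum>j<B. Y j a)"
proof -
  define cell where "cell = (\<lambda>u::nat. (u mod B, u\<^sup>2 div (W * B) mod B))"
  have "B > 0" using B by simp
  have "(\<Sum>u<W * B. Y (u\<^sup>2 div (W * B)) u) = (\<Sum>u<W * B. case cell u of (a, j) \<Rightarrow> Y j a)"
  proof (intro sum.cong refl)
    fix u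
    show "Y (u\<^sup>2 div (W * B)) u = (case cell u of (a, j) \<Rightarrow> Y j a)"
      using periodic_mod[of "\<lambda>j. Y j (u mod B)" B "u\<^sup>2 div (W * B)"] periodic_mod[of "Y (u\<^sup>2 div (W * B))" B u]
      by (simp add: cell_def per)
  qed
  also have "\<dots> = (\<Sum>x\<in>{..<B} \<times> {..<B}. \<Sum>u | u \<in> {..<W * B} \<and> cell u = x. case cell u of (a, j) \<Rightarrow> Y j a)"
    using \<open>B > 0\<close> by (subst sum.group) (auto simp: cell_def)
  also have "\<dots> \<le> (\<Sum>x\<in>{..<B} \<times> {..<B}. 36 * real W / real B * (case x of (a, j) \<Rightarrow> Y j a))"
  proof (rule sum_mono)
    fix x assume x: "x \<in> {..<B} \<times> {..<B}"
    obtain a j where aj: "x = (a, j)" by (cases x)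
    have set: "{u. u \<in> {..<W * B} \<and> cell u = x} = {u. u < W * B \<and> u mod B = a \<and> (u\<^sup>2 div (W * B)) mod B = j}"
      using aj by (auto simp: cell_def)
    have "(\<Sum>u | u \<in> {..<W * B} \<and> cell u = x. case cell u of (a, j) \<Rightarrow> Y j a) =
        (\<Sum>u | u \<in> {..<W * B} \<and> cell u = x. Y j a)"
      by (rule sum.cong) (auto simp: aj)
    also have "\<dots> = real (card {u. u < W * B \<and> u mod B = a \<and> (u\<^sup>2 div (W * B)) mod B = j}) * Y j a"
      unfolding set by simp
    also have "\<dots> \<le> 36 * real W / real B * Y j a"
      using card_square_cell_le[OF B W, of a j] x aj Y0 by (intro mult_right_mono) auto
    finally show "(\<Sum>u | u \<in> {..<W * B} \<and> cell u = x. case cell u of (a, j) \<Rightarrow> Y j a) \<le>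
      36 * real W / real B * (case x of (a, j) \<Rightarrow> Y j a)"
      using aj by simp
  qed
  also have "\<dots> = 36 * real W / real B * (\<Sum>a<B. \<Sum>j<B. Y j a)"
    by (simp only: sum_distrib_left[symmetric] sum.cartesian_product)
  finally show ?thesis .
qed

lemma inj_on_affine_mod:
  assumes "coprime \<gamma> (B::nat)"
  shows "inj_on (\<lambda>j. (\<gamma> * j + e) mod B) {..<B}"
proof (rule inj_onI)
  have aux: "j = j'" if "j' \<le> j" "j < B" "(\<gamma> * j + e) mod B = (\<gamma> * j' + e) mod B" for j j'
  proof -
    have "B dvd (\<gamma> * j + e) - (\<gamma> * j' + e)"
      using that by (subst mod_eq_dvd_iff_nat[symmetric]) auto
    also have "(\<gamma> * j + e) - (\<gamma> * j' + e) = \<gamma> * (j - j')"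
      by (simp add: diff_mult_distrib2)
    finally have "B dvd j - j'"
      using assms by (simp add: coprime_dvd_mult_right_iff coprime_commute)
    have "\<not> j' < j"
    proof
      assume "j' < j"
      then have "0 < j - j'" "j - j' < B" using that by auto
      then show False using \<open>B dvd j - j'\<close> nat_dvd_not_less by blast
    qed
    then show ?thesis using that by simp
  qed
  fix j j' assume *: "j \<in> {..<B}" "j' \<in> {..<B}" and eq: "(\<gamma> * j + e) mod B = (\<gamma> * j' + e) mod B"
  show "j = j'"
  proof (cases "j' \<le> j")
    case True
    then show ?thesis by (rule aux[OF _ _ eq]) (use * in simp)
  next
    case False
    then have "j' = j" by (intro aux[OF _ _ eq[symmetric]]) (use * in auto)
    then show ?thesis ..
  qed
qed

section \<open>Digit windows of squares\<close>

context digit_function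
begin

text \<open>The carry that \<gamma> times the part of u^2 below \<open>U\<close> sends into the
  window; it is independent of s and takes at most \<gamma> values.\<close>

definition low_carry :: "nat \<Rightarrow> nat \<Rightarrow> nat \<Rightarrow> nat" where
  "low_carry U \<gamma> u = (\<gamma> * (u\<^sup>2 mod U)) div U"

lemma low_carry_less:
  assumes "U > 0" "\<gamma> > 0"
  shows "low_carry U \<gamma> u < \<gamma>"
proof -
  have "\<gamma> * (u\<^sup>2 mod U) < \<gamma> * U" using assms by simp
  then show ?thesis
    unfolding low_carry_def by (simp add: less_mult_imp_div_less)
qed

text \<open>Since w \<le> \<mu>, the term U^2 * s^2 vanishes modulo b^(\<mu> + w), so s enters the
  window linearly, through 2 * u * s.\<close>

lemma square_mod_split:
  assumes "w \<le> \<mu>"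
  defines "U \<equiv> b ^ \<mu>"
  shows "(\<gamma> * (u + U * s)\<^sup>2) mod b ^ (\<mu> + w) =
    (\<gamma> * (u\<^sup>2 mod U)) mod U + U * ((\<gamma> * (u\<^sup>2 div U + 2 * u * s) + low_carry U \<gamma> u) mod b ^ w)"
proof -
  have U: "U > 0" using base by (simp add: U_def)
  define x where "x = \<gamma> * (u\<^sup>2 mod U)"
  define J where "J = u\<^sup>2 div U"
  have u2: "u\<^sup>2 = U * J + u\<^sup>2 mod U" by (simp add: J_def)
  have "\<gamma> * (u + U * s)\<^sup>2 = \<gamma> * (u\<^sup>2 + U * (2 * u * s) + U * (U * s\<^sup>2))"
    by (simp add: power2_eq_square algebra_simps)
  also have "\<dots> = x + U * (\<gamma> * (J + 2 * u * s) + U * (\<gamma> * s\<^sup>2))"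
    by (subst u2) (simp add: x_def algebra_simps)
  finally have eq: "\<gamma> * (u + U * s)\<^sup>2 = x + U * (\<gamma> * (J + 2 * u * s) + U * (\<gamma> * s\<^sup>2))" .
  have "U = b ^ w * b ^ (\<mu> - w)" using assms by (simp add: U_def power_add[symmetric])
  then have "(x div U + (\<gamma> * (J + 2 * u * s) + U * (\<gamma> * s\<^sup>2))) mod b ^ w = (\<gamma> * (J + 2 * u * s) + x div U) mod b ^ w"
    by (metis add.assoc add.commute mod_mult_self2 mult.assoc)
  moreover have "b ^ (\<mu> + w) = U * b ^ w" by (simp add: U_def power_add)
  moreover have "(x + U * Y) mod (U * b ^ w) = x mod U + U * ((x div U + Y) mod b ^ w)" for Y
    using U by (simp add: mod_mult2_eq add.commute)
  ultimately show ?thesis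
    unfolding eq low_carry_def x_def[symmetric] J_def[symmetric] by simp
qed

text \<open>\<kappa> collects the digits below \<mu>. It is chosen before s, so it leaves a sum over
  s as a factor and disappears in absolute value.\<close>

lemma window_square:
  assumes "w \<le> \<mu>"
  defines "U \<equiv> b ^ \<mu>"
  obtains \<kappa> where "cmod \<kappa> = 1"
    "\<And>s. window \<alpha> \<beta> (\<mu> + w) 0 0 ((u + U * s)\<^sup>2) =
       \<kappa> * window \<alpha> \<beta> w (low_carry U \<alpha> u) (low_carry U \<beta> u) (u\<^sup>2 div U + 2 * u * s)"
proof
  have g: "g ((\<gamma> * (u + U * s)\<^sup>2) mod b ^ (\<mu> + w)) =
      g ((\<gamma> * (u\<^sup>2 mod U)) mod U) * g ((\<gamma> * (u\<^sup>2 div U + 2 * u * s) + low_carry U \<gamma> u) mod b ^ w)" for \<gamma> s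
    unfolding U_def square_mod_split[OF assms(1)] using base by (intro g_split) simp
  show "window \<alpha> \<beta> (\<mu> + w) 0 0 ((u + U * s)\<^sup>2) =
      (g ((\<alpha> * (u\<^sup>2 mod U)) mod U) * cnj (g ((\<beta> * (u\<^sup>2 mod U)) mod U))) *
      window \<alpha> \<beta> w (low_carry U \<alpha> u) (low_carry U \<beta> u) (u\<^sup>2 div U + 2 * u * s)" for s
    unfolding window_def add_0_right g by simp
qed (simp add: norm_mult)

text \<open>The second differencing. The four carries and the increase of u^2 div U lie in a bounded
  set \<open>I\<close>; summing over all of \<open>I\<close> decouples them from u. What remains is
  periodic modulo b^w, so counting cells replaces u by a and u^2 div U by j. The offset 2 * r * s,
  injective modulo b^w because 2 * r * K \<le> b^w, then supplies the free variable of
  \<open>sum_correlations_le\<close>.\<close>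

lemma block_correlation_le:
  assumes ab: "\<alpha> > 0" "\<beta> > 0" and r: "r > 0" and w: "w \<le> \<mu>" "8 \<le> b ^ w" "2 * (b ^ w) ^ 3 < b ^ (\<mu> - w)"
    and rU: "r\<^sup>2 \<le> b ^ \<mu>" and K: "2 * r * K \<le> b ^ w" and \<delta>: "\<delta> \<ge> 0"
    and fourier: "\<And>c c' \<omega>. c < \<alpha> \<Longrightarrow> c' < \<beta> \<Longrightarrow> cmod (window_sum \<alpha> \<beta> w c c' \<omega>) \<le> \<delta> * real (b ^ w)"
  defines "U \<equiv> b ^ \<mu>"
  defines "\<psi> \<equiv> (\<lambda>u s. window \<alpha> \<beta> w (low_carry U \<alpha> u) (low_carry U \<beta> u) (u\<^sup>2 div U + 2 * u * s))"
  shows "real S * (\<Sum>u<U. cmod (\<Sum>s<K. \<psi> u s * cnj (\<psi> (u + r) s))) \<le>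
    (real \<alpha> * real \<beta>)\<^sup>2 * (2 * real r + 2) * 36 * real U * real (b ^ w) * sqrt (real S + 2 * real S ^ 3 * \<delta>) + (real S)\<^sup>2 * real U"
proof -
  define B where "B = b ^ w"
  define W where "W = b ^ (\<mu> - w)"
  have UWB: "U = W * B" using w(1) by (simp add: U_def W_def B_def power_add[symmetric])
  have U: "U > 0" and B: "B > 0" using base by (auto simp: U_def B_def)
  define \<Psi> where "\<Psi> = (\<lambda>c. window \<alpha> \<beta> w (fst c) (snd c))"
  have \<Psi>1: "cmod (\<Psi> c j) \<le> 1" for c j by (simp add: \<Psi>_def)
  have \<Psi>per: "\<Psi> c (j + B) = \<Psi> c j" for c j by (simp add: \<Psi>_def B_def window_periodic)
  have \<Psi>mult: "\<Psi> c (j + B * k) = \<Psi> c j" for c j k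
    by (rule periodic_add_mult) (rule \<Psi>per)
  define X where "X = (\<lambda>c c' j y a. cmod (\<Sum>t<S. \<Psi> c (j + 2 * a * t) * cnj (\<Psi> c' (j + y + 2 * (a + r) * t))))"
  have Xj: "X c c' (j + B) y a = X c c' j y a" for c c' j y a
  proof -
    have "\<Psi> c (j + B + 2 * a * t) = \<Psi> c (j + 2 * a * t)"
        "\<Psi> c' (j + B + y + 2 * (a + r) * t) = \<Psi> c' (j + y + 2 * (a + r) * t)" for t
      using \<Psi>per[of c "j + 2 * a * t"] \<Psi>per[of c' "j + y + 2 * (a + r) * t"] by (simp_all add: ac_simps)
    then show ?thesis by (simp add: X_def)
  qed
  have Xy: "X c c' j (y + B) a = X c c' j y a" for c c' j y a
  proof -
    have "\<Psi> c' (j + (y + B) + 2 * (a + r) * t) = \<Psi> c' (j + y + 2 * (a + r) * t)" for t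
      using \<Psi>per[of c' "j + y + 2 * (a + r) * t"] by (simp add: ac_simps)
    then show ?thesis by (simp add: X_def)
  qed
  have Xa: "X c c' j y (a + B) = X c c' j y a" for c c' j y a
  proof -
    have "\<Psi> c (j + 2 * (a + B) * t) = \<Psi> c (j + 2 * a * t)" for t
      using \<Psi>mult[of c "j + 2 * a * t" "2 * t"] by (simp add: algebra_simps)
    moreover have "\<Psi> c' (j + y + 2 * (a + B + r) * t) = \<Psi> c' (j + y + 2 * (a + r) * t)" for t
      using \<Psi>mult[of c' "j + y + 2 * (a + r) * t" "2 * t"] by (simp add: algebra_simps)
    ultimately show ?thesis by (simp add: X_def)
  qed
  have X0: "X c c' j y a \<ge> 0" for c c' j y a by (simp add: X_def)
  have Xjm: "X c c' (j + B * k) y a = X c c' j y a" for c c' j y a k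
    by (rule periodic_add_mult[of "\<lambda>j. X c c' j y a"]) (rule Xj)
  let ?root = "sqrt (real S + 2 * real S ^ 3 * \<delta>)"
  \<comment> \<open>Carries for \<alpha> and \<beta> at u and at u + r, and the increase of the
    quotient, which is below 2 * r + 2 because r^2 \<le> U.\<close>
  define I where "I = (({..<\<alpha>} \<times> {..<\<beta>}) \<times> ({..<\<alpha>} \<times> {..<\<beta>})) \<times> {..<2 * r + 2}"
  have I: "finite I" "real (card I) = (real \<alpha> * real \<beta>)\<^sup>2 * (2 * real r + 2)"
    by (simp_all add: I_def card_cartesian_product power2_eq_square algebra_simps)
  define idx where "idx = (\<lambda>u. (((low_carry U \<alpha> u, low_carry U \<beta> u), (low_carry U \<alpha> (u + r), low_carry U \<beta> (u + r))),
      (u + r)\<^sup>2 div U - u\<^sup>2 div U))"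
  have J: "u\<^sup>2 div U \<le> (u + r)\<^sup>2 div U" "(u + r)\<^sup>2 div U - u\<^sup>2 div U < 2 * r + 2" if "u < U" for u
  proof -
    show 1: "u\<^sup>2 div U \<le> (u + r)\<^sup>2 div U" by (intro div_le_mono power_mono) auto
    have "(u + r)\<^sup>2 = u\<^sup>2 + 2 * r * u + r\<^sup>2" by (simp add: power2_eq_square algebra_simps)
    also have "\<dots> \<le> u\<^sup>2 + 2 * r * U + U" using that rU by (intro add_mono mult_le_mono) (auto simp: U_def)
    also have "\<dots> = u\<^sup>2 + U * (2 * r + 1)" by (simp add: algebra_simps)
    finally have "(u + r)\<^sup>2 div U \<le> (u\<^sup>2 + U * (2 * r + 1)) div U" by (rule div_le_mono)
    also have "\<dots> = u\<^sup>2 div U + (2 * r + 1)" using U by (subst div_mult_self2) auto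
    finally show "(u + r)\<^sup>2 div U - u\<^sup>2 div U < 2 * r + 2" by simp
  qed
  have idx: "idx u \<in> I" if "u < U" for u
    using J[OF that] low_carry_less[OF U] ab by (simp add: idx_def I_def)
  define Y where "Y = (\<lambda>((c, c'), i) s j a. X c c' (j + 2 * a * s) (i + 2 * r * s) a)"
  have Y0: "Y x s j a \<ge> 0" for x s j a by (simp add: Y_def X0 case_prod_unfold)
  have VY: "cmod (\<Sum>t<S. \<psi> u (s + t) * cnj (\<psi> (u + r) (s + t))) = Y (idx u) s (u\<^sup>2 div U) u" if u: "u < U" for u s
  proof -
    have e1: "u\<^sup>2 div U + 2 * u * (s + t) = u\<^sup>2 div U + 2 * u * s + 2 * u * t" for t
      by (simp add: algebra_simps)
    have e2: "(u + r)\<^sup>2 div U + 2 * (u + r) * (s + t) =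
        (u\<^sup>2 div U + 2 * u * s) + (((u + r)\<^sup>2 div U - u\<^sup>2 div U) + 2 * r * s) + 2 * (u + r) * t" for t
    proof -
      have "(u + r)\<^sup>2 div U = u\<^sup>2 div U + ((u + r)\<^sup>2 div U - u\<^sup>2 div U)" using J(1)[OF u] by simp
      then show ?thesis by (simp add: algebra_simps)
    qed
    show ?thesis
      by (simp only: \<psi>_def e1 e2 Y_def idx_def X_def \<Psi>_def prod.case fst_conv snd_conv)
  qed
  have per_x: "(\<Sum>s<K. \<Sum>u<U. Y x s (u\<^sup>2 div U) u) \<le> 36 * real U * real B * ?root" if x: "x \<in> I" for x
  proof -
    obtain c c' i where xc: "x = ((c, c'), i)" by (metis prod.exhaust)
    have c: "fst c < \<alpha>" "snd c < \<beta>" using x xc by (auto simp: I_def)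
    have "(\<Sum>s<K. \<Sum>u<U. Y x s (u\<^sup>2 div U) u) \<le> (\<Sum>s<K. 36 * real W / real B * (\<Sum>a<B. \<Sum>j<B. Y x s j a))"
      unfolding UWB
    proof (intro sum_mono sum_over_square_cells_le)
      fix s j a
      show "Y x s (j + B) a = Y x s j a"
        using Xj[of c c' "j + 2 * a * s" "i + 2 * r * s" a] by (simp add: Y_def xc ac_simps)
      show "Y x s j (a + B) = Y x s j a"
      proof -
        have "j + 2 * (a + B) * s = (j + 2 * a * s) + B * (2 * s)" by (simp add: algebra_simps)
        then show ?thesis by (simp only: Y_def xc prod.case Xa Xjm)
      qed
    qed (use w Y0 in \<open>auto simp: B_def W_def\<close>)
    also have "\<dots> = 36 * real W / real B * (\<Sum>s<K. \<Sum>a<B. \<Sum>j<B. X c c' j (i + 2 * r * s) a)"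
    proof -
      have "(\<Sum>j<B. X c c' (j + 2 * a * s) (i + 2 * r * s) a) = (\<Sum>j<B. X c c' j (i + 2 * r * s) a)" for a s
        by (rule sum_periodic_shift[of "\<lambda>j. X c c' j (i + 2 * r * s) a"]) (rule Xj)
      then show ?thesis by (simp add: Y_def xc sum_distrib_left)
    qed
    also have "(\<Sum>s<K. \<Sum>a<B. \<Sum>j<B. X c c' j (i + 2 * r * s) a) = (\<Sum>a<B. \<Sum>j<B. \<Sum>s<K. X c c' j (i + 2 * r * s) a)"
    proof -
      have "(\<Sum>s<K. \<Sum>a<B. \<Sum>j<B. X c c' j (i + 2 * r * s) a) = (\<Sum>a<B. \<Sum>s<K. \<Sum>j<B. X c c' j (i + 2 * r * s) a)"
        by (rule sum.swap)
      also have "\<dots> = (\<Sum>a<B. \<Sum>j<B. \<Sum>s<K. X c c' j (i + 2 * r * s) a)"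
        by (rule sum.cong[OF refl]) (rule sum.swap)
      finally show ?thesis .
    qed
    also have "\<dots> \<le> (\<Sum>a<B. \<Sum>j<B. \<Sum>y<B. cmod (\<Sum>t<S. \<Psi> c (j + 2 * a * t) * cnj (\<Psi> c' (y + 2 * (a + r) * t))))"
    proof (intro sum_mono)
      fix a j
      have inj: "inj_on (\<lambda>s. (i + 2 * r * s) mod B) {..<K}"
      proof (rule inj_onI)
        have aux: "s = s'" if "s' \<le> s" "s < K" "(i + 2 * r * s) mod B = (i + 2 * r * s') mod B" for s s'
        proof -
          have "B dvd (i + 2 * r * s) - (i + 2 * r * s')"
            using that by (subst mod_eq_dvd_iff_nat[symmetric]) auto
          also have "(i + 2 * r * s) - (i + 2 * r * s') = 2 * r * (s - s')"
            by (simp add: diff_mult_distrib2)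
          finally have dvd: "B dvd 2 * r * (s - s')" .
          have "2 * r * (s - s') < 2 * r * K" using that r by simp
          also have "\<dots> \<le> B" using K by (simp add: B_def)
          finally have "2 * r * (s - s') = 0" using dvd nat_dvd_not_less by blast
          then show ?thesis using r that by simp
        qed
        fix s s' assume *: "s \<in> {..<K}" "s' \<in> {..<K}" and eq: "(i + 2 * r * s) mod B = (i + 2 * r * s') mod B"
        show "s = s'"
        proof (cases "s' \<le> s")
          case True
          then show ?thesis by (rule aux[OF _ _ eq]) (use * in simp)
        next
          case False
          then have "s' = s" by (intro aux[OF _ _ eq[symmetric]]) (use * in auto)
          then show ?thesis ..
        qed
      qed
      have "(\<Sum>s<K. X c c' j (i + 2 * r * s) a) = (\<Sum>s<K. X c c' j ((i + 2 * r * s) mod B) a)"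
        using periodic_mod[of "\<lambda>y. X c c' j y a" B] Xy by simp
      also have "\<dots> = (\<Sum>y\<in>(\<lambda>s. (i + 2 * r * s) mod B) ` {..<K}. X c c' j y a)"
        by (simp add: sum.reindex[OF inj])
      also have "\<dots> \<le> (\<Sum>y<B. X c c' j y a)"
        using B X0 by (intro sum_mono2) auto
      also have "\<dots> = (\<Sum>y<B. cmod (\<Sum>t<S. \<Psi> c (j + 2 * a * t) * cnj (\<Psi> c' ((y + j) + 2 * (a + r) * t))))"
        unfolding X_def by (simp only: add.commute[of j])
      also have "\<dots> = (\<Sum>y<B. cmod (\<Sum>t<S. \<Psi> c (j + 2 * a * t) * cnj (\<Psi> c' (y + 2 * (a + r) * t))))"
      proof (rule sum_periodic_shift[of "\<lambda>y. cmod (\<Sum>t<S. \<Psi> c (j + 2 * a * t) * cnj (\<Psi> c' (y + 2 * (a + r) * t)))"])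
        fix y
        have "\<Psi> c' (y + B + 2 * (a + r) * t) = \<Psi> c' (y + 2 * (a + r) * t)" for t
          using \<Psi>per[of c' "y + 2 * (a + r) * t"] by (simp add: ac_simps)
        then show "cmod (\<Sum>t<S. \<Psi> c (j + 2 * a * t) * cnj (\<Psi> c' (y + B + 2 * (a + r) * t))) =
          cmod (\<Sum>t<S. \<Psi> c (j + 2 * a * t) * cnj (\<Psi> c' (y + 2 * (a + r) * t)))" by simp
      qed
      finally show "(\<Sum>s<K. X c c' j (i + 2 * r * s) a) \<le> (\<Sum>y<B. cmod (\<Sum>t<S. \<Psi> c (j + 2 * a * t) * cnj (\<Psi> c' (y + 2 * (a + r) * t))))" .
    qed
    also have "\<dots> \<le> real B ^ 3 * ?root"
      using fourier[OF c] by (intro sum_correlations_le B \<delta> \<Psi>per \<Psi>1) (simp add: window_sum_def \<Psi>_def B_def)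
    finally have "(\<Sum>s<K. \<Sum>u<U. Y x s (u\<^sup>2 div U) u) \<le> 36 * real W / real B * (real B ^ 3 * ?root)"
      using B by (simp add: mult_left_mono divide_right_mono)
    also have "\<dots> = 36 * real U * real B * ?root"
      using B by (simp add: UWB power3_eq_cube field_simps)
    finally show ?thesis .
  qed
  have "real S * (\<Sum>u<U. cmod (\<Sum>s<K. \<psi> u s * cnj (\<psi> (u + r) s))) =
      (\<Sum>u<U. real S * cmod (\<Sum>s<K. \<psi> u s * cnj (\<psi> (u + r) s)))"
    by (rule sum_distrib_left)
  also have "\<dots> \<le> (\<Sum>u<U. (\<Sum>s<K. cmod (\<Sum>t<S. \<psi> u (s + t) * cnj (\<psi> (u + r) (s + t)))) + (real S)\<^sup>2)"
    by (intro sum_mono van_der_corput) (simp add: \<psi>_def norm_mult)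
  also have "\<dots> = (\<Sum>u<U. \<Sum>s<K. cmod (\<Sum>t<S. \<psi> u (s + t) * cnj (\<psi> (u + r) (s + t)))) + (real S)\<^sup>2 * real U"
    by (simp add: sum.distrib mult.commute)
  also have "(\<Sum>u<U. \<Sum>s<K. cmod (\<Sum>t<S. \<psi> u (s + t) * cnj (\<psi> (u + r) (s + t)))) \<le>
      (\<Sum>u<U. \<Sum>s<K. \<Sum>x\<in>I. Y x s (u\<^sup>2 div U) u)"
  proof (intro sum_mono)
    fix u s assume "u \<in> {..<U}"
    then show "cmod (\<Sum>t<S. \<psi> u (s + t) * cnj (\<psi> (u + r) (s + t))) \<le> (\<Sum>x\<in>I. Y x s (u\<^sup>2 div U) u)"
      using VY[of u s] idx[of u] I(1) Y0 member_le_sum[of "idx u" I "\<lambda>x. Y x s (u\<^sup>2 div U) u"] by auto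
  qed
  also have "\<dots> = (\<Sum>x\<in>I. \<Sum>s<K. \<Sum>u<U. Y x s (u\<^sup>2 div U) u)"
  proof -
    have "(\<Sum>u<U. \<Sum>s<K. \<Sum>x\<in>I. Y x s (u\<^sup>2 div U) u) = (\<Sum>u<U. \<Sum>x\<in>I. \<Sum>s<K. Y x s (u\<^sup>2 div U) u)"
      by (rule sum.cong[OF refl]) (rule sum.swap)
    also have "\<dots> = (\<Sum>x\<in>I. \<Sum>u<U. \<Sum>s<K. Y x s (u\<^sup>2 div U) u)"
      by (rule sum.swap)
    also have "\<dots> = (\<Sum>x\<in>I. \<Sum>s<K. \<Sum>u<U. Y x s (u\<^sup>2 div U) u)"
      by (rule sum.cong[OF refl]) (rule sum.swap)
    finally show ?thesis .
  qed
  also have "\<dots> \<le> (\<Sum>x\<in>I. 36 * real U * real B * ?root)"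
    by (intro sum_mono per_x)
  also have "\<dots> = (real \<alpha> * real \<beta>)\<^sup>2 * (2 * real r + 2) * 36 * real U * real (b ^ w) * ?root"
    by (simp add: I(2) B_def)
  finally show ?thesis by simp
qed

text \<open>Counts the n = u + U * s whose window comes within \<open>Z\<close> of overflowing. For
  a fixed carry, an affine map with slope \<gamma> is injective modulo b^w by coprimality, so at
  most \<open>Z\<close> residues j qualify; the sum over carries gives the factor \<gamma>.\<close>

lemma card_carry_blocks_le:
  assumes \<gamma>: "\<gamma> > 0" "coprime \<gamma> b" and w: "w \<le> \<mu>" "8 \<le> b ^ w" "2 * (b ^ w) ^ 3 < b ^ (\<mu> - w)"
  defines "U \<equiv> b ^ \<mu>"
  shows "(\<Sum>u<U. \<Sum>s<K. of_bool (b ^ w \<le> (\<gamma> * (u\<^sup>2 div U + 2 * u * s) + low_carry U \<gamma> u) mod b ^ w + Z))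
    \<le> 36 * real \<gamma> * real K * real U * real Z / real (b ^ w)"
proof -
  define B where "B = b ^ w"
  define W where "W = b ^ (\<mu> - w)"
  have UWB: "U = W * B" using w(1) by (simp add: U_def W_def B_def power_add[symmetric])
  have U: "U > 0" and B: "B > 0" using base by (auto simp: U_def B_def)
  define Y where "Y = (\<lambda>c s j a. of_bool (B \<le> (\<gamma> * (j + 2 * a * s) + c) mod B + Z) :: real)"
  have cnt: "(\<Sum>j<B. Y c s j a) \<le> real Z" for c s a
  proof -
    have "(\<Sum>j<B. Y c s j a) = real (card {j\<in>{..<B}. B \<le> (\<gamma> * (j + 2 * a * s) + c) mod B + Z})"
      by (simp add: Y_def of_bool_def sum.If_cases Int_def)
    also have "card {j\<in>{..<B}. B \<le> (\<gamma> * (j + 2 * a * s) + c) mod B + Z} \<le> card {B - Z..<B}"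
    proof (rule card_inj_on_le[where f = "\<lambda>j. (\<gamma> * j + (\<gamma> * (2 * a * s) + c)) mod B"])
      show "inj_on (\<lambda>j. (\<gamma> * j + (\<gamma> * (2 * a * s) + c)) mod B) {j \<in> {..<B}. B \<le> (\<gamma> * (j + 2 * a * s) + c) mod B + Z}"
        using \<gamma>(2) by (intro inj_on_subset[OF inj_on_affine_mod]) (auto simp: B_def)
      show "(\<lambda>j. (\<gamma> * j + (\<gamma> * (2 * a * s) + c)) mod B) ` {j \<in> {..<B}. B \<le> (\<gamma> * (j + 2 * a * s) + c) mod B + Z} \<subseteq> {B - Z..<B}"
        using B by (auto simp: algebra_simps)
    qed simp
    also have "card {B - Z..<B} \<le> Z" by simp
    finally show ?thesis by simp
  qed
  have "(\<Sum>u<U. \<Sum>s<K. of_bool (b ^ w \<le> (\<gamma> * (u\<^sup>2 div U + 2 * u * s) + low_carry U \<gamma> u) mod b ^ w + Z))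
      \<le> (\<Sum>u<U. \<Sum>s<K. \<Sum>c<\<gamma>. Y c s (u\<^sup>2 div U) u)"
  proof (intro sum_mono)
    fix u s
    have "(of_bool (b ^ w \<le> (\<gamma> * (u\<^sup>2 div U + 2 * u * s) + low_carry U \<gamma> u) mod b ^ w + Z) :: real) = Y (low_carry U \<gamma> u) s (u\<^sup>2 div U) u"
      by (simp add: Y_def B_def)
    also have "\<dots> \<le> (\<Sum>c<\<gamma>. Y c s (u\<^sup>2 div U) u)"
      using low_carry_less[OF U \<gamma>(1)] by (intro member_le_sum) (auto simp: Y_def)
    finally show "of_bool (b ^ w \<le> (\<gamma> * (u\<^sup>2 div U + 2 * u * s) + low_carry U \<gamma> u) mod b ^ w + Z) \<le> (\<Sum>c<\<gamma>. Y c s (u\<^sup>2 div U) u)" .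
  qed
  also have "\<dots> = (\<Sum>s<K. \<Sum>u<U. \<Sum>c<\<gamma>. Y c s (u\<^sup>2 div U) u)"
    by (rule sum.swap)
  also have "\<dots> = (\<Sum>s<K. \<Sum>c<\<gamma>. \<Sum>u<U. Y c s (u\<^sup>2 div U) u)"
    by (rule sum.cong[OF refl]) (rule sum.swap)
  also have "\<dots> \<le> (\<Sum>s<K. \<Sum>c<\<gamma>. 36 * real W / real B * (\<Sum>a<B. \<Sum>j<B. Y c s j a))"
    unfolding UWB
  proof (intro sum_mono sum_over_square_cells_le)
    have md: "(x + B * k) mod B = x mod B" for x k by simp
    fix c s j a
    have "\<gamma> * (j + B + 2 * a * s) + c = \<gamma> * (j + 2 * a * s) + c + B * \<gamma>" by (simp add: algebra_simps)
    then show "Y c s (j + B) a = Y c s j a" unfolding Y_def by (simp only: md)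
    have "\<gamma> * (j + 2 * (a + B) * s) + c = \<gamma> * (j + 2 * a * s) + c + B * (\<gamma> * 2 * s)" by (simp add: algebra_simps)
    then show "Y c s j (a + B) = Y c s j a" unfolding Y_def by (simp only: md)
  qed (use w in \<open>auto simp: B_def W_def Y_def\<close>)
  also have "\<dots> \<le> (\<Sum>s<K. \<Sum>c<\<gamma>. 36 * real W / real B * (\<Sum>a<B. real Z))"
    by (intro sum_mono mult_left_mono cnt) auto
  also have "\<dots> = 36 * real \<gamma> * real K * real U * real Z / real (b ^ w)"
    using B by (simp add: UWB B_def[symmetric])
  finally show ?thesis .
qed

text \<open>For fixed r, the multiples by \<alpha> or \<beta> of n^2 and (n + r)^2 agree above the
  window unless the increment carries out of it. There the values of \<open>g\<close> cancel, and
  only the windows are left for \<open>block_correlation_le\<close>.\<close>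

lemma sublinear_dilate_quotient_squares:
  assumes ab: "\<alpha> > 0" "\<beta> > 0" "coprime \<alpha> b" "coprime \<beta> b"
    and decay: "\<And>\<delta>. \<delta> > 0 \<Longrightarrow> \<exists>w0. \<forall>w\<ge>w0. \<forall>c<\<alpha>. \<forall>c'<\<beta>. \<forall>\<omega>. cmod (window_sum \<alpha> \<beta> w c c' \<omega>) \<le> \<delta> * real (b ^ w)"
  shows "sublinear (\<lambda>N. \<Sum>n<N. dilate_quotient \<alpha> \<beta> (n\<^sup>2))"
proof (rule sublinear_van_der_corput)
  let ?h = "dilate_quotient \<alpha> \<beta>"
  fix r :: nat assume r: "r > 0"
  show "sublinear (\<lambda>N. \<Sum>n<N. ?h (n\<^sup>2) * cnj (?h ((n + r)\<^sup>2)))"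
  proof (rule sublinearI)
    fix \<epsilon> :: real assume \<epsilon>: "\<epsilon> > 0"
    have b1: "real b > 1" using base by simp
    have big: "\<exists>d0. \<forall>d\<ge>d0. x \<le> real (b ^ d)" for x :: real
    proof -
      obtain d0 where d0: "x < real b ^ d0" using real_arch_pow[OF b1] by blast
      have "x \<le> real (b ^ d)" if "d \<ge> d0" for d
      proof -
        have "real b ^ d0 \<le> real b ^ d" using b1 that by (intro power_increasing) auto
        then show ?thesis using d0 by simp
      qed
      then show ?thesis by blast
    qed
    \<comment> \<open>Guard digits: 1728 = 16 * 36 * 3 makes the main part of the escaping carries
      cost \<epsilon> / 16, and 2 * r \<le> b^d yields 2 * r * K \<le> b^w later.\<close>
    obtain d where d: "max (2 * real r) (1728 * (real \<alpha> ^ 2 + real \<beta> ^ 2) * real r / \<epsilon>) \<le> real (b ^ d)"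
      using big by blast
    have bd0: "real (b ^ d) > 0" using base by simp
    define D where "D = real (b ^ (d + 1))"
    have D0: "D > 0" using base by (simp add: D_def)
    define C where "C = (real \<alpha> * real \<beta>)\<^sup>2 * (2 * real r + 2) * 36"
    have C0: "C \<ge> 0" by (simp add: C_def)
    \<comment> \<open>Chosen to give C * D * sqrt (2 * S) \<le> S * \<epsilon> / 8; the \<delta>
      below makes 2 * S^3 * \<delta> = S, so the root in the correlation bound is sqrt (2 *
      S).\<close>
    obtain S0 :: nat where S0: "2 * (8 * C * D / \<epsilon>)\<^sup>2 \<le> real S0" using real_arch_simple by blast
    define S where "S = Suc S0"
    have S: "2 * (8 * C * D / \<epsilon>)\<^sup>2 \<le> real S" "S > 0" using S0 by (auto simp: S_def)
    define \<delta> where "\<delta> = 1 / (2 * (real S)\<^sup>2)"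
    have \<delta>: "\<delta> > 0" using S by (simp add: \<delta>_def)
    obtain w0 where w0: "\<And>w c c' \<omega>. w \<ge> w0 \<Longrightarrow> c < \<alpha> \<Longrightarrow> c' < \<beta> \<Longrightarrow> cmod (window_sum \<alpha> \<beta> w c c' \<omega>) \<le> \<delta> * real (b ^ w)"
      using decay[OF \<delta>] by blast
    \<comment> \<open>The 8 serves the cell count, 576 = 16 * 36 the rounding 1 in \<open>Z\<close>,
      and the last term makes S * U at most \<epsilon> / 8 * N.\<close>
    obtain w1 where w1: "\<And>w. w \<ge> w1 \<Longrightarrow> 8 + 576 * (real \<alpha> + real \<beta>) / \<epsilon> + 8 * real S * D / \<epsilon> \<le> real (b ^ w)"
      using big by blast
    define w where "w = max (max w0 w1) (d + 1)"
    have w: "w \<ge> w0" "w \<ge> w1" "w \<ge> d + 1" by (auto simp: w_def)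
    define B where "B = real (b ^ w)"
    have Bbig: "8 + 576 * (real \<alpha> + real \<beta>) / \<epsilon> + 8 * real S * D / \<epsilon> \<le> B"
      using w1[OF w(2)] by (simp add: B_def)
    have nn: "0 \<le> 576 * (real \<alpha> + real \<beta>) / \<epsilon>" "0 \<le> 8 * real S * D / \<epsilon>"
      using \<epsilon> D0 by simp_all
    have B8: "8 \<le> b ^ w"
    proof -
      have "real 8 \<le> real (b ^ w)" using Bbig nn by (simp add: B_def)
      then show ?thesis by (simp only: of_nat_le_iff)
    qed
    \<comment> \<open>Makes the \<mu> below at least 4 * w + 2 + r^2, which gives both 2 * b^(3 * w)
      < b^(\<mu> - w) and r^2 \<le> b^\<mu>.\<close>
    define n0 where "n0 = 5 * w + 2 + r\<^sup>2"
    have main: "cmod (\<Sum>n<N. ?h (n\<^sup>2) * cnj (?h ((n + r)\<^sup>2))) \<le> \<epsilon> * real N" if N: "N \<ge> b ^ n0" for N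
    proof -
      have "N \<ge> 1" using N base by (meson le_trans one_le_power one_le_numeral)
      then obtain \<nu> where \<nu>: "b ^ \<nu> \<le> N" "N < b ^ (\<nu> + 1)"
        using ex_power_ivl1[of b N] base by auto
      have "b ^ n0 < b ^ (\<nu> + 1)" using N \<nu> by linarith
      then have "n0 < \<nu> + 1" using base by (simp only: power_strict_increasing_iff)
      \<comment> \<open>The window ends at place \<mu> + w = \<nu> + 1 + d, which is d digits above
        \<open>N\<close>, because the increment 2 * n * r has the order of \<open>N\<close>. It
        starts w digits lower, which keeps K = N div U bounded in terms of w.\<close>
      define \<mu> where "\<mu> = \<nu> + 1 + d - w"
      have \<mu>: "\<mu> + w = \<nu> + 1 + d" "\<nu> = \<mu> + (w - d - 1)" "4 * w + 2 + r\<^sup>2 \<le> \<mu>" "w \<le> \<mu>"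
        using \<open>n0 < \<nu> + 1\<close> w(3) by (auto simp: \<mu>_def n0_def)
      define U where "U = b ^ \<mu>"
      have U: "U > 0" using base by (simp add: U_def)
      have ltp: "m < b ^ m" for m
        using base power_gt_expt[of b m] by simp
      have rU: "r\<^sup>2 \<le> U"
        using ltp[of \<mu>] \<mu>(3) by (simp add: U_def)
      have cube: "2 * (b ^ w) ^ 3 < b ^ (\<mu> - w)"
      proof -
        have "2 * (b ^ w) ^ 3 = 2 * b ^ (3 * w)" by (simp add: power_mult[symmetric] mult.commute)
        also have "\<dots> < b ^ 2 * b ^ (3 * w)"
        proof -
          have "(2::nat) < 2 ^ 2" by simp
          also have "\<dots> \<le> b ^ 2" using base by (intro power_mono) auto
          finally show ?thesis using base by simp
        qed
        also have "\<dots> = b ^ (3 * w + 2)" by (simp add: power_add[symmetric] add.commute)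
        also have "\<dots> \<le> b ^ (\<mu> - w)" using base \<mu>(3) by (intro power_increasing) auto
        finally show ?thesis .
      qed
      define K where "K = N div U"
      have NUK: "N = U * K + N mod U" by (simp add: K_def)
      have UB: "real U * B = real (b ^ \<nu>) * D"
      proof -
        have "U * b ^ w = b ^ \<nu> * b ^ (d + 1)" using \<mu>(1) by (simp add: U_def power_add[symmetric])
        then show ?thesis unfolding B_def D_def by (metis of_nat_mult)
      qed
      have UBN: "real U * B \<le> real N * D"
      proof -
        have "real (b ^ \<nu>) \<le> real N" using \<nu>(1) by (simp only: of_nat_le_iff)
        then show ?thesis unfolding UB using D0 by (intro mult_right_mono) auto
      qed
      have B0: "B > 0" using base by (simp add: B_def)
      have UN: "real S * real U \<le> \<epsilon> / 8 * real N" "real U \<le> \<epsilon> / 8 * real N"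
      proof -
        have "8 * real S * D / \<epsilon> \<le> B" using Bbig nn by linarith
        then have SD: "real S * D \<le> \<epsilon> / 8 * B" using \<epsilon> by (simp add: field_simps)
        have "real S * real U * B \<le> real S * (real N * D)" using UBN by (simp add: mult.assoc mult_left_mono)
        also have "\<dots> = real N * (real S * D)" by simp
        also have "\<dots> \<le> real N * (\<epsilon> / 8 * B)" using SD by (intro mult_left_mono) auto
        finally have "real S * real U * B \<le> (\<epsilon> / 8 * real N) * B" by (simp add: mult_ac)
        then show 1: "real S * real U \<le> \<epsilon> / 8 * real N" using B0 by simp
        have "1 * real U \<le> real S * real U" using S(2) by (intro mult_right_mono) auto
        then show "real U \<le> \<epsilon> / 8 * real N" using 1 by linarith
      qed
      have K2: "2 * r * K \<le> b ^ w"
      proof -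
        have "U * K \<le> N" using NUK by simp
        also have "\<dots> < b ^ (\<nu> + 1)" by (rule \<nu>(2))
        finally have "b ^ d * (U * K) \<le> b ^ d * b ^ (\<nu> + 1)" by simp
        also have "\<dots> = U * b ^ w" using \<mu>(1) by (simp add: U_def power_add[symmetric] add.commute add.left_commute)
        finally have "b ^ d * K \<le> b ^ w" using U by (simp add: mult.left_commute)
        moreover have "2 * r \<le> b ^ d"
        proof -
          have "real (2 * r) \<le> real (b ^ d)" using d by simp
          then show ?thesis by (simp only: of_nat_le_iff)
        qed
        ultimately show ?thesis by (meson le_trans mult_le_mono1)
      qed
      define F where "F = (\<lambda>n. ?h (n\<^sup>2) * cnj (?h ((n + r)\<^sup>2)))"
      define F' where "F' = (\<lambda>n. window \<alpha> \<beta> (\<mu> + w) 0 0 (n\<^sup>2) * cnj (window \<alpha> \<beta> (\<mu> + w) 0 0 ((n + r)\<^sup>2)))"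
      define bad where "bad = (\<lambda>\<gamma> n. b ^ (\<mu> + w) \<le> (\<gamma> * n\<^sup>2) mod b ^ (\<mu> + w) + \<gamma> * (2 * n * r + r\<^sup>2))"
      have FF': "cmod (F n - F' n) \<le> 2 * of_bool (bad \<alpha> n) + 2 * of_bool (bad \<beta> n)" for n
      proof (cases "bad \<alpha> n \<or> bad \<beta> n")
        case True
        have "cmod (F n - F' n) \<le> cmod (F n) + cmod (F' n)" by (rule norm_triangle_ineq4)
        also have "\<dots> = 2" by (simp add: F_def F'_def norm_mult)
        finally show ?thesis using True by auto
      next
        case False
        have split: "g (\<gamma> * (n + r)\<^sup>2) = g ((\<gamma> * (n + r)\<^sup>2) mod b ^ (\<mu> + w)) * g (\<gamma> * n\<^sup>2 div b ^ (\<mu> + w))"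
          if "\<not> bad \<gamma> n" for \<gamma>
        proof -
          define q where "q = \<gamma> * n\<^sup>2 div b ^ (\<mu> + w)"
          define e where "e = (\<gamma> * n\<^sup>2) mod b ^ (\<mu> + w) + \<gamma> * (2 * n * r + r\<^sup>2)"
          have "\<gamma> * (n + r)\<^sup>2 = b ^ (\<mu> + w) * q + e"
            using mult_div_mod_eq[of "b ^ (\<mu> + w)" "\<gamma> * n\<^sup>2"] by (simp add: q_def e_def power2_eq_square algebra_simps)
          moreover have "e < b ^ (\<mu> + w)"
            using that by (simp add: bad_def e_def)
          ultimately have "\<gamma> * (n + r)\<^sup>2 div b ^ (\<mu> + w) = \<gamma> * n\<^sup>2 div b ^ (\<mu> + w)"
            unfolding q_def[symmetric] using base by auto
          then show ?thesis using g_mod_div[of "\<gamma> * (n + r)\<^sup>2" "\<mu> + w"] by simp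
        qed
        define ea where "ea = g (\<alpha> * n\<^sup>2 div b ^ (\<mu> + w))"
        define eb where "eb = g (\<beta> * n\<^sup>2 div b ^ (\<mu> + w))"
        have gs: "g (\<alpha> * (n + r)\<^sup>2) = g ((\<alpha> * (n + r)\<^sup>2) mod b ^ (\<mu> + w)) * ea"
          "g (\<beta> * (n + r)\<^sup>2) = g ((\<beta> * (n + r)\<^sup>2) mod b ^ (\<mu> + w)) * eb"
          "g (\<alpha> * n\<^sup>2) = g ((\<alpha> * n\<^sup>2) mod b ^ (\<mu> + w)) * ea"
          "g (\<beta> * n\<^sup>2) = g ((\<beta> * n\<^sup>2) mod b ^ (\<mu> + w)) * eb"
          using split[of \<alpha>] split[of \<beta>] False g_mod_div[of "\<alpha> * n\<^sup>2" "\<mu> + w"] g_mod_div[of "\<beta> * n\<^sup>2" "\<mu> + w"]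
          unfolding ea_def eb_def by blast+
        have "F n = F' n * ((ea * cnj ea) * (eb * cnj eb))"
          unfolding F_def F'_def dilate_quotient_def window_def add_0_right gs
          by (simp only: complex_cnj_mult complex_cnj_cnj mult_ac)
        then have "F n = F' n" by (simp add: ea_def eb_def)
        then show ?thesis by simp
      qed
      have badsum: "(\<Sum>n<U * K. of_bool (bad \<gamma> n)) \<le> \<epsilon> / 8 * real N" if \<gamma>: "\<gamma> \<in> {\<alpha>, \<beta>}" for \<gamma>
      proof -
        \<comment> \<open>In units of \<open>U\<close> the increment is at most 3 * \<gamma> * r *
          b^(w - d); the extra 1 accounts for the digits below \<open>U\<close>.\<close>
        define Z where "Z = 3 * \<gamma> * r * b ^ (w - d) + 1"
        have "(\<Sum>n<U * K. of_bool (bad \<gamma> n) :: real) = (\<Sum>u<U. \<Sum>s<K. of_bool (bad \<gamma> (u + U * s)))"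
          by (rule sum_lessThan_times)
        also have "\<dots> \<le> (\<Sum>u<U. \<Sum>s<K. of_bool (b ^ w \<le> (\<gamma> * (u\<^sup>2 div U + 2 * u * s) + low_carry U \<gamma> u) mod b ^ w + Z))"
        proof (intro sum_mono)
          fix u s assume us: "u \<in> {..<U}" "s \<in> {..<K}"
          define q where "q = (\<gamma> * (u\<^sup>2 div U + 2 * u * s) + low_carry U \<gamma> u) mod b ^ w"
          have "b ^ w \<le> q + Z" if "bad \<gamma> (u + U * s)"
          proof -
            have "u + U * s < U * Suc s" using us by simp
            also have "\<dots> \<le> U * K" using us by (intro mult_le_mono2) auto
            also have "\<dots> \<le> N" using NUK by simp
            finally have n: "u + U * s \<le> b ^ (\<nu> + 1)" using \<nu>(2) by simp
            have "r \<le> r\<^sup>2" by (simp add: power2_eq_square)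
            also have "\<dots> \<le> b ^ \<mu>" using rU by (simp add: U_def)
            also have "\<dots> \<le> b ^ (\<nu> + 1)" using base \<mu>(2) by (intro power_increasing) auto
            finally have rb: "r \<le> b ^ (\<nu> + 1)" .
            have "2 * (u + U * s) * r + r\<^sup>2 \<le> 2 * b ^ (\<nu> + 1) * r + b ^ (\<nu> + 1) * r"
              unfolding power2_eq_square using n rb by (intro add_mono mult_le_mono) auto
            also have "\<dots> = 3 * r * b ^ (\<nu> + 1)" by simp
            also have "b ^ (\<nu> + 1) = U * b ^ (w - d)"
            proof -
              have "\<nu> + 1 = \<mu> + (w - d)" using \<mu>(2) w(3) by linarith
              then show ?thesis by (simp only: U_def power_add)
            qed
            finally have "\<gamma> * (2 * (u + U * s) * r + r\<^sup>2) \<le> \<gamma> * (3 * r * (U * b ^ (w - d)))"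
              by (rule mult_le_mono2)
            moreover have "(\<gamma> * (u + U * s)\<^sup>2) mod b ^ (\<mu> + w) < U + U * q"
              unfolding U_def square_mod_split[OF \<mu>(4)] q_def[unfolded U_def] using U by (simp add: U_def)
            ultimately have "b ^ (\<mu> + w) < U + U * q + \<gamma> * (3 * r * (U * b ^ (w - d)))"
              using that unfolding bad_def by linarith
            then have "U * b ^ w < U * (q + Z)"
              by (simp add: U_def[symmetric] power_add Z_def algebra_simps)
            then show ?thesis by simp
          qed
          then show "of_bool (bad \<gamma> (u + U * s)) \<le> (of_bool (b ^ w \<le> (\<gamma> * (u\<^sup>2 div U + 2 * u * s) + low_carry U \<gamma> u) mod b ^ w + Z) :: real)"
            by (simp add: q_def)
        qed
        also have "\<dots> \<le> 36 * real \<gamma> * real K * real U * real Z / real (b ^ w)"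
          unfolding U_def using \<gamma> ab by (intro card_carry_blocks_le \<mu>(4) B8 cube) auto
        also have "\<dots> = (real K * real U) * (36 * real \<gamma> * (real Z / B))"
          by (simp add: B_def)
        also have "\<dots> \<le> real N * (\<epsilon> / 8)"
        proof (rule mult_mono)
          have "U * K \<le> N" using NUK by simp
          then show "real K * real U \<le> real N" by (metis mult.commute of_nat_le_iff of_nat_mult)
          have B: "B = real (b ^ d) * real (b ^ (w - d))"
            using w(3) by (simp add: B_def power_add[symmetric])
          have bwd: "real (b ^ (w - d)) > 0" using base by simp
          have "real Z = 3 * real \<gamma> * real r * real (b ^ (w - d)) + 1"
            by (simp add: Z_def)
          then have "real Z / B = 3 * real \<gamma> * real r * real (b ^ (w - d)) / B + 1 / B"
            by (simp add: add_divide_distrib)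
          also have "3 * real \<gamma> * real r * real (b ^ (w - d)) / B = 3 * real \<gamma> * real r / real (b ^ d)"
            unfolding B using base by (simp add: field_simps)
          finally have ZB: "real Z / B = 3 * real \<gamma> * real r / real (b ^ d) + 1 / B" .
          have "36 * real \<gamma> * (3 * real \<gamma> * real r / real (b ^ d)) \<le> \<epsilon> / 16"
          proof -
            have "1728 * (real \<gamma> ^ 2) * real r / \<epsilon> \<le> 1728 * (real \<alpha> ^ 2 + real \<beta> ^ 2) * real r / \<epsilon>"
              using \<gamma> \<epsilon> by (intro divide_right_mono mult_right_mono) auto
            also have "\<dots> \<le> real (b ^ d)" using d by simp
            finally have "1728 * (real \<gamma> ^ 2) * real r \<le> \<epsilon> * real (b ^ d)" using \<epsilon> by (simp add: field_simps)
            then have "(108 * (real \<gamma> ^ 2) * real r) \<le> \<epsilon> / 16 * real (b ^ d)" by linarith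
            then have "(108 * (real \<gamma> ^ 2) * real r) / real (b ^ d) \<le> \<epsilon> / 16" using bd0 by (simp only: pos_divide_le_eq)
            then show ?thesis by (simp add: power2_eq_square)
          qed
          moreover have "36 * real \<gamma> * (1 / B) \<le> \<epsilon> / 16"
          proof -
            have "576 * (real \<alpha> + real \<beta>) / \<epsilon> \<le> B" using Bbig nn by linarith
            then have "576 * (real \<alpha> + real \<beta>) \<le> \<epsilon> * B" using \<epsilon> by (simp add: field_simps)
            moreover have "real \<gamma> \<le> real \<alpha> + real \<beta>" using \<gamma> by auto
            ultimately have "36 * real \<gamma> \<le> (\<epsilon> * B) / 16"
              using divide_right_mono[of "576 * (real \<alpha> + real \<beta>)" "\<epsilon> * B" 16] by simp
            then show ?thesis using B0 by (simp add: field_simps)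
          qed
          ultimately show "36 * real \<gamma> * (real Z / B) \<le> \<epsilon> / 8"
            unfolding ZB distrib_left by linarith
        qed (use B0 in auto)
        finally show ?thesis by (simp add: mult.commute)
      qed
      have blocks: "cmod (\<Sum>n<U * K. F' n) \<le> \<epsilon> / 4 * real N"
      proof -
        define \<psi> where "\<psi> = (\<lambda>u s. window \<alpha> \<beta> w (low_carry U \<alpha> u) (low_carry U \<beta> u) (u\<^sup>2 div U + 2 * u * s))"
        define T where "T = (\<Sum>u<U. cmod (\<Sum>s<K. \<psi> u s * cnj (\<psi> (u + r) s)))"
        have "(\<Sum>n<U * K. F' n) = (\<Sum>u<U. \<Sum>s<K. F' (u + U * s))"
          by (rule sum_lessThan_times)
        also have "cmod \<dots> \<le> T"
          unfolding T_def
        proof (intro sum_norm_le)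
          fix u
          obtain \<kappa> where \<kappa>: "cmod \<kappa> = 1" "\<And>s. window \<alpha> \<beta> (\<mu> + w) 0 0 ((u + U * s)\<^sup>2) = \<kappa> * \<psi> u s"
            using window_square[OF \<mu>(4), of \<alpha> \<beta> u] unfolding \<psi>_def U_def by blast
          obtain \<kappa>' where \<kappa>': "cmod \<kappa>' = 1" "\<And>s. window \<alpha> \<beta> (\<mu> + w) 0 0 ((u + r + U * s)\<^sup>2) = \<kappa>' * \<psi> (u + r) s"
            using window_square[OF \<mu>(4), of \<alpha> \<beta> "u + r"] unfolding \<psi>_def U_def by blast
          have "F' (u + U * s) = (\<kappa> * cnj \<kappa>') * (\<psi> u s * cnj (\<psi> (u + r) s))" for s
            using \<kappa>(2)[of s] \<kappa>'(2)[of s] by (simp add: F'_def ac_simps)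
          then have "(\<Sum>s<K. F' (u + U * s)) = (\<kappa> * cnj \<kappa>') * (\<Sum>s<K. \<psi> u s * cnj (\<psi> (u + r) s))"
            by (simp add: sum_distrib_left)
          then show "cmod (\<Sum>s<K. F' (u + U * s)) \<le> cmod (\<Sum>s<K. \<psi> u s * cnj (\<psi> (u + r) s))"
            using \<kappa>(1) \<kappa>'(1) by (simp add: norm_mult)
        qed
        also have "T \<le> \<epsilon> / 4 * real N"
        proof -
          have "real S * T \<le> (real \<alpha> * real \<beta>)\<^sup>2 * (2 * real r + 2) * 36 * real U * real (b ^ w) * sqrt (real S + 2 * real S ^ 3 * \<delta>) + (real S)\<^sup>2 * real U"
            unfolding T_def \<psi>_def U_def
            using \<delta> by (intro block_correlation_le ab r \<mu>(4) B8 cube K2 w0 w(1)) (use rU in \<open>auto simp: U_def\<close>)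
          also have "real S + 2 * real S ^ 3 * \<delta> = 2 * real S"
            using S(2) by (simp add: \<delta>_def power2_eq_square power3_eq_cube)
          also have "(real \<alpha> * real \<beta>)\<^sup>2 * (2 * real r + 2) * 36 * real U * real (b ^ w) * sqrt (2 * real S) + (real S)\<^sup>2 * real U =
              C * sqrt (2 * real S) * (real U * B) + real S * (real S * real U)"
            by (simp add: C_def B_def power2_eq_square)
          also have "\<dots> \<le> C * sqrt (2 * real S) * (real N * D) + real S * (\<epsilon> / 8 * real N)"
            using UBN UN C0 by (intro add_mono mult_left_mono) auto
          also have "C * sqrt (2 * real S) * (real N * D) \<le> real S * (\<epsilon> / 8 * real N)"
          proof -
            have "C * D * sqrt (2 * real S) \<le> real S * \<epsilon> / 8"
            proof -
              have "8 * C * D / \<epsilon> \<le> sqrt (real S / 2)"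
                using S(1) by (intro real_le_rsqrt) simp
              then have "C * D \<le> \<epsilon> / 8 * sqrt (real S / 2)"
                using \<epsilon> by (simp add: field_simps)
              then have "C * D * sqrt (2 * real S) \<le> \<epsilon> / 8 * sqrt (real S / 2) * sqrt (2 * real S)"
                by (rule mult_right_mono) simp
              also have "sqrt (real S / 2) * sqrt (2 * real S) = real S"
                by (simp add: real_sqrt_mult[symmetric])
              then have "\<epsilon> / 8 * sqrt (real S / 2) * sqrt (2 * real S) = real S * \<epsilon> / 8"
                by (simp add: mult.assoc)
              finally show ?thesis .
            qed
            from mult_right_mono[OF this, of "real N"] show ?thesis by (simp add: mult_ac)
          qed
          finally have "real S * T \<le> real S * (\<epsilon> / 4 * real N)" by (simp add: algebra_simps)
          then show ?thesis using S(2) by simp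
        qed
        finally show ?thesis .
      qed
      have rest: "cmod (\<Sum>n<N. F n) \<le> cmod (\<Sum>n<U * K. F n) + real U"
      proof -
        have "(\<Sum>n<N. F n) = (\<Sum>n<U * K. F n) + (\<Sum>n\<in>{U * K..<N}. F n)"
          using NUK by (metis lessThan_atLeast0 le_add1 sum.atLeastLessThan_concat zero_le)
        also have "cmod \<dots> \<le> cmod (\<Sum>n<U * K. F n) + cmod (\<Sum>n\<in>{U * K..<N}. F n)"
          by (rule norm_triangle_ineq)
        also have "cmod (\<Sum>n\<in>{U * K..<N}. F n) \<le> (\<Sum>n\<in>{U * K..<N}. 1)"
          by (intro sum_norm_le) (simp add: F_def norm_mult)
        also have "\<dots> \<le> real U"
        proof -
          have "N - U * K = N mod U" using NUK by linarith
          also have "\<dots> \<le> U" using U by (simp add: less_imp_le)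
          finally show ?thesis by simp
        qed
        finally show ?thesis by simp
      qed
      have "cmod (\<Sum>n<U * K. F n) \<le> cmod (\<Sum>n<U * K. F' n) + cmod (\<Sum>n<U * K. F n - F' n)"
        using norm_triangle_ineq[of "\<Sum>n<U * K. F' n" "\<Sum>n<U * K. F n - F' n"] by (simp add: sum_subtractf)
      also have "cmod (\<Sum>n<U * K. F n - F' n) \<le> (\<Sum>n<U * K. 2 * of_bool (bad \<alpha> n) + 2 * of_bool (bad \<beta> n))"
        by (intro sum_norm_le FF')
      also have "\<dots> = 2 * (\<Sum>n<U * K. of_bool (bad \<alpha> n)) + 2 * (\<Sum>n<U * K. of_bool (bad \<beta> n))"
        by (simp only: sum.distrib sum_distrib_left)
      also have "\<dots> \<le> 2 * (\<epsilon> / 8 * real N) + 2 * (\<epsilon> / 8 * real N)"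
        using badsum[of \<alpha>] badsum[of \<beta>] by (intro add_mono mult_left_mono) auto
      finally have "cmod (\<Sum>n<N. F n) \<le> \<epsilon> / 4 * real N + (2 * (\<epsilon> / 8 * real N) + 2 * (\<epsilon> / 8 * real N)) + \<epsilon> / 8 * real N"
        using rest blocks UN(2) by linarith
      also have "\<dots> \<le> \<epsilon> * real N"
        using \<epsilon> by (simp add: field_simps)
      finally show ?thesis unfolding F_def .
    qed
    then show "\<forall>\<^sub>F N in sequentially. cmod (\<Sum>n<N. ?h (n\<^sup>2) * cnj (?h ((n + r)\<^sup>2))) \<le> \<epsilon> * real N"
      unfolding eventually_sequentially by blast
  qed
qed simp

end

section \<open>Euler products\<close>

definition completely_multiplicative :: "(nat \<Rightarrow> complex) \<Rightarrow> bool" where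
  "completely_multiplicative f \<longleftrightarrow> f 0 = 0 \<and> f 1 = 1 \<and> (\<forall>m n. f (m * n) = f m * f n)"

lemma completely_multiplicativeD:
  assumes "completely_multiplicative f"
  shows "f 0 = 0" "f (Suc 0) = 1" "f (m * n) = f m * f n"
  using assms by (auto simp: completely_multiplicative_def)

definition squarefree_over :: "nat set \<Rightarrow> nat set" where
  "squarefree_over Q = {n. squarefree n \<and> prime_factors n \<subseteq> Q}"

lemma squarefree_over_nonzero: "n \<in> squarefree_over Q \<Longrightarrow> n \<noteq> 0"
  by (rule notI) (simp add: squarefree_over_def)

lemma squarefree_over_insert:
  assumes p: "prime p" "p \<notin> Q"
  shows "squarefree_over (insert p Q) = squarefree_over Q \<union> (\<lambda>n. p * n) ` squarefree_over Q"
    and "n \<in> squarefree_over Q \<Longrightarrow> \<not> p dvd n"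
proof -
  show ndvd: "\<not> p dvd n" if "n \<in> squarefree_over Q" for n
  proof
    assume "p dvd n"
    moreover have "n \<noteq> 0" using that by (rule squarefree_over_nonzero)
    ultimately have "p \<in> prime_factors n" using p by (simp add: prime_factors_dvd)
    then show False using that p by (auto simp: squarefree_over_def)
  qed
  show "squarefree_over (insert p Q) = squarefree_over Q \<union> (\<lambda>n. p * n) ` squarefree_over Q"
  proof (intro equalityI subsetI)
    fix n assume n: "n \<in> squarefree_over (insert p Q)"
    have n0: "n \<noteq> 0" using n by (rule squarefree_over_nonzero)
    show "n \<in> squarefree_over Q \<union> (\<lambda>n. p * n) ` squarefree_over Q"
    proof (cases "p dvd n")
      case False
      then have "p \<notin> prime_factors n" by auto
      then show ?thesis using n by (auto simp: squarefree_over_def)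
    next
      case True
      then obtain m where m: "n = p * m" by blast
      have "squarefree m" using n m by (auto simp: squarefree_over_def dest: squarefree_multD)
      moreover have "\<not> p dvd m"
      proof
        assume "p dvd m"
        then have "p\<^sup>2 dvd n" by (simp add: m power2_eq_square)
        then show False using n p not_prime_unit squarefreeD by (auto simp: squarefree_over_def)
      qed
      moreover have "prime_factors m \<subseteq> insert p Q"
        using n m n0 by (auto simp: squarefree_over_def prime_factors_product)
      ultimately have "m \<in> squarefree_over Q"
        by (auto simp: squarefree_over_def in_prime_factors_imp_dvd)
      then show ?thesis using m by blast
    qed
  next
    fix n assume n: "n \<in> squarefree_over Q \<union> (\<lambda>n. p * n) ` squarefree_over Q"
    then consider "n \<in> squarefree_over Q" | m where "n = p * m" "m \<in> squarefree_over Q" by blast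
    then show "n \<in> squarefree_over (insert p Q)"
    proof cases
      case 2
      have "coprime p m" using ndvd[OF 2(2)] p by (simp add: prime_imp_coprime)
      then have "squarefree n"
        using 2 squarefree_mult_coprime[of p m] squarefree_prime[OF p(1)] by (auto simp: squarefree_over_def)
      moreover have "m \<noteq> 0" using 2(2) by (rule squarefree_over_nonzero)
      ultimately show ?thesis
        using 2 p by (auto simp: squarefree_over_def prime_factors_product prime_prime_factors)
    qed (auto simp: squarefree_over_def)
  qed
qed

lemma prod_one_minus_eq_sum_moebius:
  assumes f: "completely_multiplicative f" and "finite Q" "\<And>p. p \<in> Q \<Longrightarrow> prime p"
  shows "finite (squarefree_over Q) \<and> (\<Prod>p\<in>Q. 1 - f p) = (\<Sum>n\<in>squarefree_over Q. of_int (moebius_mu n) * f n)"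
  using assms(2,3)
proof (induction Q rule: finite_induct)
  case empty
  have "squarefree_over {} = {1}"
    by (auto simp: squarefree_over_def prime_factorization_empty_iff)
  then show ?case by (simp add: completely_multiplicativeD[OF f])
next
  case (insert p Q)
  note D = squarefree_over_insert[of p Q]
  have p: "prime p" using insert by simp
  have fin: "finite (squarefree_over Q)" using insert by simp
  have disj: "squarefree_over Q \<inter> (\<lambda>n. p * n) ` squarefree_over Q = {}"
    using D(2) p insert by fastforce
  have "(\<Sum>n\<in>squarefree_over (insert p Q). of_int (moebius_mu n) * f n) =
      (\<Sum>n\<in>squarefree_over Q. of_int (moebius_mu n) * f n) + (\<Sum>n\<in>(\<lambda>n. p * n) ` squarefree_over Q. of_int (moebius_mu n) * f n)"
    unfolding D(1)[OF p insert(2)] using fin disj by (intro sum.union_disjoint) auto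
  also have "(\<Sum>n\<in>(\<lambda>n. p * n) ` squarefree_over Q. of_int (moebius_mu n) * f n) =
      (\<Sum>n\<in>squarefree_over Q. of_int (moebius_mu (p * n)) * f (p * n))"
    using p by (subst sum.reindex) (auto simp: inj_on_def)
  also have "\<dots> = (\<Sum>n\<in>squarefree_over Q. - f p * (of_int (moebius_mu n) * f n))"
    using D(2)[OF p insert(2)] p
    by (intro sum.cong refl) (simp add: moebius_mu_mult_prime completely_multiplicativeD(3)[OF f])
  also have "\<dots> = - f p * (\<Sum>n\<in>squarefree_over Q. of_int (moebius_mu n) * f n)"
    by (simp only: sum_distrib_left)
  finally have "(\<Sum>n\<in>squarefree_over (insert p Q). of_int (moebius_mu n) * f n) =
      (1 - f p) * (\<Sum>n\<in>squarefree_over Q. of_int (moebius_mu n) * f n)"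
    by (simp add: algebra_simps)
  moreover have "finite (squarefree_over (insert p Q))"
    using D(1)[OF p insert(2)] fin by simp
  ultimately show ?case using insert by simp
qed

section \<open>Absolutely convergent Euler products\<close>

lemma summable_on_norm_imp:
  fixes f :: "nat \<Rightarrow> complex"
  assumes "(\<lambda>n. norm (f n)) summable_on UNIV"
  shows "f summable_on A"
  using assms abs_summable_summable summable_on_subset_banach by blast

text \<open>A sieve: the factor 1 - f p removes the multiples of p from the sum, by reindexing n as
  p * n. Using 1 - f p and not its inverse avoids geometric series.\<close>

lemma prod_one_minus_mult_infsum:
  assumes f: "completely_multiplicative f" and sum: "(\<lambda>n. norm (f n)) summable_on UNIV"
    and "finite Q" "\<And>p. p \<in> Q \<Longrightarrow> prime p"
  shows "(\<Prod>p\<in>Q. 1 - f p) * infsum f UNIV = infsum f {n. \<forall>p\<in>Q. \<not> p dvd n}"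
  using assms(3,4)
proof (induction Q rule: finite_induct)
  case (insert p Q)
  define R where "R = {n. \<forall>q\<in>Q. \<not> q dvd n}"
  have p: "prime p" using insert by simp
  have sub: "(\<lambda>n. p * n) ` R = {n \<in> R. p dvd n}"
  proof -
    have "q dvd p * n \<longleftrightarrow> q dvd n" if "q \<in> Q" for q n
    proof -
      have "prime q" "q \<noteq> p" using that insert by auto
      then have "coprime q p" using p primes_coprime by blast
      then show ?thesis by (simp add: coprime_dvd_mult_right_iff)
    qed
    note dvd_iff = this
    show ?thesis
    proof (intro equalityI subsetI)
      fix n assume n: "n \<in> {n \<in> R. p dvd n}"
      then obtain m where m: "n = p * m" by blast
      then have "m \<in> R" using n dvd_iff by (auto simp: R_def)
      then show "n \<in> (\<lambda>n. p * n) ` R" using m by blast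
    qed (auto simp: R_def dvd_iff)
  qed
  have "infsum f R = infsum f ((R - (\<lambda>n. p * n) ` R) \<union> (\<lambda>n. p * n) ` R)"
    using sub by (intro arg_cong[of _ _ "infsum f"]) auto
  also have "\<dots> = infsum f (R - (\<lambda>n. p * n) ` R) + infsum f ((\<lambda>n. p * n) ` R)"
    using summable_on_norm_imp[OF sum] by (intro infsum_Un_disjoint) auto
  also have "infsum f ((\<lambda>n. p * n) ` R) = infsum (f \<circ> (\<lambda>n. p * n)) R"
    using p by (intro infsum_reindex) (auto simp: inj_on_def)
  also have "\<dots> = infsum (\<lambda>n. f p * f n) R"
    by (simp add: comp_def completely_multiplicativeD(3)[OF f])
  also have "\<dots> = f p * infsum f R"
    by (rule infsum_cmult_right) (rule summable_on_norm_imp[OF sum])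
  finally have "infsum f R - f p * infsum f R = infsum f (R - (\<lambda>n. p * n) ` R)"
    by (subst diff_eq_eq)
  then have "(1 - f p) * infsum f R = infsum f (R - (\<lambda>n. p * n) ` R)"
    by (simp only: left_diff_distrib mult_1)
  moreover have "R - (\<lambda>n. p * n) ` R = {n. \<forall>q\<in>insert p Q. \<not> q dvd n}"
    unfolding sub by (auto simp: R_def)
  ultimately show ?case using insert by (simp add: R_def mult.assoc)
qed simp

lemma infsum_tail_tendsto_0:
  fixes F :: "nat \<Rightarrow> real"
  assumes F: "F summable_on UNIV"
  shows "(\<lambda>y. infsum F {y<..}) \<longlonglongrightarrow> 0"
proof -
  have "infsum F {y<..} = infsum F UNIV - sum F {..<Suc y}" for y
  proof -
    have "infsum F (UNIV - {..y}) = infsum F UNIV - infsum F {..y}"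
      using F by (intro infsum_Diff) auto
    moreover have "UNIV - {..y} = {y<..}" by auto
    ultimately show ?thesis by (simp add: lessThan_Suc_atMost)
  qed
  moreover have "(\<lambda>y. infsum F UNIV - sum F {..<Suc y}) \<longlonglongrightarrow> infsum F UNIV - infsum F UNIV"
    using has_sum_imp_sums[OF has_sum_infsum[OF F]] unfolding sums_def
    by (intro tendsto_intros filterlim_compose[OF _ filterlim_Suc])
  ultimately show ?thesis by simp
qed

lemma prime_divisor_le_or_gt:
  fixes n y :: nat
  assumes "\<And>p. prime p \<Longrightarrow> p \<le> y \<Longrightarrow> \<not> p dvd n" "n \<noteq> 0" "n \<noteq> 1"
  shows "y < n"
proof -
  obtain p where "prime p" "p dvd n" using prime_factor_nat[OF assms(3)] by blast
  then have "p \<le> n" "\<not> p \<le> y" using assms(1)[of p] dvd_imp_le[of p n] assms(2) by auto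
  then show ?thesis by linarith
qed

text \<open>Both errors are tails over n > y: an n other than 0 and 1 without prime divisors up to y
  exceeds y, and every squarefree n \<le> y already occurs in the expanded product. Nothing is
  divided by, so nonvanishing of the sum is a consequence and not a premise.\<close>

lemma euler_product_tendsto:
  assumes f: "completely_multiplicative f" and sum: "(\<lambda>n. norm (f n)) summable_on UNIV"
  shows "(\<lambda>y. (\<Prod>p | prime p \<and> p \<le> y. 1 - f p) * infsum f UNIV) \<longlonglongrightarrow> 1"
    and "(\<lambda>y. \<Prod>p | prime p \<and> p \<le> y. 1 - f p) \<longlonglongrightarrow> infsum (\<lambda>n. of_int (moebius_mu n) * f n) UNIV"
proof -
  define t where "t = (\<lambda>y. infsum (\<lambda>n. norm (f n)) {y<..})"
  have t: "t \<longlonglongrightarrow> 0" unfolding t_def by (rule infsum_tail_tendsto_0[OF sum])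
  have tail: "norm (infsum g A) \<le> t y" if "A \<subseteq> {y<..}" "\<And>n. norm (g n) \<le> norm (f n)" for g A y
  proof -
    have gs: "(\<lambda>n. norm (g n)) summable_on A"
      using sum that(2) by (intro summable_on_comparison_test[OF summable_on_subset_banach[OF sum]]) auto
    have "norm (infsum g A) \<le> infsum (\<lambda>n. norm (g n)) A"
      using gs by (rule norm_infsum_bound)
    also have "\<dots> \<le> t y"
      unfolding t_def using that gs by (intro infsum_mono_neutral summable_on_subset_banach[OF sum]) auto
    finally show ?thesis .
  qed
  let ?Q = "\<lambda>y. {p. prime p \<and> p \<le> y}"
  have fin: "finite (?Q y)" for y :: nat by simp
  have 1: "norm ((\<Prod>p\<in>?Q y. 1 - f p) * infsum f UNIV - 1) \<le> t y" for y
  proof -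
    define A where "A = {n. \<forall>p\<in>?Q y. \<not> p dvd n}"
    have A1: "Suc 0 \<in> A" by (auto simp: A_def)
    have "(\<Prod>p\<in>?Q y. 1 - f p) * infsum f UNIV = infsum f A"
      unfolding A_def by (rule prod_one_minus_mult_infsum[OF f sum fin]) auto
    also have "\<dots> = infsum f (A - {0})"
      by (rule infsum_cong_neutral) (auto simp: completely_multiplicativeD[OF f])
    also have "A - {0} = insert 1 (A - {0, 1})" using A1 by auto
    also have "\<dots> = {1} \<union> (A - {0, 1})" by simp
    also have "infsum f \<dots> = infsum f {1} + infsum f (A - {0, 1})"
      by (rule infsum_Un_disjoint) (auto intro: summable_on_norm_imp[OF sum])
    finally have "(\<Prod>p\<in>?Q y. 1 - f p) * infsum f UNIV - 1 = infsum f (A - {0, 1})"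
      by (simp add: completely_multiplicativeD[OF f])
    also have "norm \<dots> \<le> t y"
      by (rule tail) (auto simp: A_def intro: prime_divisor_le_or_gt)
    finally show ?thesis .
  qed
  have "(\<lambda>y. (\<Prod>p\<in>?Q y. 1 - f p) * infsum f UNIV - 1) \<longlonglongrightarrow> 0"
    by (rule Lim_null_comparison[OF _ t]) (use 1 in auto)
  then show "(\<lambda>y. (\<Prod>p\<in>?Q y. 1 - f p) * infsum f UNIV) \<longlonglongrightarrow> 1"
    by (simp add: LIM_zero_iff)
  define h where "h = (\<lambda>n. of_int (moebius_mu n) * f n)"
  have h: "norm (h n) \<le> norm (f n)" for n
    using cmod_moebius_mu_le[of n] by (simp add: h_def norm_mult mult_left_le_one_le del: norm_of_int)
  have hsum: "(\<lambda>n. norm (h n)) summable_on UNIV"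
    using h by (intro summable_on_comparison_test[OF sum]) auto
  have 2: "norm ((\<Prod>p\<in>?Q y. 1 - f p) - infsum h UNIV) \<le> t y" for y
  proof -
    define D where "D = squarefree_over (?Q y)"
    have D: "finite D" "(\<Prod>p\<in>?Q y. 1 - f p) = sum h D"
      using prod_one_minus_eq_sum_moebius[OF f fin, of y] by (auto simp: D_def h_def)
    have "infsum h (UNIV - D) = infsum h UNIV - sum h D"
      using infsum_Diff[OF summable_on_norm_imp[OF hsum, of UNIV] summable_on_norm_imp[OF hsum, of D]] D(1) by simp
    then have "norm ((\<Prod>p\<in>?Q y. 1 - f p) - infsum h UNIV) = norm (infsum h (UNIV - D))"
      by (simp add: D(2) norm_minus_commute)
    also have "infsum h (UNIV - D) = infsum h ({y<..} - D)"
    proof (rule infsum_cong_neutral)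
      fix n assume n: "n \<in> (UNIV - D) - ({y<..} - D)"
      then have "n \<le> y" "n \<notin> D" by auto
      then have "\<not> squarefree n"
        by (auto simp: D_def squarefree_over_def dest: in_prime_factors_imp_prime)
           (metis dvd_imp_le in_prime_factors_imp_dvd le_trans not_squarefree_0 not_gr_zero)
      then show "h n = 0" by (simp add: h_def moebius_mu_def)
    qed auto
    also have "norm \<dots> \<le> t y" by (rule tail) (use h in auto)
    finally show ?thesis .
  qed
  have "(\<lambda>y. (\<Prod>p\<in>?Q y. 1 - f p) - infsum h UNIV) \<longlonglongrightarrow> 0"
    by (rule Lim_null_comparison[OF _ t]) (use 2 in auto)
  then show "(\<lambda>y. \<Prod>p\<in>?Q y. 1 - f p) \<longlonglongrightarrow> infsum (\<lambda>n. of_int (moebius_mu n) * f n) UNIV"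
    by (simp add: LIM_zero_iff h_def)
qed

text \<open>Comparing the two limits of one product identifies the \<mu>-series as the inverse;
  convolution of arithmetic functions does not enter.\<close>

lemma infsum_moebius_mult_infsum:
  assumes f: "completely_multiplicative f" and sum: "(\<lambda>n. norm (f n)) summable_on UNIV"
  shows "infsum (\<lambda>n. of_int (moebius_mu n) * f n) UNIV * infsum f UNIV = 1"
proof -
  have "(\<lambda>y. (\<Prod>p | prime p \<and> p \<le> y. 1 - f p) * infsum f UNIV) \<longlonglongrightarrow> infsum (\<lambda>n. of_int (moebius_mu n) * f n) UNIV * infsum f UNIV"
    by (intro tendsto_mult_right euler_product_tendsto(2)[OF assms])
  then show ?thesis
    using euler_product_tendsto(1)[OF assms] LIMSEQ_unique by blast
qed

text \<open>The exponential bound replaces the exact inequality of the classical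
  \<open>3 + 4 cos \<theta> + cos 2\<theta> \<ge> 0\<close> argument, at the cost of a quadratic error.\<close>

lemma three_four_one_factor:
  fixes z :: complex and r :: real
  assumes "cmod z = 1" "0 \<le> r" "r \<le> 1"
  shows "(1 - r) ^ 3 * cmod (1 - of_real r * z) ^ 4 * cmod (1 - of_real r * z\<^sup>2) \<le> exp (4 * r\<^sup>2)"
proof -
  define c where "c = Re z"
  have z1: "(Re z)\<^sup>2 + (Im z)\<^sup>2 = 1"
    using assms by (metis cmod_power2 power_one)
  have e: "1 + x \<le> exp x" for x :: real by (rule exp_ge_add_one_self)
  have a1: "(1 - r)\<^sup>2 \<le> exp (- 2 * r + r\<^sup>2)"
    using e[of "- 2 * r + r\<^sup>2"] by (simp add: power2_eq_square algebra_simps)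
  have mod: "(cmod (1 - of_real r * u))\<^sup>2 = 1 - 2 * r * Re u + r\<^sup>2 * ((Re u)\<^sup>2 + (Im u)\<^sup>2)" for u
    unfolding cmod_power2 by (simp add: power2_eq_square algebra_simps)
  have a2: "(cmod (1 - of_real r * z))\<^sup>2 \<le> exp (- 2 * r * c + r\<^sup>2)"
    using e[of "- 2 * r * c + r\<^sup>2"] unfolding mod z1 c_def by (simp add: algebra_simps)
  have "cmod (z\<^sup>2) = 1" using assms by (simp add: norm_power)
  then have z2: "(Re (z\<^sup>2))\<^sup>2 + (Im (z\<^sup>2))\<^sup>2 = 1"
    by (metis cmod_power2 power_one)
  have "Re (z\<^sup>2) = (Re z)\<^sup>2 - (Im z)\<^sup>2" by (simp add: power2_eq_square)
  also have "\<dots> = 2 * c\<^sup>2 - 1" using z1 by (simp add: c_def)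
  finally have re2: "Re (z\<^sup>2) = 2 * c\<^sup>2 - 1" .
  have a3: "(cmod (1 - of_real r * z\<^sup>2))\<^sup>2 \<le> exp (- 2 * r * (2 * c\<^sup>2 - 1) + r\<^sup>2)"
  proof -
    have "(cmod (1 - of_real r * z\<^sup>2))\<^sup>2 = 1 - 2 * r * Re (z\<^sup>2) + r\<^sup>2 * 1" by (simp only: mod z2)
    also have "\<dots> = 1 + (- 2 * r * (2 * c\<^sup>2 - 1) + r\<^sup>2)" by (simp add: re2)
    also have "\<dots> \<le> exp (- 2 * r * (2 * c\<^sup>2 - 1) + r\<^sup>2)" by (rule e)
    finally show ?thesis .
  qed
  define x where "x = (1 - r) ^ 3 * cmod (1 - of_real r * z) ^ 4 * cmod (1 - of_real r * z\<^sup>2)"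
  have "x\<^sup>2 = ((1 - r)\<^sup>2) ^ 3 * ((cmod (1 - of_real r * z))\<^sup>2) ^ 4 * (cmod (1 - of_real r * z\<^sup>2))\<^sup>2"
    by (simp add: x_def power_mult_distrib power_mult[symmetric])
  also have "\<dots> \<le> exp (- 2 * r + r\<^sup>2) ^ 3 * exp (- 2 * r * c + r\<^sup>2) ^ 4 * exp (- 2 * r * (2 * c\<^sup>2 - 1) + r\<^sup>2)"
    by (intro mult_mono power_mono a1 a2 a3) auto
  \<comment> \<open>The linear terms -6 * r, -8 * r * c and -2 * r * (2 * c^2 - 1) combine to -4 * r
    * (1 + c)^2, the classical square; the quadratic errors add up to 3 + 4 + 1 = 8.\<close>
  also have "\<dots> = exp (8 * r\<^sup>2 - 4 * r * (1 + c)\<^sup>2)"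
    by (simp add: exp_of_nat_mult[symmetric] exp_add[symmetric] power2_eq_square algebra_simps)
  also have "\<dots> \<le> exp (8 * r\<^sup>2)" using assms by simp
  also have "\<dots> = (exp (4 * r\<^sup>2))\<^sup>2"
    by (simp add: exp_double[symmetric])
  finally have "x \<le> exp (4 * r\<^sup>2)"
    by (rule power2_le_imp_le) simp
  then show ?thesis by (simp add: x_def)
qed

text \<open>The bound does not degenerate near the line Re s = 1: the local errors exp (4 / p^2)
  multiply to at most \<open>exp 8\<close>, as the sum of 1 / p^2 is at most 2. Primes dividing the
  modulus fall under the first alternative for \<open>f2\<close> and \<open>f3\<close>.\<close>

lemma three_four_one:
  fixes f1 :: "nat \<Rightarrow> real" and f2 f3 :: "nat \<Rightarrow> complex"
  assumes f: "completely_multiplicative (\<lambda>n. of_real (f1 n))" "completely_multiplicative f2" "completely_multiplicative f3"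
    and sum: "(\<lambda>n. norm (complex_of_real (f1 n))) summable_on UNIV" "(\<lambda>n. norm (f2 n)) summable_on UNIV" "(\<lambda>n. norm (f3 n)) summable_on UNIV"
    and f1: "\<And>p. prime p \<Longrightarrow> 0 \<le> f1 p \<and> f1 p \<le> 1 / real p"
    and f23: "\<And>p. prime p \<Longrightarrow> (f2 p = 0 \<and> f3 p = 0) \<or> (\<exists>z. cmod z = 1 \<and> f2 p = of_real (f1 p) * z \<and> f3 p = of_real (f1 p) * z\<^sup>2)"
  shows "exp (- 8) \<le> cmod (infsum (\<lambda>n. of_real (f1 n)) UNIV) ^ 3 * cmod (infsum f2 UNIV) ^ 4 * cmod (infsum f3 UNIV)"
proof -
  let ?L1 = "infsum (\<lambda>n. complex_of_real (f1 n)) UNIV" and ?L2 = "infsum f2 UNIV" and ?L3 = "infsum f3 UNIV"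
  let ?P = "\<lambda>g y. (\<Prod>p | prime p \<and> p \<le> y. 1 - g p) :: complex"
  let ?c1 = "\<lambda>n. complex_of_real (f1 n)"
  have lim: "(\<lambda>y. cmod ((?P ?c1 y * ?L1) ^ 3 * (?P f2 y * ?L2) ^ 4 * (?P f3 y * ?L3))) \<longlonglongrightarrow> cmod (1 ^ 3 * 1 ^ 4 * 1)"
    by (intro tendsto_intros euler_product_tendsto(1) f sum)
  have "cmod ((?P ?c1 y * ?L1) ^ 3 * (?P f2 y * ?L2) ^ 4 * (?P f3 y * ?L3)) \<le> exp 8 * (cmod ?L1 ^ 3 * cmod ?L2 ^ 4 * cmod ?L3)" for y
  proof -
    have "cmod ((?P ?c1 y * ?L1) ^ 3 * (?P f2 y * ?L2) ^ 4 * (?P f3 y * ?L3)) =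
        cmod ((?P ?c1 y) ^ 3 * (?P f2 y) ^ 4 * ?P f3 y) * (cmod ?L1 ^ 3 * cmod ?L2 ^ 4 * cmod ?L3)"
      by (simp add: norm_mult norm_power power_mult_distrib)
    also have "cmod ((?P ?c1 y) ^ 3 * (?P f2 y) ^ 4 * ?P f3 y) =
        (\<Prod>p | prime p \<and> p \<le> y. cmod (1 - ?c1 p) ^ 3 * cmod (1 - f2 p) ^ 4 * cmod (1 - f3 p))"
      by (simp add: norm_mult norm_power prod.distrib prod_power_distrib[symmetric] prod_norm)
    also have "\<dots> \<le> (\<Prod>p | prime p \<and> p \<le> y. exp (4 * (1 / real p ^ 2)))"
    proof (intro prod_mono conjI)
      fix p assume "p \<in> {p. prime p \<and> p \<le> y}"
      then have p: "prime p" by simp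
      have r: "0 \<le> f1 p" "f1 p \<le> 1 / real p" using f1[OF p] by auto
      moreover have "1 / real p \<le> 1" using prime_ge_1_nat[OF p] by simp
      ultimately have r1: "f1 p \<le> 1" by linarith
      have "(f1 p)\<^sup>2 \<le> (1 / real p)\<^sup>2" using r by (intro power_mono) auto
      then have sq: "exp (4 * (f1 p)\<^sup>2) \<le> exp (4 * (1 / real p ^ 2))" by (simp add: power_divide)
      have c1: "cmod (1 - ?c1 p) = 1 - f1 p"
        using r1 by (metis abs_of_nonneg diff_ge_0_iff_ge norm_of_real of_real_1 of_real_diff)
      have "cmod (1 - ?c1 p) ^ 3 * cmod (1 - f2 p) ^ 4 * cmod (1 - f3 p) \<le> exp (4 * (f1 p)\<^sup>2)"
        using f23[OF p]
      proof (elim disjE exE conjE)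
        assume "f2 p = 0" "f3 p = 0"
        moreover have "(1 - f1 p) ^ 3 \<le> 1" using r r1 by (intro power_le_one) auto
        moreover have "1 \<le> exp (4 * (f1 p)\<^sup>2)" by simp
        ultimately show ?thesis unfolding c1 by (auto intro: order_trans)
      next
        fix z assume "cmod z = 1" "f2 p = of_real (f1 p) * z" "f3 p = of_real (f1 p) * z\<^sup>2"
        then show ?thesis unfolding c1 using three_four_one_factor[of z "f1 p"] r r1 by simp
      qed
      with sq show "cmod (1 - ?c1 p) ^ 3 * cmod (1 - f2 p) ^ 4 * cmod (1 - f3 p) \<le> exp (4 * (1 / real p ^ 2))"
        by linarith
    qed auto
    also have "\<dots> = exp (4 * (\<Sum>p | prime p \<and> p \<le> y. 1 / real p ^ 2))"
      by (simp only: exp_sum[symmetric] sum_distrib_left finite_Collect_conjI finite_Collect_le_nat disjI2)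
    also have "\<dots> \<le> exp 8"
      using sum_inverse_squares_le[of "{p. prime p \<and> p \<le> y}"] by simp
    finally show ?thesis by (simp add: mult_right_mono)
  qed
  then have "cmod (1 ^ 3 * 1 ^ 4 * 1) \<le> exp 8 * (cmod ?L1 ^ 3 * cmod ?L2 ^ 4 * cmod ?L3)"
    by (intro LIMSEQ_le_const2[OF lim]) auto
  then show ?thesis by (simp add: exp_minus field_simps)
qed

section \<open>Continuation of Dirichlet L-series\<close>

definition dirichlet_char :: "nat \<Rightarrow> (nat \<Rightarrow> complex) \<Rightarrow> bool" where
  "dirichlet_char M \<theta> \<longleftrightarrow> M > 0 \<and> \<theta> 1 = 1 \<and> (\<forall>m n. \<theta> (m * n) = \<theta> m * \<theta> n) \<and>
     (\<forall>n. \<theta> (n + M) = \<theta> n) \<and> (\<forall>n. \<not> coprime n M \<longrightarrow> \<theta> n = 0)"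

lemma dirichlet_charD:
  assumes "dirichlet_char M \<theta>"
  shows "M > 0" "\<theta> (Suc 0) = 1" "\<theta> (m * n) = \<theta> m * \<theta> n" "\<theta> (n + M) = \<theta> n" "\<not> coprime n M \<Longrightarrow> \<theta> n = 0"
  using assms by (auto simp: dirichlet_char_def)

lemma dirichlet_char_cong:
  assumes "dirichlet_char M \<theta>" "[m = n] (mod M)"
  shows "\<theta> m = \<theta> n"
  using periodic_mod[of \<theta> M m] periodic_mod[of \<theta> M n] dirichlet_charD(4)[OF assms(1)] assms(2)
  by (simp add: cong_def)

lemma dirichlet_char_power:
  assumes "dirichlet_char M \<theta>"
  shows "\<theta> (n ^ k) = \<theta> n ^ k"
  by (induction k) (simp_all add: dirichlet_charD[OF assms])

lemma cmod_dirichlet_char: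
  assumes \<theta>: "dirichlet_char M \<theta>" and "coprime n M"
  shows "cmod (\<theta> n) = 1"
proof -
  have "[n ^ totient M = 1] (mod M)"
    using assms(2) by (rule euler_theorem)
  then have "\<theta> n ^ totient M = 1"
    using dirichlet_char_cong[OF \<theta>] dirichlet_char_power[OF \<theta>] dirichlet_charD(2)[OF \<theta>] by (metis One_nat_def)
  then have "cmod (\<theta> n) ^ totient M = 1" by (metis norm_one norm_power)
  moreover have "totient M > 0" using dirichlet_charD(1)[OF \<theta>] by simp
  ultimately show ?thesis by (metis norm_ge_zero power_eq_1_iff abs_of_nonneg real_norm_def not_gr_zero)
qed

lemma cmod_dirichlet_char_le:
  assumes "dirichlet_char M \<theta>"
  shows "cmod (\<theta> n) \<le> 1"
  using cmod_dirichlet_char[OF assms, of n] dirichlet_charD(5)[OF assms, of n] by (cases "coprime n M") auto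

section \<open>Complex powers and termwise continuation\<close>

lemma norm_of_nat_powr: "cmod (of_nat n powr s) = real n powr Re s"
  by (subst norm_powr_real_powr) auto

lemma of_nat_mult_powr: "(of_nat (m * n) :: complex) powr s = of_nat m powr s * of_nat n powr s"
  by (simp add: powr_times_real)

lemma powr_neg_diff_le:
  fixes z s :: complex
  assumes n: "n \<ge> 1" and z: "z \<in> closed_segment (of_nat n) (of_nat (Suc n))" and s: "Re s > 0"
  shows "cmod (z powr (- s) - of_nat n powr (- s)) \<le> cmod s * real n powr (- Re s - 1)"
proof -
  define S where "S = closed_segment (complex_of_nat n) (of_nat (Suc n))"
  have S: "\<exists>x. y = of_real x \<and> real n \<le> x \<and> x \<le> real n + 1" if "y \<in> S" for y
  proof -
    have "S = closed_segment (complex_of_real (real n)) (of_real (real (Suc n)))" by (simp add: S_def)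
    then have "S = of_real ` closed_segment (real n) (real (Suc n))" by (simp only: closed_segment_of_real)
    then show ?thesis using that by (auto simp: closed_segment_eq_real_ivl)
  qed
  have "cmod (z powr (- s) - of_nat n powr (- s)) \<le> (cmod s * real n powr (- Re s - 1)) * cmod (z - of_nat n)"
  proof (rule field_differentiable_bound[where S = S and f' = "\<lambda>y. - s * y powr (- s - 1)"])
    fix y assume "y \<in> S"
    then obtain x where x: "y = of_real x" "real n \<le> x" using S by blast
    have "y \<notin> \<real>\<^sub>\<le>\<^sub>0" using x n by auto
    then show "((\<lambda>y. y powr (- s)) has_field_derivative - s * y powr (- s - 1)) (at y within S)"
      by (rule has_field_derivative_at_within[OF has_field_derivative_powr])
    have "cmod (y powr (- s - 1)) = x powr (- Re s - 1)"
      using x n by (subst norm_powr_real_powr) auto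
    also have "\<dots> \<le> real n powr (- Re s - 1)"
      using x n s by (intro powr_mono2') auto
    finally show "cmod (- s * y powr (- s - 1)) \<le> cmod s * real n powr (- Re s - 1)"
      by (simp add: norm_mult mult_left_mono)
  qed (use z in \<open>auto simp: S_def\<close>)
  also have "\<dots> \<le> (cmod s * real n powr (- Re s - 1)) * 1"
  proof (rule mult_left_mono)
    obtain x where x: "z = of_real x" "real n \<le> x" "x \<le> real n + 1" using S z S_def by blast
    have "cmod (z - of_nat n) = \<bar>x - real n\<bar>"
      unfolding x(1) by (metis norm_of_real of_real_diff of_real_of_nat_eq)
    then show "cmod (z - of_nat n) \<le> 1" using x by simp
  qed simp
  finally show ?thesis by simp
qed

text \<open>\<phi> subtracts from z^(1 - s) its tangent at n, so the derivative of \<phi> is a first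
  difference of z^(- s). The extra factor 1 / n so gained is what makes the continued series
  converge for Re s > 0.\<close>

lemma powr_second_diff_le:
  fixes s :: complex
  assumes n: "n \<ge> 1" and s: "Re s > 0"
  shows "cmod ((s - 1) * of_nat n powr (- s) - of_nat n powr (1 - s) + of_nat (Suc n) powr (1 - s))
    \<le> cmod (1 - s) * cmod s * real n powr (- Re s - 1)"
proof -
  define S where "S = closed_segment (complex_of_nat n) (of_nat (Suc n))"
  define \<phi> where "\<phi> = (\<lambda>z::complex. z powr (1 - s) - (1 - s) * of_nat n powr (- s) * z)"
  have "cmod (\<phi> (of_nat (Suc n)) - \<phi> (of_nat n)) \<le>
      (cmod (1 - s) * (cmod s * real n powr (- Re s - 1))) * cmod (complex_of_nat (Suc n) - of_nat n)"
  proof (rule field_differentiable_bound[where S = S and f' = "\<lambda>y. (1 - s) * (y powr (- s) - of_nat n powr (- s))"])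
    fix y assume y: "y \<in> S"
    have "S = closed_segment (complex_of_real (real n)) (of_real (real (Suc n)))" by (simp add: S_def)
    then have "S = of_real ` closed_segment (real n) (real (Suc n))" by (simp only: closed_segment_of_real)
    then obtain x where x: "y = of_real x" "real n \<le> x" using y by (auto simp: closed_segment_eq_real_ivl)
    have "y \<notin> \<real>\<^sub>\<le>\<^sub>0" using x n by auto
    then have d1: "((\<lambda>y. y powr (1 - s)) has_field_derivative (1 - s) * y powr (1 - s - 1)) (at y within S)"
      by (rule has_field_derivative_at_within[OF has_field_derivative_powr])
    have d2: "((\<lambda>z. (1 - s) * of_nat n powr (- s) * z) has_field_derivative (1 - s) * of_nat n powr (- s)) (at y within S)"
      by (auto intro!: derivative_eq_intros)
    show "(\<phi> has_field_derivative (1 - s) * (y powr (- s) - of_nat n powr (- s))) (at y within S)"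
      unfolding \<phi>_def using DERIV_diff[OF d1 d2] by (simp add: right_diff_distrib)
    show "cmod ((1 - s) * (y powr (- s) - of_nat n powr (- s))) \<le> cmod (1 - s) * (cmod s * real n powr (- Re s - 1))"
      unfolding norm_mult using y powr_neg_diff_le[OF n _ s] by (intro mult_left_mono) (auto simp: S_def)
  qed (auto simp: S_def)
  also have "cmod (complex_of_nat (Suc n) - of_nat n) = 1" by simp
  also have "\<phi> (of_nat (Suc n)) - \<phi> (of_nat n) = (s - 1) * of_nat n powr (- s) - of_nat n powr (1 - s) + of_nat (Suc n) powr (1 - s)"
    by (simp add: \<phi>_def algebra_simps)
  finally show ?thesis by (simp add: mult.assoc)
qed

text \<open>Serves both continuations below: on a disc of radius Re s / 2 the growth in s is bounded
  and the exponent stays below -1.\<close>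

lemma holomorphic_dirichlet_like_series:
  fixes F :: "nat \<Rightarrow> complex \<Rightarrow> complex"
  assumes hol: "\<And>k. F k holomorphic_on {s. Re s > 0}" and K: "K \<ge> 0"
    and bound: "\<And>k s. Re s > 0 \<Longrightarrow> cmod (F k s) \<le> K * (1 + cmod s)\<^sup>2 * real (Suc k) powr (- Re s - 1)"
  shows "(\<lambda>s. \<Sum>k. F k s) holomorphic_on {s. Re s > 0}" "\<And>s. Re s > 0 \<Longrightarrow> summable (\<lambda>k. F k s)"
proof -
  have op: "open {s. Re s > 0}" by (simp add: open_halfspace_Re_gt)
  obtain g where g: "\<forall>s\<in>{s. Re s > 0}. ((\<lambda>k. F k s) sums g s) \<and> g field_differentiable (at s)"
  proof (rule series_differentiable_comparison_complex[OF op, of F])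
    fix k s assume "s \<in> {s. Re s > 0}"
    then show "F k field_differentiable at s"
      using hol[of k] op holomorphic_on_imp_differentiable_at by blast
  next
    fix s assume s: "s \<in> {s. Re s > 0}"
    define d where "d = Re s / 2"
    define h where "h = (\<lambda>k. K * (1 + (cmod s + d))\<^sup>2 * real (Suc k) powr (- d - 1))"
    have d: "d > 0" using s by (simp add: d_def)
    have "summable (\<lambda>k. real (Suc k) powr (- d - 1))"
      using d by (subst summable_Suc_iff) (simp add: summable_real_powr_iff)
    then have "summable h" unfolding h_def by (rule summable_mult)
    then have "summable (\<lambda>k. complex_of_real (h k))" by (rule summable_of_real)
    moreover have h0: "h k \<ge> 0" for k using K by (simp add: h_def)
    then have "range (\<lambda>k. complex_of_real (h k)) \<subseteq> \<real>\<^sub>\<ge>\<^sub>0" by auto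
    moreover have "cmod (F k y) \<le> cmod (complex_of_real (h k))" if y: "y \<in> ball s d \<inter> {s. Re s > 0}" for k y
    proof -
      have dist: "cmod (s - y) < d" using y by (simp add: dist_norm)
      have "Re s - Re y \<le> cmod (s - y)" using complex_Re_le_cmod[of "s - y"] by simp
      then have re: "d \<le> Re y" using dist by (simp add: d_def)
      have "cmod y \<le> cmod s + cmod (s - y)"
        using norm_triangle_ineq4[of s "s - y"] by simp
      then have cy: "cmod y \<le> cmod s + d" using dist by linarith
      have "cmod (F k y) \<le> K * (1 + cmod y)\<^sup>2 * real (Suc k) powr (- Re y - 1)"
        using bound y by simp
      also have "\<dots> \<le> h k"
        unfolding h_def using K re cy by (intro mult_mono power_mono powr_mono) auto
      also have "\<dots> = cmod (complex_of_real (h k))" using h0 by simp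
      finally show ?thesis .
    qed
    ultimately show "\<exists>d h. 0 < d \<and> summable h \<and> range h \<subseteq> \<real>\<^sub>\<ge>\<^sub>0 \<and>
        (\<forall>\<^sub>F k in sequentially. \<forall>y\<in>ball s d \<inter> {s. Re s > 0}. cmod (F k y) \<le> cmod (h k))"
      using d by (intro exI[of _ d] exI[of _ "\<lambda>k. complex_of_real (h k)"]) (auto intro!: always_eventually)
  qed auto
  have eq: "(\<Sum>k. F k s) = g s" if "Re s > 0" for s
    using g that by (simp add: sums_iff)
  have "g holomorphic_on {s. Re s > 0}"
    using g by (auto simp: holomorphic_on_def intro: field_differentiable_at_within)
  then show "(\<lambda>s. \<Sum>k. F k s) holomorphic_on {s. Re s > 0}"
    by (rule holomorphic_transform) (simp add: eq)
  show "summable (\<lambda>k. F k s)" if "Re s > 0" for s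
    using g that by (auto simp: sums_iff)
qed

text \<open>The term n = 0 vanishes because \<open>0 powr x = 0\<close>.\<close>

definition dirichlet_series :: "(nat \<Rightarrow> complex) \<Rightarrow> complex \<Rightarrow> complex" where
  "dirichlet_series \<theta> s = infsum (\<lambda>n. \<theta> n * of_nat n powr (- s)) UNIV"

lemma norm_dirichlet_summable:
  assumes "\<And>n. cmod (\<theta> n) \<le> A" "Re s > 1"
  shows "(\<lambda>n. norm (\<theta> n * of_nat n powr (- s))) summable_on UNIV"
proof -
  have "summable (\<lambda>n. real n powr (- Re s))"
    using assms(2) by (simp add: summable_real_powr_iff)
  then have "summable (\<lambda>n. A * real n powr (- Re s))" by (rule summable_mult)
  then have "(\<lambda>n. A * real n powr (- Re s)) summable_on UNIV"
    using order_trans[OF norm_ge_zero assms(1)[of 0]] by (subst summable_on_UNIV_nonneg_real_iff) auto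
  then show ?thesis
    by (rule summable_on_comparison_test) (auto simp: norm_mult norm_of_nat_powr intro!: mult_right_mono assms(1))
qed

lemma dirichlet_series_sums:
  assumes "\<And>n. cmod (\<theta> n) \<le> A" "Re s > 1"
  shows "(\<lambda>k. \<theta> (Suc k) * of_nat (Suc k) powr (- s)) sums dirichlet_series \<theta> s"
proof -
  have "(\<lambda>n. \<theta> n * of_nat n powr (- s)) summable_on UNIV"
    using norm_dirichlet_summable[OF assms] by (rule abs_summable_summable)
  then have "(\<lambda>n. \<theta> n * of_nat n powr (- s)) sums dirichlet_series \<theta> s"
    unfolding dirichlet_series_def by (intro has_sum_imp_sums has_sum_infsum)
  then show ?thesis
    by (subst sums_Suc_iff) simp
qed

text \<open>This is \<open>(s - 1) \<zeta>(s)\<close>, continued to the right half-plane by subtracting \<open>x\<^bsup>-s\<^esup>\<close> integrated over \<open>[k, k + 1]\<close>.\<close>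

definition zeta_numerator :: "complex \<Rightarrow> complex" where
  "zeta_numerator s = 1 + (\<Sum>k. (s - 1) * of_nat (Suc k) powr (- s) - of_nat (Suc k) powr (1 - s) + of_nat (Suc (Suc k)) powr (1 - s))"

lemma zeta_numerator_holomorphic: "zeta_numerator holomorphic_on {s. Re s > 0}"
  and zeta_numerator_summable: "Re s > 0 \<Longrightarrow> summable (\<lambda>k. (s - 1) * of_nat (Suc k) powr (- s) - of_nat (Suc k) powr (1 - s) + of_nat (Suc (Suc k)) powr (1 - s))"
proof -
  let ?F = "\<lambda>k s. (s - 1) * of_nat (Suc k) powr (- s) - of_nat (Suc k) powr (1 - s) + of_nat (Suc (Suc k)) powr (1 - s) :: complex"
  have bound: "cmod (?F k s) \<le> 1 * (1 + cmod s)\<^sup>2 * real (Suc k) powr (- Re s - 1)" if "Re s > 0" for k s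
  proof -
    have "cmod (?F k s) \<le> cmod (1 - s) * cmod s * real (Suc k) powr (- Re s - 1)"
      using powr_second_diff_le[of "Suc k" s] that by simp
    also have "cmod (1 - s) \<le> 1 + cmod s" using norm_triangle_ineq4[of 1 s] by simp
    then have "cmod (1 - s) * cmod s * real (Suc k) powr (- Re s - 1) \<le> (1 + cmod s) * (1 + cmod s) * real (Suc k) powr (- Re s - 1)"
      by (intro mult_mono) auto
    finally show ?thesis by (simp add: power2_eq_square)
  qed
  have hol: "?F k holomorphic_on {s. Re s > 0}" for k
    by (intro holomorphic_intros)
  show "zeta_numerator holomorphic_on {s. Re s > 0}"
    unfolding zeta_numerator_def[abs_def]
    by (intro holomorphic_on_add holomorphic_on_const holomorphic_dirichlet_like_series(1)[OF hol _ bound]) auto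
  show "summable (\<lambda>k. ?F k s)" if "Re s > 0"
    by (rule holomorphic_dirichlet_like_series(2)[OF hol _ bound that]) auto
qed

lemma powr_tendsto_0:
  assumes "Re s > 0"
  shows "(\<lambda>N. of_nat (Suc N) powr (- s) :: complex) \<longlonglongrightarrow> 0"
proof (rule tendsto_norm_zero_cancel)
  have "(\<lambda>N. real (Suc N) powr (- Re s)) \<longlonglongrightarrow> 0"
    using assms by real_asymp
  then show "(\<lambda>N. norm (of_nat (Suc N) powr (- s) :: complex)) \<longlonglongrightarrow> 0"
    by (simp only: norm_of_nat_powr uminus_complex.sel)
qed

lemma zeta_numerator_eq:
  assumes s: "Re s > 1"
  shows "zeta_numerator s = (s - 1) * dirichlet_series (\<lambda>_. 1) s"
proof -
  let ?F = "\<lambda>k. (s - 1) * of_nat (Suc k) powr (- s) - of_nat (Suc k) powr (1 - s) + of_nat (Suc (Suc k)) powr (1 - s) :: complex"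
  have part: "1 + (\<Sum>k<N. ?F k) = (s - 1) * (\<Sum>k<N. of_nat (Suc k) powr (- s)) + of_nat (Suc N) powr (1 - s)" for N
    by (induction N) (simp_all add: algebra_simps)
  have "(\<lambda>N. 1 + (\<Sum>k<N. ?F k)) \<longlonglongrightarrow> 1 + (\<Sum>k. ?F k)"
    using zeta_numerator_summable[of s] s by (intro tendsto_intros summable_LIMSEQ) auto
  then have "(\<lambda>N. 1 + (\<Sum>k<N. ?F k)) \<longlonglongrightarrow> zeta_numerator s"
    by (simp only: zeta_numerator_def)
  moreover have "(\<lambda>N. (s - 1) * (\<Sum>k<N. of_nat (Suc k) powr (- s)) + of_nat (Suc N) powr (1 - s)) \<longlonglongrightarrow>
      (s - 1) * dirichlet_series (\<lambda>_. 1) s + 0"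
  proof (intro tendsto_intros)
    show "(\<lambda>N. \<Sum>k<N. of_nat (Suc k) powr (- s)) \<longlonglongrightarrow> dirichlet_series (\<lambda>_. 1) s"
      using dirichlet_series_sums[of "\<lambda>_. 1" 1 s] s by (simp add: sums_def)
    show "(\<lambda>N. of_nat (Suc N) powr (1 - s) :: complex) \<longlonglongrightarrow> 0"
      using powr_tendsto_0[of "s - 1"] s by simp
  qed
  ultimately show ?thesis
    unfolding part using LIMSEQ_unique by fastforce
qed

text \<open>Every summand vanishes at s = 1; the value is the residue of zeta there.\<close>

lemma zeta_numerator_1: "zeta_numerator 1 = 1"
  by (simp add: zeta_numerator_def del: of_nat_Suc)

text \<open>For a character, the residue of its L-function at 1; nonzero exactly for the principal
  one.\<close>

definition char_mean :: "nat \<Rightarrow> (nat \<Rightarrow> complex) \<Rightarrow> complex" where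
  "char_mean M \<theta> = (\<Sum>a<M. \<theta> a) / of_nat M"

text \<open>Subtracting the mean makes the partial sums periodic, hence bounded, for principal and
  other characters alike.\<close>

definition char_discrepancy :: "nat \<Rightarrow> (nat \<Rightarrow> complex) \<Rightarrow> nat \<Rightarrow> complex" where
  "char_discrepancy M \<theta> n = (\<Sum>k<n. \<theta> (Suc k) - char_mean M \<theta>)"

lemma cmod_char_mean_le:
  assumes "dirichlet_char M \<theta>"
  shows "cmod (char_mean M \<theta>) \<le> 1"
proof -
  have "cmod (\<Sum>a<M. \<theta> a) \<le> (\<Sum>a<M. 1)"
    by (intro sum_norm_le cmod_dirichlet_char_le[OF assms])
  then show ?thesis
    using dirichlet_charD(1)[OF assms] by (simp add: char_mean_def norm_divide divide_le_eq_1)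
qed

lemma cmod_char_discrepancy_le:
  assumes \<theta>: "dirichlet_char M \<theta>"
  shows "cmod (char_discrepancy M \<theta> n) \<le> 2 * real M"
proof -
  let ?e = "\<lambda>k. \<theta> (Suc k) - char_mean M \<theta>"
  have M: "M > 0" using dirichlet_charD(1)[OF \<theta>] .
  have e: "cmod (?e k) \<le> 2" for k
    using norm_triangle_ineq4[of "\<theta> (Suc k)" "char_mean M \<theta>"] cmod_dirichlet_char_le[OF \<theta>, of "Suc k"] cmod_char_mean_le[OF \<theta>]
    by linarith
  have shift: "(\<Sum>k<M. \<theta> (k + c)) = (\<Sum>k<M. \<theta> k)" for c
    by (rule sum_periodic_shift) (rule dirichlet_charD(4)[OF \<theta>])
  have "char_discrepancy M \<theta> (n + M) = char_discrepancy M \<theta> n" for n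
  proof -
    have "char_discrepancy M \<theta> (n + M) = char_discrepancy M \<theta> n + (\<Sum>k<M. ?e (n + k))"
    proof -
      have "(\<Sum>k<n + m. ?e k) = (\<Sum>k<n. ?e k) + (\<Sum>k<m. ?e (n + k))" for m
        by (induction m) (simp_all add: add.assoc)
      then show ?thesis unfolding char_discrepancy_def by blast
    qed
    also have "(\<Sum>k<M. ?e (n + k)) = (\<Sum>k<M. \<theta> (k + Suc n)) - of_nat M * char_mean M \<theta>"
      by (simp add: sum_subtractf add.commute)
    also have "\<dots> = 0" using shift[of "Suc n"] M by (simp add: char_mean_def)
    finally show ?thesis by simp
  qed
  then have "char_discrepancy M \<theta> n = char_discrepancy M \<theta> (n mod M)"
    using periodic_mod[of "char_discrepancy M \<theta>" M n] by simp
  also have "cmod \<dots> \<le> (\<Sum>k<n mod M. 2)"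
    unfolding char_discrepancy_def by (intro sum_norm_le e)
  also have "\<dots> \<le> 2 * real M" using M by simp
  finally show ?thesis .
qed

text \<open>Partial summation of the Dirichlet series with coefficients \<theta> n minus the mean,
  in a form that converges absolutely for Re s > 0.\<close>

definition L_regular :: "nat \<Rightarrow> (nat \<Rightarrow> complex) \<Rightarrow> complex \<Rightarrow> complex" where
  "L_regular M \<theta> s = (\<Sum>k. char_discrepancy M \<theta> (Suc k) * (of_nat (Suc k) powr (- s) - of_nat (Suc (Suc k)) powr (- s)))"

lemma L_regular_holomorphic:
  assumes \<theta>: "dirichlet_char M \<theta>"
  shows "L_regular M \<theta> holomorphic_on {s. Re s > 0}"
    and "Re s > 0 \<Longrightarrow> summable (\<lambda>k. char_discrepancy M \<theta> (Suc k) * (of_nat (Suc k) powr (- s) - of_nat (Suc (Suc k)) powr (- s)))"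
proof -
  let ?F = "\<lambda>k s. char_discrepancy M \<theta> (Suc k) * (of_nat (Suc k) powr (- s) - of_nat (Suc (Suc k)) powr (- s))"
  have bound: "cmod (?F k s) \<le> (2 * real M) * (1 + cmod s)\<^sup>2 * real (Suc k) powr (- Re s - 1)" if "Re s > 0" for k s
  proof -
    have "cmod (of_nat (Suc (Suc k)) powr (- s) - of_nat (Suc k) powr (- s)) \<le> cmod s * real (Suc k) powr (- Re s - 1)"
      using that by (intro powr_neg_diff_le) auto
    then have "cmod (?F k s) \<le> (2 * real M) * (cmod s * real (Suc k) powr (- Re s - 1))"
      unfolding norm_mult by (intro mult_mono cmod_char_discrepancy_le[OF \<theta>]) (auto simp: norm_minus_commute)
    also have "\<dots> \<le> (2 * real M) * ((1 + cmod s)\<^sup>2 * real (Suc k) powr (- Re s - 1))"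
    proof (intro mult_left_mono mult_right_mono)
      show "cmod s \<le> (1 + cmod s)\<^sup>2" by (simp add: power2_eq_square algebra_simps add_increasing)
    qed auto
    finally show ?thesis by (simp add: mult.assoc)
  qed
  have hol: "?F k holomorphic_on {s. Re s > 0}" for k
    by (intro holomorphic_intros)
  show "L_regular M \<theta> holomorphic_on {s. Re s > 0}"
    unfolding L_regular_def[abs_def]
    by (intro holomorphic_dirichlet_like_series(1)[OF hol _ bound]) auto
  show "summable (\<lambda>k. ?F k s)" if "Re s > 0"
    by (rule holomorphic_dirichlet_like_series(2)[OF hol _ bound that]) auto
qed

lemma L_regular_sums:
  assumes \<theta>: "dirichlet_char M \<theta>" and s: "Re s > 0"
  shows "(\<lambda>k. (\<theta> (Suc k) - char_mean M \<theta>) * of_nat (Suc k) powr (- s)) sums L_regular M \<theta> s"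
proof -
  let ?E = "char_discrepancy M \<theta>"
  define v where "v = (\<lambda>k. of_nat (Suc k) powr (- s) :: complex)"
  have abel: "(\<Sum>k<N. (\<theta> (Suc k) - char_mean M \<theta>) * v k) = (\<Sum>k<N. ?E (Suc k) * (v k - v (Suc k))) + ?E N * v N" for N
  proof (induction N)
    case 0
    show ?case by (simp add: char_discrepancy_def)
  next
    case (Suc N)
    have "?E (Suc N) = ?E N + (\<theta> (Suc N) - char_mean M \<theta>)" by (simp add: char_discrepancy_def)
    then show ?case using Suc by (simp add: ring_distribs)
  qed
  have "(\<lambda>N. \<Sum>k<N. ?E (Suc k) * (v k - v (Suc k))) \<longlonglongrightarrow> L_regular M \<theta> s"
    using L_regular_holomorphic(2)[OF \<theta> s] summable_LIMSEQ unfolding L_regular_def v_def by blast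
  moreover have "(\<lambda>N. ?E N * v N) \<longlonglongrightarrow> 0"
  proof (rule Lim_null_comparison)
    show "\<forall>\<^sub>F N in sequentially. norm (?E N * v N) \<le> 2 * real M * norm (v N)"
      unfolding norm_mult by (intro always_eventually allI mult_right_mono cmod_char_discrepancy_le[OF \<theta>]) auto
    show "(\<lambda>N. 2 * real M * norm (v N)) \<longlonglongrightarrow> 0"
      unfolding v_def using powr_tendsto_0[OF s] by (intro tendsto_mult_right_zero tendsto_norm_zero)
  qed
  ultimately have "(\<lambda>N. (\<Sum>k<N. ?E (Suc k) * (v k - v (Suc k))) + ?E N * v N) \<longlonglongrightarrow> L_regular M \<theta> s + 0"
    by (rule tendsto_add)
  then have "(\<lambda>k. (\<theta> (Suc k) - char_mean M \<theta>) * v k) sums L_regular M \<theta> s"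
    unfolding sums_def abel by simp
  then show ?thesis by (simp only: v_def)
qed

text \<open>One formula for all characters. At s = 1 division by zero makes the first summand 0,
  which is the correct value when the mean is 0 and a mere convention otherwise.\<close>

definition L_function :: "nat \<Rightarrow> (nat \<Rightarrow> complex) \<Rightarrow> complex \<Rightarrow> complex" where
  "L_function M \<theta> s = char_mean M \<theta> * (zeta_numerator s / (s - 1)) + L_regular M \<theta> s"

lemma dirichlet_series_eq_L_function:
  assumes \<theta>: "dirichlet_char M \<theta>" and s: "Re s > 1"
  shows "dirichlet_series \<theta> s = L_function M \<theta> s"
proof -
  have "s \<noteq> 1" using s by auto
  have "(\<lambda>k. \<theta> (Suc k) * of_nat (Suc k) powr (- s) - char_mean M \<theta> * (1 * of_nat (Suc k) powr (- s))) sums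
      (dirichlet_series \<theta> s - char_mean M \<theta> * dirichlet_series (\<lambda>_. 1) s)"
    by (intro sums_diff sums_mult dirichlet_series_sums[OF _ s]) (auto intro: cmod_dirichlet_char_le[OF \<theta>])
  then have "(\<lambda>k. (\<theta> (Suc k) - char_mean M \<theta>) * of_nat (Suc k) powr (- s)) sums
      (dirichlet_series \<theta> s - char_mean M \<theta> * dirichlet_series (\<lambda>_. 1) s)"
    by (simp add: algebra_simps)
  then have "dirichlet_series \<theta> s - char_mean M \<theta> * dirichlet_series (\<lambda>_. 1) s = L_regular M \<theta> s"
    using L_regular_sums[OF \<theta>, of s] s sums_unique2 by fastforce
  moreover have "zeta_numerator s / (s - 1) = dirichlet_series (\<lambda>_. 1) s"
    using zeta_numerator_eq[OF s] \<open>s \<noteq> 1\<close> by simp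
  ultimately show ?thesis by (simp add: L_function_def algebra_simps)
qed

lemma L_function_holomorphic:
  assumes \<theta>: "dirichlet_char M \<theta>"
  shows "L_function M \<theta> holomorphic_on ({s. Re s > 0} - {1})"
    and "char_mean M \<theta> = 0 \<Longrightarrow> L_function M \<theta> holomorphic_on {s. Re s > 0}"
proof -
  show "L_function M \<theta> holomorphic_on ({s. Re s > 0} - {1})"
    unfolding L_function_def[abs_def]
    by (intro holomorphic_intros holomorphic_on_subset[OF zeta_numerator_holomorphic]
        holomorphic_on_subset[OF L_regular_holomorphic(1)[OF \<theta>]]) auto
  show "L_function M \<theta> holomorphic_on {s. Re s > 0}" if "char_mean M \<theta> = 0"
    using L_regular_holomorphic(1)[OF \<theta>] by (rule holomorphic_transform) (simp add: L_function_def that)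
qed

section \<open>Nonvanishing on the line Re s = 1\<close>

text \<open>The value 0 at n = 0 comes from \<open>0 powr s = 0\<close>; \<theta> itself is 1 at 0
  when M = 1.\<close>

lemma completely_multiplicative_dirichlet:
  assumes \<theta>: "dirichlet_char M \<theta>"
  shows "completely_multiplicative (\<lambda>n. \<theta> n * of_nat n powr s)"
  unfolding completely_multiplicative_def
proof (intro conjI allI)
  fix m n
  show "\<theta> (m * n) * of_nat (m * n) powr s = \<theta> m * of_nat m powr s * (\<theta> n * of_nat n powr s)"
    unfolding of_nat_mult_powr dirichlet_charD(3)[OF \<theta>] by simp
qed (use dirichlet_charD(2)[OF \<theta>] in auto)

lemma dirichlet_char_power2:
  assumes "dirichlet_char M \<theta>"
  shows "dirichlet_char M (\<lambda>n. (\<theta> n)\<^sup>2)"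
  using assms by (auto simp: dirichlet_char_def power_mult_distrib)

lemma dirichlet_char_trivial: "dirichlet_char 1 (\<lambda>_. 1)"
  by (simp add: dirichlet_char_def)

lemma dirichlet_three_four_one:
  assumes \<theta>: "dirichlet_char M \<theta>" and \<sigma>: "\<sigma> > 1"
  shows "exp (- 8) \<le> cmod (dirichlet_series (\<lambda>_. 1) (of_real \<sigma>)) ^ 3 * cmod (dirichlet_series \<theta> (Complex \<sigma> t)) ^ 4 *
    cmod (dirichlet_series (\<lambda>n. (\<theta> n)\<^sup>2) (Complex \<sigma> (2 * t)))"
proof -
  note \<theta>2 = dirichlet_char_power2[OF \<theta>]
  define f1 where "f1 = (\<lambda>n. real n powr (- \<sigma>))"
  have f1: "complex_of_real (f1 n) = 1 * of_nat n powr (- of_real \<sigma>)" for n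
    unfolding f1_def by (metis mult_1 of_nat_0_le_iff of_real_minus of_real_of_nat_eq powr_of_real)
  have eq: "Complex \<sigma> u = of_real \<sigma> + \<i> * of_real u" for u
    by (simp add: complex_eq_iff)
  define P where "P = (\<lambda>p u. (of_nat p :: complex) powr (- (\<i> * of_real u)))"
  have split: "of_nat p powr (- Complex \<sigma> u) = of_real (f1 p) * P p u" for p u
    unfolding f1 P_def eq by (simp add: powr_add[symmetric] algebra_simps)
  have "exp (- 8) \<le> cmod (infsum (\<lambda>n. complex_of_real (f1 n)) UNIV) ^ 3 *
      cmod (infsum (\<lambda>n. \<theta> n * of_nat n powr (- Complex \<sigma> t)) UNIV) ^ 4 *
      cmod (infsum (\<lambda>n. (\<theta> n)\<^sup>2 * of_nat n powr (- Complex \<sigma> (2 * t))) UNIV)"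
  proof (rule three_four_one)
    show "completely_multiplicative (\<lambda>n. complex_of_real (f1 n))"
      unfolding f1 by (rule completely_multiplicative_dirichlet[OF dirichlet_char_trivial])
    show "completely_multiplicative (\<lambda>n. \<theta> n * of_nat n powr (- Complex \<sigma> t))"
      by (rule completely_multiplicative_dirichlet[OF \<theta>])
    show "completely_multiplicative (\<lambda>n. (\<theta> n)\<^sup>2 * of_nat n powr (- Complex \<sigma> (2 * t)))"
      by (rule completely_multiplicative_dirichlet[OF \<theta>2])
    show "(\<lambda>n. norm (complex_of_real (f1 n))) summable_on UNIV"
      unfolding f1 using \<sigma> by (intro norm_dirichlet_summable[of _ 1]) auto
    show "(\<lambda>n. norm (\<theta> n * of_nat n powr (- Complex \<sigma> t))) summable_on UNIV"
      using \<sigma> by (intro norm_dirichlet_summable[of _ 1]) (auto intro: cmod_dirichlet_char_le[OF \<theta>])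
    show "(\<lambda>n. norm ((\<theta> n)\<^sup>2 * of_nat n powr (- Complex \<sigma> (2 * t)))) summable_on UNIV"
      using \<sigma> by (intro norm_dirichlet_summable[of _ 1]) (auto intro: cmod_dirichlet_char_le[OF \<theta>2])
  next
    fix p :: nat assume p: "prime p"
    have p1: "real p \<ge> 1" using prime_ge_1_nat[OF p] by simp
    then have "real p powr (- \<sigma>) \<le> real p powr (- 1)"
      using \<sigma> by (intro powr_mono) auto
    then show "0 \<le> f1 p \<and> f1 p \<le> 1 / real p"
      using p1 by (simp add: f1_def powr_minus_divide)
    show "(\<theta> p * of_nat p powr (- Complex \<sigma> t) = 0 \<and> (\<theta> p)\<^sup>2 * of_nat p powr (- Complex \<sigma> (2 * t)) = 0) \<or>
      (\<exists>z. cmod z = 1 \<and> \<theta> p * of_nat p powr (- Complex \<sigma> t) = of_real (f1 p) * z \<and>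
        (\<theta> p)\<^sup>2 * of_nat p powr (- Complex \<sigma> (2 * t)) = of_real (f1 p) * z\<^sup>2)"
    proof (cases "coprime p M")
      case False
      then show ?thesis using dirichlet_charD(5)[OF \<theta>] by simp
    next
      case True
      have "P p (2 * t) = (P p t)\<^sup>2"
        unfolding P_def power2_eq_square powr_add[symmetric] by (simp add: algebra_simps)
      moreover have "cmod (P p t) = 1"
        using p1 by (simp add: P_def norm_of_nat_powr)
      ultimately show ?thesis
        using cmod_dirichlet_char[OF \<theta> True]
        by (intro disjI2 exI[of _ "\<theta> p * P p t"]) (simp add: split norm_mult power_mult_distrib)
    qed
  qed
  then show ?thesis
    unfolding dirichlet_series_def f1 .
qed

text \<open>A zero at 1 + i t makes L(\<sigma> + i t) of order \<sigma> - 1. Its fourth power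
  against the triple pole of zeta^3 leaves one factor \<sigma> - 1, and the L-function of \<theta>^2
  stays bounded near 1 + 2 i t, by either alternative of the hypothesis. The product would tend to
  0, against the lower bound exp (- 8).\<close>

lemma L_function_nonzero_complex:
  assumes \<theta>: "dirichlet_char M \<theta>"
    and t: "t \<noteq> 0 \<or> (char_mean M \<theta> = 0 \<and> char_mean M (\<lambda>n. (\<theta> n)\<^sup>2) = 0)"
  shows "L_function M \<theta> (Complex 1 t) \<noteq> 0"
proof
  assume zero: "L_function M \<theta> (Complex 1 t) = 0"
  note \<theta>2 = dirichlet_char_power2[OF \<theta>]
  let ?L = "L_function M \<theta>" and ?L2 = "L_function M (\<lambda>n. (\<theta> n)\<^sup>2)"
  have op: "open {s::complex. Re s > 0}" by (simp add: open_halfspace_Re_gt)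
  then have op1: "open ({s::complex. Re s > 0} - {1})" by (intro open_delete)
  have diff: "L_function M \<psi> field_differentiable at (Complex 1 u)"
    if "dirichlet_char M \<psi>" "u \<noteq> 0 \<or> char_mean M \<psi> = 0" for \<psi> u
  proof (cases "u = 0")
    case True
    then show ?thesis
      using L_function_holomorphic(2)[OF that(1)] that(2) holomorphic_on_imp_differentiable_at[OF _ op] by simp
  next
    case False
    then have "Complex 1 u \<noteq> 1" by (simp add: complex_eq_iff)
    then show ?thesis
      using L_function_holomorphic(1)[OF that(1)] holomorphic_on_imp_differentiable_at[OF _ op1] by simp
  qed
  obtain D where D: "(?L has_field_derivative D) (at (Complex 1 t))"
    using diff[OF \<theta>] t by (auto simp: field_differentiable_def)
  have cont2: "isCont ?L2 (Complex 1 (2 * t))"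
    using diff[OF \<theta>2, of "2 * t"] t by (auto intro!: field_differentiable_imp_continuous_at)
  have contZ: "isCont zeta_numerator 1"
    using holomorphic_on_imp_differentiable_at[OF zeta_numerator_holomorphic op] by (intro field_differentiable_imp_continuous_at) auto
  have at: "filterlim (\<lambda>\<sigma>. Complex \<sigma> u) (at (Complex 1 u)) (at_right 1)" for u
  proof -
    have "((\<lambda>\<sigma>. Complex \<sigma> u) \<longlongrightarrow> Complex 1 u) (at_right 1)"
      by (intro tendsto_Complex tendsto_const tendsto_ident_at)
    moreover have "eventually (\<lambda>\<sigma>. Complex \<sigma> u \<noteq> Complex 1 u) (at_right 1)"
      by (auto simp: eventually_at_filter)
    ultimately show ?thesis by (simp add: filterlim_at)
  qed
  have lim_zeta: "((\<lambda>\<sigma>. zeta_numerator (of_real \<sigma>)) \<longlongrightarrow> zeta_numerator 1) (at_right 1)"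
    by (rule isCont_tendsto_compose[OF contZ]) (auto intro!: tendsto_eq_intros)
  have lim_L: "((\<lambda>\<sigma>. ?L (Complex \<sigma> t) / of_real (\<sigma> - 1)) \<longlongrightarrow> D) (at_right 1)"
  proof -
    have "((\<lambda>s. (?L s - ?L (Complex 1 t)) / (s - Complex 1 t)) \<longlongrightarrow> D) (at (Complex 1 t))"
      using D by (simp add: has_field_derivative_iff)
    then have "((\<lambda>\<sigma>. (?L (Complex \<sigma> t) - ?L (Complex 1 t)) / (Complex \<sigma> t - Complex 1 t)) \<longlongrightarrow> D) (at_right 1)"
      by (rule filterlim_compose[OF _ at])
    moreover have "Complex \<sigma> t - Complex 1 t = of_real (\<sigma> - 1)" for \<sigma> by (simp add: complex_eq_iff)
    ultimately show ?thesis by (simp add: zero)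
  qed
  have lim_L2: "((\<lambda>\<sigma>. ?L2 (Complex \<sigma> (2 * t))) \<longlongrightarrow> ?L2 (Complex 1 (2 * t))) (at_right 1)"
    by (rule isCont_tendsto_compose[OF cont2]) (intro tendsto_Complex tendsto_const tendsto_ident_at)
  have lim: "((\<lambda>\<sigma>. cmod (zeta_numerator (of_real \<sigma>)) ^ 3 * cmod (?L (Complex \<sigma> t) / of_real (\<sigma> - 1)) ^ 4 *
      (\<sigma> - 1) * cmod (?L2 (Complex \<sigma> (2 * t)))) \<longlongrightarrow>
      cmod (zeta_numerator 1) ^ 3 * cmod D ^ 4 * (1 - 1) * cmod (?L2 (Complex 1 (2 * t)))) (at_right 1)"
    by (intro tendsto_intros lim_zeta lim_L lim_L2)
  have "eventually (\<lambda>\<sigma>. exp (- 8) \<le> cmod (zeta_numerator (of_real \<sigma>)) ^ 3 * cmod (?L (Complex \<sigma> t) / of_real (\<sigma> - 1)) ^ 4 *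
      (\<sigma> - 1) * cmod (?L2 (Complex \<sigma> (2 * t)))) (at_right 1)"
    unfolding eventually_at_filter
  proof (intro always_eventually allI impI)
    fix \<sigma> :: real assume "\<sigma> \<in> {1<..}"
    then have \<sigma>: "\<sigma> > 1" by simp
    define d where "d = \<sigma> - 1"
    have d: "d > 0" using \<sigma> by (simp add: d_def)
    have z: "cmod (zeta_numerator (of_real \<sigma>)) = d * cmod (dirichlet_series (\<lambda>_. 1) (of_real \<sigma>))"
    proof -
      have "cmod (of_real \<sigma> - 1) = d"
        using d by (metis abs_of_pos d_def norm_of_real of_real_1 of_real_diff)
      then show ?thesis using zeta_numerator_eq[of "of_real \<sigma>"] \<sigma> by (simp add: norm_mult)
    qed
    have l: "cmod (?L (Complex \<sigma> t) / of_real d) = cmod (dirichlet_series \<theta> (Complex \<sigma> t)) / d"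
      using dirichlet_series_eq_L_function[OF \<theta>, of "Complex \<sigma> t"] \<sigma> d by (simp add: norm_divide)
    have l2: "?L2 (Complex \<sigma> (2 * t)) = dirichlet_series (\<lambda>n. (\<theta> n)\<^sup>2) (Complex \<sigma> (2 * t))"
      using dirichlet_series_eq_L_function[OF \<theta>2, of "Complex \<sigma> (2 * t)"] \<sigma> by simp
    have "exp (- 8) \<le> cmod (dirichlet_series (\<lambda>_. 1) (of_real \<sigma>)) ^ 3 * cmod (dirichlet_series \<theta> (Complex \<sigma> t)) ^ 4 *
        cmod (dirichlet_series (\<lambda>n. (\<theta> n)\<^sup>2) (Complex \<sigma> (2 * t)))"
      by (rule dirichlet_three_four_one[OF \<theta> \<sigma>])
    also have "\<dots> = (d * cmod (dirichlet_series (\<lambda>_. 1) (of_real \<sigma>))) ^ 3 * (cmod (dirichlet_series \<theta> (Complex \<sigma> t)) / d) ^ 4 *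
        d * cmod (dirichlet_series (\<lambda>n. (\<theta> n)\<^sup>2) (Complex \<sigma> (2 * t)))"
      using d by (simp add: power_mult_distrib power_divide field_simps power_numeral_reduce)
    finally show "exp (- 8) \<le> cmod (zeta_numerator (of_real \<sigma>)) ^ 3 * cmod (?L (Complex \<sigma> t) / of_real (\<sigma> - 1)) ^ 4 *
      (\<sigma> - 1) * cmod (?L2 (Complex \<sigma> (2 * t)))"
      unfolding d_def[symmetric] z l l2 .
  qed
  from tendsto_lowerbound[OF lim this] show False by simp
qed

text \<open>Multiplication by a unit u permutes the residues, so multiplication by \<theta> u fixes
  the sum of \<theta>.\<close>

lemma char_mean_nonzero_imp:
  assumes \<theta>: "dirichlet_char M \<theta>" and "char_mean M \<theta> \<noteq> 0" and u: "coprime u M"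
  shows "\<theta> u = 1"
proof -
  have M: "M > 0" using dirichlet_charD(1)[OF \<theta>] .
  have inj: "inj_on (\<lambda>a. (u * a) mod M) {..<M}"
    using inj_on_affine_mod[OF u, of 0] by simp
  have img: "(\<lambda>a. (u * a) mod M) ` {..<M} = {..<M}"
    using M by (intro endo_inj_surj inj) auto
  have "\<theta> u * (\<Sum>a<M. \<theta> a) = (\<Sum>a<M. \<theta> ((u * a) mod M))"
    using periodic_mod[of \<theta> M] dirichlet_charD(4)[OF \<theta>]
    by (simp add: sum_distrib_left dirichlet_charD(3)[OF \<theta>])
  also have "\<dots> = (\<Sum>a\<in>(\<lambda>a. (u * a) mod M) ` {..<M}. \<theta> a)"
    by (simp add: sum.reindex[OF inj])
  also have "\<dots> = (\<Sum>a<M. \<theta> a)" by (simp only: img)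
  finally have "\<theta> u * (\<Sum>a<M. \<theta> a) = (\<Sum>a<M. \<theta> a)" .
  moreover have "(\<Sum>a<M. \<theta> a) \<noteq> 0" using assms(2) by (auto simp: char_mean_def)
  ultimately show ?thesis by simp
qed

section \<open>Divisor sums of real characters\<close>

lemma sum_divisors_prime_power_times:
  fixes \<theta> :: "nat \<Rightarrow> real"
  assumes mult: "\<And>m n. \<theta> (m * n) = \<theta> m * \<theta> n" "\<theta> 1 = 1" and p: "prime p" "\<not> p dvd m" and m: "m > 0"
  shows "(\<Sum>d | d dvd p ^ a * m. \<theta> d) = (\<Sum>i\<le>a. \<theta> p ^ i) * (\<Sum>d | d dvd m. \<theta> d)"
proof -
  let ?\<phi> = "\<lambda>(i, e). p ^ i * e"
  have p0: "p > 0" using p prime_gt_0_nat by blast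
  have pow: "\<theta> (p ^ i) = \<theta> p ^ i" for i
    by (induction i) (use mult in auto)
  have "bij_betw ?\<phi> ({..a} \<times> {e. e dvd m}) {d. d dvd p ^ a * m}"
    unfolding bij_betw_def
  proof
    have aux: "i' \<le> i" if "p ^ i * e = p ^ i' * e'" "\<not> p dvd e" for i i' e e'
    proof (rule ccontr)
      assume "\<not> i' \<le> i"
      then have "p ^ i' = p ^ i * p ^ (i' - i)" "i' - i > 0" by (auto simp: power_add[symmetric])
      then have "e = p ^ (i' - i) * e'" using that p0 by simp
      then show False using that(2) \<open>i' - i > 0\<close> by (simp add: dvd_power)
    qed
    show "inj_on ?\<phi> ({..a} \<times> {e. e dvd m})"
    proof (rule inj_onI, clarify)
      fix i e i' e' assume *: "e dvd m" "e' dvd m" "p ^ i * e = p ^ i' * e'"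
      have nd: "\<not> p dvd e" "\<not> p dvd e'" using * p(2) dvd_trans by blast+
      have "i = i'" using aux[OF *(3) nd(1)] aux[OF *(3)[symmetric] nd(2)] by simp
      then show "i = i' \<and> e = e'" using *(3) p0 by simp
    qed
    show "?\<phi> ` ({..a} \<times> {e. e dvd m}) = {d. d dvd p ^ a * m}"
    proof (intro equalityI subsetI)
      fix d assume "d \<in> ?\<phi> ` ({..a} \<times> {e. e dvd m})"
      then show "d \<in> {d. d dvd p ^ a * m}" by (auto intro!: mult_dvd_mono le_imp_power_dvd)
    next
      fix d assume "d \<in> {d. d dvd p ^ a * m}"
      then have d: "d dvd p ^ a * m" by simp
      have "d \<noteq> 0" using d m p0 by (intro notI) simp
      then obtain e where e: "d = p ^ multiplicity p d * e" "\<not> p dvd e"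
        using multiplicity_decompose'[of d p] p(1) not_prime_unit by blast
      have "coprime (p ^ multiplicity p d) m" "coprime e (p ^ a)"
        using prime_imp_coprime[OF p] prime_imp_coprime[OF p(1) e(2)] by (auto simp: coprime_commute)
      moreover have "p ^ multiplicity p d dvd p ^ a * m" "e dvd p ^ a * m"
        using d e(1) by (metis dvd_mult_left dvd_trans dvd_triv_left, metis dvd_trans dvd_triv_right e(1))
      ultimately have 1: "p ^ multiplicity p d dvd p ^ a" and 2: "e dvd m"
        by (simp_all add: coprime_dvd_mult_left_iff coprime_dvd_mult_right_iff)
      have "multiplicity p d \<le> a" using 1 p(1) prime_gt_1_nat by (simp add: power_dvd_imp_le)
      then show "d \<in> ?\<phi> ` ({..a} \<times> {e. e dvd m})" using e(1) 2 by (intro image_eqI[of _ _ "(multiplicity p d, e)"]) auto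
    qed
  qed
  then have "(\<Sum>d | d dvd p ^ a * m. \<theta> d) = (\<Sum>x\<in>{..a} \<times> {e. e dvd m}. \<theta> (?\<phi> x))"
    by (rule sum.reindex_bij_betw[symmetric])
  also have "\<dots> = (\<Sum>i\<le>a. \<Sum>e | e dvd m. \<theta> p ^ i * \<theta> e)"
    by (simp add: sum.cartesian_product case_prod_unfold mult pow)
  finally show ?thesis by (simp only: sum_product)
qed

text \<open>Stripping off one prime power at a time reduces everything to geometric sums of a value
  in {-1, 0, 1}. These are nonnegative, and with an even top exponent at least 1 even for the value
  -1.\<close>

lemma sum_real_char_divisors:
  fixes \<theta> :: "nat \<Rightarrow> real"
  assumes mult: "\<And>m n. \<theta> (m * n) = \<theta> m * \<theta> n" "\<theta> 1 = 1" and val: "\<And>n. \<theta> n \<in> {-1, 0, 1}"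
  shows "n > 0 \<Longrightarrow> 0 \<le> (\<Sum>d | d dvd n. \<theta> d)" and "n > 0 \<Longrightarrow> 1 \<le> (\<Sum>d | d dvd n\<^sup>2. \<theta> d)"
proof -
  have geo: "0 \<le> (\<Sum>i\<le>a. v ^ i)" "1 \<le> (\<Sum>i\<le>2 * a. v ^ i)" if "v \<in> {-1, 0, 1}" for v :: real and a
  proof -
    have neg: "(\<Sum>i\<le>a. (-1) ^ i :: real) = (if even a then 1 else 0)" for a by (induction a) auto
    have zero: "(\<Sum>i\<le>a. 0 ^ i :: real) = 1" for a by (induction a) auto
    show "0 \<le> (\<Sum>i\<le>a. v ^ i)" "1 \<le> (\<Sum>i\<le>2 * a. v ^ i)"
      using that by (auto simp: neg zero)
  qed
  have decomp: "\<exists>p a m. prime p \<and> n = p ^ a * m \<and> \<not> p dvd m \<and> 0 < m \<and> m < n" if "n > 1" for n :: nat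
  proof -
    have "n \<noteq> 1" using that by simp
    then obtain p where p: "prime p" "p dvd n" using prime_factor_nat by blast
    have "n \<noteq> 0" using that by simp
    then obtain m where m: "n = p ^ multiplicity p n * m" "\<not> p dvd m"
      using multiplicity_decompose'[of n p] p(1) not_prime_unit by blast
    have "m \<noteq> 0" using m(2) by (intro notI) simp
    moreover have "m \<noteq> n" using m(2) p(2) by auto
    moreover have "m dvd n" using m(1) by (metis dvd_triv_right)
    ultimately show ?thesis using p m that dvd_imp_le[of m n] by (intro exI[of _ p] exI[of _ "multiplicity p n"] exI[of _ m]) auto
  qed
  show "0 \<le> (\<Sum>d | d dvd n. \<theta> d)" if "n > 0"
    using that
  proof (induction n rule: less_induct)
    case (less n)
    show ?case
    proof (cases "n > 1")
      case True
      then obtain p a m where pam: "prime p" "n = p ^ a * m" "\<not> p dvd m" "0 < m" "m < n" using decomp by blast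
      show ?thesis
        unfolding pam(2) sum_divisors_prime_power_times[OF mult pam(1,3,4)]
        using less.IH[OF pam(5,4)] geo(1)[OF val] by simp
    qed (use less mult(2) in \<open>auto simp: not_less le_Suc_eq\<close>)
  qed
  show "1 \<le> (\<Sum>d | d dvd n\<^sup>2. \<theta> d)" if "n > 0"
    using that
  proof (induction n rule: less_induct)
    case (less n)
    show ?case
    proof (cases "n > 1")
      case True
      then obtain p a m where pam: "prime p" "n = p ^ a * m" "\<not> p dvd m" "0 < m" "m < n" using decomp by blast
      have n2: "n\<^sup>2 = p ^ (2 * a) * m\<^sup>2" by (simp add: pam(2) power_mult_distrib power_mult[symmetric] mult.commute)
      have "\<not> p dvd m\<^sup>2" "0 < m\<^sup>2" using pam by (auto simp: prime_dvd_power_iff)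
      then have "(\<Sum>d | d dvd n\<^sup>2. \<theta> d) = (\<Sum>i\<le>2 * a. \<theta> p ^ i) * (\<Sum>d | d dvd m\<^sup>2. \<theta> d)"
        unfolding n2 by (intro sum_divisors_prime_power_times[OF mult pam(1)])
      also have "\<dots> \<ge> 1 * 1"
        using less.IH[OF pam(5,4)] geo(2)[OF val, of p a] by (intro mult_mono) auto
      finally show ?thesis by simp
    qed (use less mult(2) in \<open>auto simp: not_less le_Suc_eq\<close>)
  qed
qed

text \<open>With n = k + 1, the main part of x^n / (1 - x^n) as x tends to 1, minus the term itself.
  Weighted by \<theta>, the main parts sum to L(1, \<theta>) / (1 - x).\<close>

definition lambert_gap :: "real \<Rightarrow> nat \<Rightarrow> real" where
  "lambert_gap x k = 1 / (real (Suc k) * (1 - x)) - x ^ Suc k / (1 - x ^ Suc k)"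

text \<open>The arithmetic-geometric mean of x^i and x^(n - 1 - i) bounds a geometric sum of n terms
  below by n * x^((n - 1) / 2); the root \<open>y\<close> makes the exponents integral.\<close>

lemma geometric_sum_lower:
  fixes x :: real
  assumes x: "0 < x" "x < 1"
  shows "real n * real (Suc n) * x ^ n \<le> (\<Sum>i<n. x ^ i) * (\<Sum>i<Suc n. x ^ i)"
proof -
  define y where "y = sqrt x"
  have y: "0 < y" "y < 1" "y\<^sup>2 = x" using x by (auto simp: y_def)
  have low: "real n * y ^ n \<le> (\<Sum>i<n. x ^ i)" and low': "real n * y ^ (n - 1) \<le> (\<Sum>i<n. x ^ i)" for n
  proof -
    have "2 * (\<Sum>i<n. x ^ i) = (\<Sum>i<n. x ^ i) + (\<Sum>i<n. x ^ (n - Suc i))"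
      by (simp add: sum.nat_diff_reindex)
    also have "\<dots> = (\<Sum>i<n. x ^ i + x ^ (n - Suc i))" by (simp add: sum.distrib)
    also have "\<dots> \<ge> (\<Sum>i<n. 2 * y ^ (n - 1))"
    proof (rule sum_mono)
      fix i assume "i \<in> {..<n}"
      then have e: "i + (n - Suc i) = n - 1" by simp
      have "0 \<le> (y ^ i - y ^ (n - Suc i))\<^sup>2" by simp
      also have "\<dots> = (y ^ i)\<^sup>2 + (y ^ (n - Suc i))\<^sup>2 - 2 * (y ^ i * y ^ (n - Suc i))"
        by (simp add: power2_diff)
      also have "(y ^ i)\<^sup>2 = x ^ i" using y(3) by (metis power_mult mult.commute)
      also have "(y ^ (n - Suc i))\<^sup>2 = x ^ (n - Suc i)" using y(3) by (metis power_mult mult.commute)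
      also have "y ^ i * y ^ (n - Suc i) = y ^ (n - 1)" by (simp only: power_add[symmetric] e)
      finally show "2 * y ^ (n - 1) \<le> x ^ i + x ^ (n - Suc i)" by simp
    qed
    finally show 1: "real n * y ^ (n - 1) \<le> (\<Sum>i<n. x ^ i)" by simp
    have "y ^ n \<le> y ^ (n - 1)" using y by (intro power_decreasing) auto
    then have "real n * y ^ n \<le> real n * y ^ (n - 1)" by (rule mult_left_mono) simp
    then show "real n * y ^ n \<le> (\<Sum>i<n. x ^ i)" using 1 by linarith
  qed
  have "real n * real (Suc n) * x ^ n = (real n * y ^ n) * (real (Suc n) * y ^ n)"
    unfolding y(3)[symmetric] by (simp add: power_mult[symmetric] mult.commute power2_eq_square power_mult_distrib)
  also have "\<dots> \<le> (\<Sum>i<n. x ^ i) * (\<Sum>i<Suc n. x ^ i)"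
    using low[of n] low'[of "Suc n"] x y by (intro mult_mono sum_nonneg) auto
  finally show ?thesis .
qed

text \<open>After multiplication by 1 - x, consecutive gaps differ by 1 / (n * (n + 1)) - x^n / (S n
  * S (n + 1)), so monotonicity is exactly the preceding inequality.\<close>

lemma lambert_gap_decreasing:
  assumes x: "0 < x" "x < 1"
  shows "lambert_gap x (Suc k) \<le> lambert_gap x k"
proof -
  define n where "n = Suc k"
  define S where "S = (\<lambda>n. \<Sum>i<n. x ^ i)"
  have S: "1 - x ^ m = (1 - x) * S m" for m
    unfolding S_def using one_diff_power_eq[of x m] by simp
  have Spos: "S m > 0" if "m > 0" for m
    unfolding S_def using x that by (intro sum_pos) auto
  have n: "n > 0" by (simp add: n_def)
  have Ss: "S (Suc n) - x * S n = 1"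
  proof -
    have "S (Suc n) = 1 + x * S n" unfolding S_def sum.lessThan_Suc_shift by (simp add: sum_distrib_left)
    then show ?thesis by simp
  qed
  have g: "(1 - x) * lambert_gap x (m - 1) = 1 / real m - x ^ m / S m" if "m > 0" for m
  proof -
    have "lambert_gap x (m - 1) = 1 / (real m * (1 - x)) - x ^ m / ((1 - x) * S m)"
      using that by (simp add: lambert_gap_def S)
    moreover have "u * (1 / (real m * u) - y / (u * z)) = 1 / real m - y / z" if "u \<noteq> 0" for u y z :: real
      using that by (simp add: right_diff_distrib)
    ultimately show ?thesis using x by simp
  qed
  have "(1 - x) * lambert_gap x k - (1 - x) * lambert_gap x (Suc k) =
      (1 / real n - x ^ n / S n) - (1 / real (Suc n) - x ^ Suc n / S (Suc n))"
    using g[OF n] g[of "Suc n"] by (simp add: n_def)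
  also have "\<dots> = 1 / (real n * real (Suc n)) - x ^ n * (S (Suc n) - x * S n) / (S n * S (Suc n))"
  proof -
    have a: "1 / real n - 1 / real (Suc n) = 1 / (real n * real (Suc n))"
      using n by (simp add: field_simps)
    have "y / s - x * y / t = y * (t - x * s) / (s * t)" if "s \<noteq> 0" "t \<noteq> 0" for y s t :: real
      using that by (simp add: field_simps)
    from this[of "S n" "S (Suc n)" "x ^ n"]
    have "x ^ n / S n - x ^ Suc n / S (Suc n) = x ^ n * (S (Suc n) - x * S n) / (S n * S (Suc n))"
      using Spos[of n] Spos[of "Suc n"] n by simp
    with a show ?thesis by linarith
  qed
  also have "\<dots> = 1 / (real n * real (Suc n)) - x ^ n / (S n * S (Suc n))" by (simp only: Ss mult_1_right)
  also have "\<dots> \<ge> 0"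
  proof -
    have "real n * real (Suc n) * x ^ n \<le> S n * S (Suc n)" unfolding S_def by (rule geometric_sum_lower[OF x])
    moreover have "0 < S n * S (Suc n)" "0 < real n * real (Suc n)" using n Spos[of n] Spos[of "Suc n"] by simp_all
    ultimately have "x ^ n / (S n * S (Suc n)) \<le> 1 / (real n * real (Suc n))"
      by (simp only: pos_divide_le_eq pos_le_divide_eq times_divide_eq_left mult_1 mult.commute[of "x ^ n"])
    then show ?thesis by linarith
  qed
  finally have "(1 - x) * lambert_gap x (Suc k) \<le> (1 - x) * lambert_gap x k" by linarith
  then show ?thesis using x by simp
qed

lemma lambert_gap_nonneg:
  assumes x: "0 < x" "x < 1"
  shows "0 \<le> lambert_gap x k"
proof -
  have "(\<lambda>k. x ^ Suc k) \<longlonglongrightarrow> 0"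
    using LIMSEQ_realpow_zero[of x] x by (intro LIMSEQ_Suc) auto
  then have "(\<lambda>k. x ^ Suc k / (1 - x ^ Suc k)) \<longlonglongrightarrow> 0 / (1 - 0)"
    by (intro tendsto_intros) auto
  moreover have "(\<lambda>k. 1 / (1 - x) * inverse (real (Suc k))) \<longlonglongrightarrow> 1 / (1 - x) * 0"
    by (intro tendsto_intros LIMSEQ_inverse_real_of_nat)
  ultimately have "(\<lambda>k. 1 / (1 - x) * inverse (real (Suc k)) - x ^ Suc k / (1 - x ^ Suc k)) \<longlonglongrightarrow> 1 / (1 - x) * 0 - 0 / (1 - 0)"
    by (intro tendsto_diff)
  then have "lambert_gap x \<longlonglongrightarrow> 0"
    by (simp add: lambert_gap_def[abs_def] field_simps)
  moreover have "decseq (lambert_gap x)"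
    by (intro decseq_SucI lambert_gap_decreasing x)
  ultimately show ?thesis by (intro decseq_ge)
qed

text \<open>The condition j > 0 matters, since every n divides 0.\<close>

lemma lambert_term_sums:
  fixes x :: real
  assumes x: "0 < x" "x < 1" and n: "n > 0"
  shows "(\<lambda>j. of_bool (n dvd j \<and> j > 0) * x ^ j) sums (x ^ n / (1 - x ^ n))"
proof -
  have "x ^ n < 1" using x n by (simp add: power_less_one_iff)
  then have "(\<lambda>m. x ^ n * (x ^ n) ^ m) sums (x ^ n * (1 / (1 - x ^ n)))"
    using x by (intro sums_mult geometric_sums) auto
  then have "(\<lambda>m. of_bool (n dvd n * Suc m \<and> n * Suc m > 0) * x ^ (n * Suc m)) sums (x ^ n / (1 - x ^ n))"
    using n by (simp add: power_add power_mult)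
  moreover have "strict_mono (\<lambda>m. n * Suc m)" using n by (auto intro!: strict_monoI)
  moreover have "of_bool (n dvd j \<and> j > 0) * x ^ j = 0" if "j \<notin> range (\<lambda>m. n * Suc m)" for j
  proof -
    have "\<not> (n dvd j \<and> j > 0)"
    proof
      assume "n dvd j \<and> j > 0"
      then obtain i where "j = n * i" "i > 0" by (metis dvd_def gr0I mult_0_right)
      then have "j = n * Suc (i - 1)" by simp
      then show False using that by blast
    qed
    then show ?thesis by simp
  qed
  ultimately show ?thesis
    using sums_mono_reindex[of "\<lambda>m. n * Suc m" "\<lambda>j. of_bool (n dvd j \<and> j > 0) * x ^ j"] by blast
qed

text \<open>Monsky's argument: the Lambert series of a real character is unbounded near 1 because its
  coefficients are nonnegative and at least 1 at squares, whereas \<open>L(1, \<theta>) = 0\<close> would bound it.\<close>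

lemma L_regular_1_nonzero:
  assumes \<theta>: "dirichlet_char M \<theta>" and mean: "char_mean M \<theta> = 0" and real: "\<And>n. coprime n M \<Longrightarrow> (\<theta> n)\<^sup>2 = 1"
  shows "L_regular M \<theta> 1 \<noteq> 0"
proof
  assume zero: "L_regular M \<theta> 1 = 0"
  define v where "v = (\<lambda>n. Re (\<theta> n))"
  have val: "\<theta> n = of_real (v n)" "v n \<in> {-1, 0, 1}" for n
  proof -
    have "\<theta> n = 0 \<or> \<theta> n = 1 \<or> \<theta> n = -1"
      using real[of n] dirichlet_charD(5)[OF \<theta>, of n] by (auto simp: power2_eq_1_iff)
    then show "\<theta> n = of_real (v n)" "v n \<in> {-1, 0, 1}" by (auto simp: v_def)
  qed
  have mult: "v (m * n) = v m * v n" for m n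
    using dirichlet_charD(3)[OF \<theta>, of m n] unfolding val(1) by (metis of_real_eq_iff of_real_mult)
  have v1: "v 1 = 1" using dirichlet_charD(2)[OF \<theta>] by (simp add: v_def)
  have vle: "\<bar>v n\<bar> \<le> 1" for n using val(2)[of n] by auto
  define Q where "Q = (\<lambda>N. \<Sum>k<N. v (Suc k) / real (Suc k))"
  have Q: "Q \<longlonglongrightarrow> 0"
  proof -
    have "(\<lambda>k. (\<theta> (Suc k) - char_mean M \<theta>) * of_nat (Suc k) powr (- 1)) sums 0"
      using L_regular_sums[OF \<theta>, of 1] zero by simp
    moreover have "(\<theta> (Suc k) - char_mean M \<theta>) * of_nat (Suc k) powr (- 1) = complex_of_real (v (Suc k) / real (Suc k))" for k
    proof -
      have "(of_nat (Suc k) :: complex) powr (- 1) = inverse (of_nat (Suc k))"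
        by (simp add: powr_minus del: of_nat_Suc)
      then show ?thesis by (simp add: mean val(1) divide_inverse del: of_nat_Suc)
    qed
    ultimately have "(\<lambda>k. complex_of_real (v (Suc k) / real (Suc k))) sums of_real 0" by simp
    then have "(\<lambda>k. v (Suc k) / real (Suc k)) sums 0" by (simp only: sums_of_real_iff)
    then show ?thesis by (simp add: sums_def Q_def)
  qed
  define E where "E = (\<lambda>n. \<Sum>k<n. v (Suc k))"
  have E: "\<bar>E n\<bar> \<le> 2 * real M" for n
  proof -
    have "char_discrepancy M \<theta> n = of_real (E n)"
      by (simp add: char_discrepancy_def mean E_def val(1))
    then show ?thesis using cmod_char_discrepancy_le[OF \<theta>, of n] by simp
  qed
  \<comment> \<open>2 * M + 1 squares, one more than the bound 2 * M permits once x tends to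
    1.\<close>
  define J where "J = 2 * M + 1"
  have bound: "(\<Sum>i=1..J. x ^ (i\<^sup>2)) \<le> 2 * real M" if x: "0 < x" "x < 1" for x :: real
  proof -
    let ?B = "lambert_gap x"
    define P where "P = (\<lambda>N. \<Sum>k<N. v (Suc k) * (x ^ Suc k / (1 - x ^ Suc k)))"
    \<comment> \<open>Partial sums of \<open>v\<close> are bounded by 2 * M, and the gaps decrease
      from 1 without becoming negative, so partial summation telescopes to 2 * M for all x and
      \<open>N\<close>.\<close>
    have abel: "\<bar>\<Sum>k<N. v (Suc k) * ?B k\<bar> \<le> 2 * real M" for N
    proof -
      have "(\<Sum>k<N. v (Suc k) * ?B k) = (\<Sum>k<N. E (Suc k) * (?B k - ?B (Suc k))) + E N * ?B N"
        by (induction N) (simp_all add: E_def algebra_simps)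
      also have "\<bar>\<dots>\<bar> \<le> (\<Sum>k<N. 2 * real M * (?B k - ?B (Suc k))) + 2 * real M * ?B N"
      proof (rule order_trans[OF abs_triangle_ineq], rule add_mono)
        show "\<bar>\<Sum>k<N. E (Suc k) * (?B k - ?B (Suc k))\<bar> \<le> (\<Sum>k<N. 2 * real M * (?B k - ?B (Suc k)))"
        proof (rule sum_abs[THEN order_trans], rule sum_mono)
          fix k
          show "\<bar>E (Suc k) * (?B k - ?B (Suc k))\<bar> \<le> 2 * real M * (?B k - ?B (Suc k))"
            unfolding abs_mult using lambert_gap_decreasing[OF x, of k] E[of "Suc k"]
            by (intro mult_mono) auto
        qed
        show "\<bar>E N * ?B N\<bar> \<le> 2 * real M * ?B N"
          unfolding abs_mult using lambert_gap_nonneg[OF x, of N] E[of N] by (intro mult_mono) auto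
      qed
      also have "(\<Sum>k<N. 2 * real M * (?B k - ?B (Suc k))) = 2 * real M * (?B 0 - ?B N)"
        by (simp only: sum_distrib_left[symmetric] sum_lessThan_telescope')
      also have "?B 0 = 1" using x by (simp add: lambert_gap_def diff_divide_distrib[symmetric])
      finally show ?thesis by (simp add: algebra_simps)
    qed
    have PQ: "P N \<le> 2 * real M + Q N / (1 - x)" for N
    proof -
      have "(\<Sum>k<N. v (Suc k) * ?B k) = Q N / (1 - x) - P N"
        by (simp add: lambert_gap_def Q_def P_def sum_divide_distrib right_diff_distrib sum_subtractf)
      then show ?thesis using abel[of N] by linarith
    qed
    \<comment> \<open>Truncating the divisors at \<open>N\<close> leaves finitely many Lambert
      series to combine. For 0 < j \<le> N this is the full divisor sum; beyond, only the trivial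
      bound - j is used, and it costs the tail \<open>T\<close>.\<close>
    define rN where "rN = (\<lambda>N j. \<Sum>k<N. v (Suc k) * of_bool (Suc k dvd j \<and> j > 0))"
    have Psums: "(\<lambda>j. rN N j * x ^ j) sums P N" for N
    proof -
      have "(\<lambda>j. \<Sum>k<N. v (Suc k) * (of_bool (Suc k dvd j \<and> j > 0) * x ^ j)) sums P N"
        unfolding P_def by (intro sums_sum sums_mult lambert_term_sums x) simp
      then show ?thesis by (simp only: rN_def sum_distrib_right mult.assoc)
    qed
    have sj: "summable (\<lambda>j. real j * x ^ j)"
    proof -
      have "summable (\<lambda>n. x * (of_nat (Suc n) * x ^ n))"
        using geometric_deriv_sums[of x] x by (intro summable_mult) (auto simp: sums_iff)
      then have "summable (\<lambda>n. real (Suc n) * x ^ Suc n)" by (simp add: mult_ac del: of_nat_Suc)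
      then show ?thesis by (subst (asm) summable_Suc_iff)
    qed
    define T where "T = (\<lambda>N. \<Sum>j. real (j + Suc N) * x ^ (j + Suc N))"
    have T: "T \<longlonglongrightarrow> 0"
    proof -
      have "(\<lambda>N. (\<Sum>j. real j * x ^ j) - (\<Sum>j<Suc N. real j * x ^ j)) \<longlonglongrightarrow> (\<Sum>j. real j * x ^ j) - (\<Sum>j. real j * x ^ j)"
        by (intro tendsto_intros LIMSEQ_Suc summable_LIMSEQ[OF sj])
      moreover have "T = (\<lambda>N. (\<Sum>j. real j * x ^ j) - (\<Sum>j<Suc N. real j * x ^ j))"
        unfolding T_def by (rule ext) (rule suminf_minus_initial_segment[OF sj])
      ultimately show ?thesis by (simp only: diff_self)
    qed
    have low: "(\<Sum>i=1..J. x ^ (i\<^sup>2)) \<le> P N + T N" if N: "N \<ge> J\<^sup>2" for N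
    proof -
      have rabs: "- real j \<le> rN N j" for j
      proof (cases "j = 0")
        case False
        have "\<bar>rN N j\<bar> \<le> (\<Sum>k<N. of_bool (Suc k dvd j \<and> j > 0))"
          unfolding rN_def by (rule sum_abs[THEN order_trans], rule sum_mono) (use vle in \<open>auto simp: abs_mult\<close>)
        also have "\<dots> = real (card {k. k < N \<and> Suc k dvd j \<and> j > 0})"
          by (simp add: of_bool_def sum.If_cases Int_def)
        also have "card {k. k < N \<and> Suc k dvd j \<and> j > 0} \<le> card {..<j}"
          by (intro card_mono) (auto dest: dvd_imp_le)
        finally show ?thesis by simp
      qed (simp add: rN_def)
      have req: "rN N j = (\<Sum>d | d dvd j. v d)" if j: "0 < j" "j \<le> N" for j
      proof -
        have "rN N j = (\<Sum>k\<in>{k. k < N \<and> Suc k dvd j}. v (Suc k))"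
          unfolding rN_def using j by (intro sum.mono_neutral_cong_right) auto
        also have "\<dots> = (\<Sum>d | d dvd j. v d)"
        proof (rule sum.reindex_bij_witness[of _ "\<lambda>d. d - 1" Suc])
          fix d assume "d \<in> {d. d dvd j}"
          then have d: "d dvd j" by simp
          then have "d \<noteq> 0" "d \<le> N" using j dvd_imp_le[of d j] by (auto intro!: Nat.gr0I)
          then show "Suc (d - 1) = d" "d - 1 \<in> {k. k < N \<and> Suc k dvd j}" using d by auto
        qed auto
        finally show ?thesis .
      qed
      have rpos: "0 \<le> rN N j * x ^ j" if "j \<le> N" for j
      proof (cases "j = 0")
        case False
        then show ?thesis using req[of j] that sum_real_char_divisors(1)[OF mult v1 val(2), of j] x by simp
      qed (simp add: rN_def)
      have "P N = (\<Sum>j. rN N (j + Suc N) * x ^ (j + Suc N)) + (\<Sum>j<Suc N. rN N j * x ^ j)"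
        using suminf_split_initial_segment[of "\<lambda>j. rN N j * x ^ j" "Suc N"] Psums[of N] by (simp add: sums_iff)
      moreover have "- T N \<le> (\<Sum>j. rN N (j + Suc N) * x ^ (j + Suc N))"
      proof -
        have s1: "summable (\<lambda>j. real (j + Suc N) * x ^ (j + Suc N))" using sj by (subst summable_iff_shift)
        have s2: "summable (\<lambda>j. rN N (j + Suc N) * x ^ (j + Suc N))"
          using Psums[of N] by (subst summable_iff_shift) (auto simp: sums_iff)
        have "- T N = (\<Sum>j. - (real (j + Suc N) * x ^ (j + Suc N)))"
          unfolding T_def using s1 by (rule suminf_minus[symmetric])
        also have "\<dots> \<le> (\<Sum>j. rN N (j + Suc N) * x ^ (j + Suc N))"
        proof (rule suminf_le)
          fix j
          have "(- real (j + Suc N)) * x ^ (j + Suc N) \<le> rN N (j + Suc N) * x ^ (j + Suc N)"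
            by (intro mult_right_mono rabs) (use x in simp)
          then show "- (real (j + Suc N) * x ^ (j + Suc N)) \<le> rN N (j + Suc N) * x ^ (j + Suc N)"
            by (simp only: mult_minus_left)
        qed (use s1 s2 in \<open>auto intro: summable_minus\<close>)
        finally show ?thesis .
      qed
      moreover have "(\<Sum>i=1..J. x ^ (i\<^sup>2)) \<le> (\<Sum>j<Suc N. rN N j * x ^ j)"
      proof -
        have "(\<Sum>i=1..J. x ^ (i\<^sup>2)) \<le> (\<Sum>i=1..J. rN N (i\<^sup>2) * x ^ (i\<^sup>2))"
        proof (rule sum_mono)
          fix i assume i: "i \<in> {1..J}"
          then have "i\<^sup>2 \<le> J\<^sup>2" by (intro power_mono) auto
          then have "i\<^sup>2 \<le> N" using N by linarith
          then have "1 \<le> rN N (i\<^sup>2)" using req[of "i\<^sup>2"] i sum_real_char_divisors(2)[OF mult v1 val(2), of i] by simp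
          then show "x ^ (i\<^sup>2) \<le> rN N (i\<^sup>2) * x ^ (i\<^sup>2)" using x by (simp add: mult_le_cancel_right1)
        qed
        also have "\<dots> = (\<Sum>j\<in>(\<lambda>i. i\<^sup>2) ` {1..J}. rN N j * x ^ j)"
          by (subst sum.reindex) (auto simp: inj_on_def)
        also have "\<dots> \<le> (\<Sum>j<Suc N. rN N j * x ^ j)"
        proof (rule sum_mono2)
          show "(\<lambda>i. i\<^sup>2) ` {1..J} \<subseteq> {..<Suc N}"
          proof
            fix j assume "j \<in> (\<lambda>i. i\<^sup>2) ` {1..J}"
            then obtain i where i: "j = i\<^sup>2" "i \<le> J" by auto
            then have "j \<le> J\<^sup>2" by (auto intro: power_mono)
            then show "j \<in> {..<Suc N}" using N by simp
          qed
        qed (auto intro: rpos)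
        finally show ?thesis .
      qed
      ultimately show ?thesis by linarith
    qed
    have lim: "(\<lambda>N. 2 * real M + Q N / (1 - x) + T N) \<longlonglongrightarrow> 2 * real M + 0 / (1 - x) + 0"
      using x by (intro tendsto_intros Q T) auto
    have "\<exists>N0. \<forall>N\<ge>N0. (\<Sum>i=1..J. x ^ (i\<^sup>2)) \<le> 2 * real M + Q N / (1 - x) + T N"
    proof (intro exI[of _ "J\<^sup>2"] allI impI)
      fix N assume "J\<^sup>2 \<le> N"
      then show "(\<Sum>i=1..J. x ^ (i\<^sup>2)) \<le> 2 * real M + Q N / (1 - x) + T N"
        using low[of N] PQ[of N] by linarith
    qed
    then show ?thesis using LIMSEQ_le_const[OF lim] by simp
  qed
  have "((\<lambda>x::real. \<Sum>i=1..J. x ^ (i\<^sup>2)) \<longlongrightarrow> (\<Sum>i=1..J. 1 ^ (i\<^sup>2))) (at_left 1)"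
    by (intro tendsto_intros)
  moreover have "eventually (\<lambda>x::real. (\<Sum>i=1..J. x ^ (i\<^sup>2)) \<le> 2 * real M) (at_left 1)"
    using eventually_at_left_real[of 0 1] by (rule eventually_mono) (use bound in auto)
  ultimately have "(\<Sum>i=1..J. (1::real) ^ (i\<^sup>2)) \<le> 2 * real M"
    by (intro tendsto_upperbound) auto
  then show False by (simp add: J_def)
qed

text \<open>At s = 1 there are two cases: if \<theta>^2 is not principal the 3-4-1 argument still
  applies, and otherwise \<theta> is real and the Lambert series decides.\<close>

lemma L_function_nonzero:
  assumes \<theta>: "dirichlet_char M \<theta>" and s: "Re s = 1" "s \<noteq> 1 \<or> char_mean M \<theta> = 0"
  shows "L_function M \<theta> s \<noteq> 0"
proof (cases "s = 1")
  case False
  have eq: "s = Complex 1 (Im s)" using s by (simp add: complex_eq_iff)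
  have "Im s \<noteq> 0" using False s by (auto simp: complex_eq_iff)
  then show ?thesis by (subst eq) (rule L_function_nonzero_complex[OF \<theta>], simp)
next
  case True
  then have mean: "char_mean M \<theta> = 0" using s by simp
  have one: "Complex 1 0 = 1" by (simp add: complex_eq_iff)
  show ?thesis
  proof (cases "char_mean M (\<lambda>n. (\<theta> n)\<^sup>2) = 0")
    case T: True
    then show ?thesis using L_function_nonzero_complex[OF \<theta>, of 0] mean True one by simp
  next
    case False
    have "(\<theta> n)\<^sup>2 = 1" if "coprime n M" for n
      using char_mean_nonzero_imp[OF dirichlet_char_power2[OF \<theta>] False that] .
    then show ?thesis
      using L_regular_1_nonzero[OF \<theta> mean] True mean by (simp add: L_function_def)
  qed
qed

section \<open>A Tauberian theorem of Newman\<close>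

lemma powr_tail_step:
  assumes x: "x > 0" and m: "m \<ge> (1::real)"
  shows "(m + 1) powr (- 1 - x) \<le> (m powr (- x) - (m + 1) powr (- x)) / x"
proof -
  have "\<exists>z>m. z < m + 1 \<and> (m + 1) powr (- x) - m powr (- x) = (m + 1 - m) * (- x * z powr (- x - 1))"
  proof (rule MVT2)
    fix z assume "m \<le> z"
    then show "((\<lambda>z. z powr (- x)) has_real_derivative - x * z powr (- x - 1)) (at z)"
      using m by (auto intro!: derivative_eq_intros)
  qed simp
  then obtain z where z: "m < z" "z < m + 1" "m powr (- x) - (m + 1) powr (- x) = x * z powr (- x - 1)" by auto
  have "(m + 1) powr (- x - 1) \<le> z powr (- x - 1)" using z m x by (intro powr_mono2') auto
  then have "x * (m + 1) powr (- x - 1) \<le> m powr (- x) - (m + 1) powr (- x)" unfolding z(3) using x by simp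
  moreover have "- 1 - x = - x - 1" by simp
  ultimately show ?thesis using x by (simp only: pos_le_divide_eq mult.commute)
qed

lemma suminf_powr_tail_le:
  assumes x: "x > 0" and N: "N \<ge> 1"
  shows "summable (\<lambda>k. real (k + Suc N) powr (- 1 - x))" "(\<Sum>k. real (k + Suc N) powr (- 1 - x)) \<le> real N powr (- x) / x"
proof -
  have sm: "summable (\<lambda>n. real n powr (- 1 - x))" using x by (simp add: summable_real_powr_iff)
  then show s: "summable (\<lambda>k. real (k + Suc N) powr (- 1 - x))" by (rule summable_ignore_initial_segment)
  have part: "(\<Sum>k<K. real (k + Suc N) powr (- 1 - x)) \<le> (real N powr (- x) - real (N + K) powr (- x)) / x" for K
  proof (induction K)
    case (Suc K)
    have "real (K + Suc N) powr (- 1 - x) \<le> (real (N + K) powr (- x) - real (N + Suc K) powr (- x)) / x"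
      using powr_tail_step[OF x, of "real (N + K)"] N by (simp add: add_ac)
    then show ?case using Suc by (simp add: diff_divide_distrib)
  qed simp
  show "(\<Sum>k. real (k + Suc N) powr (- 1 - x)) \<le> real N powr (- x) / x"
  proof (rule suminf_le_const[OF s])
    fix K
    have "(real N powr (- x) - real (N + K) powr (- x)) / x \<le> real N powr (- x) / x"
      using x by (intro divide_right_mono) auto
    then show "(\<Sum>k<K. real (k + Suc N) powr (- 1 - x)) \<le> real N powr (- x) / x" using part[of K] by linarith
  qed
qed

text \<open>Comparison with the integral of t^(y - 1), whose monotonicity changes at y = 1. For y >
  1 the endpoint becomes N + 1, and N \<ge> 2 * R keeps (1 + 1 / N)^y \<le> exp (1 / 2) \<le> 2, so
  one bound serves the whole left arc.\<close>

lemma sum_powr_le: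
  assumes y: "y > 0" "y \<le> R" and N: "real N \<ge> 2 * R" "N \<ge> 1"
  shows "(\<Sum>k<N. real (Suc k) powr (y - 1)) \<le> 2 * (real N powr y / y)"
proof (cases "y \<le> 1")
  case True
  have step: "real (Suc k) powr (y - 1) \<le> (real (Suc k) powr y - real k powr y) / y" for k
  proof (cases "k = 0")
    case True
    then show ?thesis using y \<open>y \<le> 1\<close> by (simp add: field_simps)
  next
    case False
    have "\<exists>z>real k. z < real (Suc k) \<and> real (Suc k) powr y - real k powr y = (real (Suc k) - real k) * (y * z powr (y - 1))"
    proof (rule MVT2)
      fix z assume "real k \<le> z"
      then show "((\<lambda>z. z powr y) has_real_derivative y * z powr (y - 1)) (at z)"
        using False by (auto intro!: derivative_eq_intros)
    qed simp
    then obtain z where z: "real k < z" "z < real (Suc k)" "real (Suc k) powr y - real k powr y = y * z powr (y - 1)" by auto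
    have "real (Suc k) powr (y - 1) \<le> z powr (y - 1)" using z True False by (intro powr_mono2') auto
    then show ?thesis using z(3) y by (simp add: field_simps)
  qed
  have "(\<Sum>k<N. real (Suc k) powr (y - 1)) \<le> (\<Sum>k<N. (real (Suc k) powr y - real k powr y) / y)"
    by (intro sum_mono step)
  also have "\<dots> = real N powr y / y"
    using sum_lessThan_telescope[of "\<lambda>k. real k powr y" N] by (simp only: sum_divide_distrib[symmetric]) simp
  also have "\<dots> \<le> 2 * (real N powr y / y)"
  proof -
    have "0 \<le> real N powr y / y" using y by simp
    then show ?thesis by linarith
  qed
  finally show ?thesis .
next
  case False
  have step: "real (Suc k) powr (y - 1) \<le> (real (Suc (Suc k)) powr y - real (Suc k) powr y) / y" for k
  proof -
    have "\<exists>z>real (Suc k). z < real (Suc (Suc k)) \<and> real (Suc (Suc k)) powr y - real (Suc k) powr y = (real (Suc (Suc k)) - real (Suc k)) * (y * z powr (y - 1))"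
    proof (rule MVT2)
      fix z assume "real (Suc k) \<le> z"
      then have "z > 0" by (metis less_le_trans of_nat_0_less_iff zero_less_Suc)
      then show "((\<lambda>z. z powr y) has_real_derivative y * z powr (y - 1)) (at z)"
        by (auto intro!: derivative_eq_intros)
    qed simp
    then obtain z where z: "real (Suc k) < z" "real (Suc (Suc k)) powr y - real (Suc k) powr y = y * z powr (y - 1)" by auto
    have "real (Suc k) powr (y - 1) \<le> z powr (y - 1)" using z False by (intro powr_mono2) auto
    then show ?thesis using z(2) y by (simp add: field_simps)
  qed
  have "(\<Sum>k<N. real (Suc k) powr (y - 1)) \<le> (\<Sum>k<N. (real (Suc (Suc k)) powr y - real (Suc k) powr y) / y)"
    by (intro sum_mono step)
  also have "\<dots> = (real (Suc N) powr y - 1) / y"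
    using sum_lessThan_telescope[of "\<lambda>k. real (Suc k) powr y" N] by (simp only: sum_divide_distrib[symmetric]) simp
  also have "\<dots> \<le> real (Suc N) powr y / y" using y by (intro divide_right_mono) auto
  also have "\<dots> \<le> (2 * real N powr y) / y"
  proof (intro divide_right_mono)
    have "1 + 1 / real N \<le> exp (1 / real N)" by (rule exp_ge_add_one_self)
    then have "(1 + 1 / real N) powr y \<le> exp (1 / real N) powr y" using y by (intro powr_mono2) auto
    also have "\<dots> = exp (y / real N)" by (simp add: exp_powr_real)
    also have "\<dots> \<le> exp (1 / 2)" using y N by (simp add: field_simps)
    also have "\<dots> \<le> 2"
    proof -
      have "exp (1 / 2 :: real) ^ 2 = exp 1" by (simp add: exp_of_nat_mult[symmetric])
      also have "\<dots> \<le> 2 ^ 2" using exp_le by simp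
      finally show ?thesis by (rule power2_le_imp_le) simp
    qed
    finally have "(1 + 1 / real N) powr y \<le> 2" .
    moreover have "real (Suc N) powr y = (1 + 1 / real N) powr y * real N powr y"
    proof -
      have "real (Suc N) = (1 + 1 / real N) * real N" using N by (simp add: field_simps)
      then show ?thesis by (simp only: powr_mult)
    qed
    ultimately show "real (Suc N) powr y \<le> 2 * real N powr y" by (simp add: mult_right_mono)
  qed (use y in auto)
  finally show ?thesis by simp
qed

text \<open>Evaluated from the parametrisation; over two complementary half circles it yields the
  residue at 0 by hand.\<close>

lemma contour_integral_inverse_arc:
  assumes "R > 0" "s < t"
  shows "((\<lambda>z. c / z) has_contour_integral (c * (\<i> * of_real (t - s)))) (part_circlepath 0 R s t)"
proof (subst has_contour_integral_part_circlepath_iff[OF assms(2)])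
  have "((\<lambda>_::real. c * \<i>) has_integral ((t - s) *\<^sub>R (c * \<i>))) {s..t}"
    using has_integral_const_real[of "c * \<i>" s t] assms by simp
  moreover have "c / (0 + of_real R * cis x) * of_real R * \<i> * cis x = c * \<i>" for x
    using assms(1) by (simp add: field_simps)
  ultimately show "((\<lambda>x. c / (0 + of_real R * cis x) * of_real R * \<i> * cis x) has_integral c * (\<i> * of_real (t - s))) {s..t}"
    by (simp add: scaleR_conv_of_real mult_ac)
qed

lemma holomorphic_difference_quotient:
  assumes f: "f holomorphic_on S" and S: "open S" "0 \<in> S"
  shows "(\<lambda>z. if z = 0 then deriv f 0 else (f z - f 0) / z) holomorphic_on S"
proof -
  let ?g = "\<lambda>z. f z - f 0"
  have d: "deriv ?g 0 = deriv f 0"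
    using f S by (subst deriv_diff) (auto intro: holomorphic_on_imp_differentiable_at)
  show ?thesis
    by (rule pole_theorem_open_0[where g = ?g and a = 0])
      (use S d in \<open>auto intro!: holomorphic_intros f\<close>)
qed

text \<open>Newman's kernel: on the circle it is real and proportional to Re z, so it cancels the
  factor 1 / |Re z| in the bounds for tails and partial sums.\<close>

lemma arc_kernel:
  assumes "cmod z = R" "R > 0"
  shows "(1 + z\<^sup>2 / of_real (R\<^sup>2)) / z = of_real (2 * Re z / R\<^sup>2)"
proof -
  have z0: "z \<noteq> 0" using assms by auto
  have R2: "of_real (R\<^sup>2) = z * cnj z" using assms by (simp add: complex_norm_square[symmetric])
  have "(1 + z\<^sup>2 / of_real (R\<^sup>2)) / z = (z + cnj z) / (z * cnj z)"
    using z0 unfolding R2 by (simp add: field_simps power2_eq_square)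
  also have "\<dots> = of_real (2 * Re z / R\<^sup>2)"
    unfolding R2[symmetric] by (simp add: complex_add_cnj)
  finally show ?thesis .
qed

text \<open>Newman's contour argument.  The normalisation \<open>G 1 = 0\<close> makes \<open>G (1 + z) / z\<close> holomorphic,
  so that no winding number enters.\<close>

lemma newman_bound:
  fixes a :: "nat \<Rightarrow> complex"
  assumes a: "\<And>n. cmod (a n) \<le> A" and V: "open V" "{s. Re s \<ge> 1} \<subseteq> V" and G: "G holomorphic_on V" "G 1 = 0"
    and eq: "\<And>s. Re s > 1 \<Longrightarrow> G s = dirichlet_series a s" and R: "R > 0" and \<epsilon>: "\<epsilon> > 0"
  shows "\<forall>\<^sub>F N in sequentially. cmod (\<Sum>k<N. a (Suc k) / of_nat (Suc k)) \<le> 3 * A / R + \<epsilon>"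
proof -
  have A0: "A \<ge> 0" using order_trans[OF norm_ge_zero a[of 0]] .
  define V' where "V' = (\<lambda>z. 1 + z) -` V"
  have V'o: "open V'" unfolding V'_def by (intro open_vimage V(1) continuous_intros)
  have V'0: "z \<in> V'" if "Re z \<ge> 0" for z using that V(2) by (auto simp: V'_def)
  define g where "g = (\<lambda>z. G (1 + z))"
  have ghol: "g holomorphic_on V'"
  proof -
    have "G \<circ> (\<lambda>z. 1 + z) holomorphic_on V'"
      by (rule holomorphic_on_compose_gen[OF _ G(1)]) (auto simp: V'_def intro!: holomorphic_intros)
    then show ?thesis by (simp add: g_def comp_def)
  qed
  define q where "q = (\<lambda>z. if z = 0 then deriv g 0 else (g z - g 0) / z)"
  have qhol: "q holomorphic_on V'"
    unfolding q_def using V'0[of 0] by (intro holomorphic_difference_quotient ghol V'o) auto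
  have g0: "g 0 = 0" using G(2) by (simp add: g_def)
  \<comment> \<open>Compactness of this half disc gives a uniform margin to the left of the
    imaginary axis in which G (1 + z) is still holomorphic.\<close>
  define K0 where "K0 = {z. Re z \<ge> 0} \<inter> cball 0 (R + 1)"
  have "compact K0" unfolding K0_def by (intro closed_Int_compact compact_cball closed_halfspace_Re_ge)
  moreover have "K0 \<subseteq> V'" using V'0 by (auto simp: K0_def)
  ultimately obtain e where e: "e > 0" "(\<Union>x\<in>K0. ball x e) \<subseteq> V'"
    using compact_subset_open_imp_ball_epsilon_subset[of K0 V'] V'o by blast
  define \<delta>0 where "\<delta>0 = min 1 (e / 2)"
  have \<delta>0: "0 < \<delta>0" "\<delta>0 \<le> 1" "\<delta>0 < e" using e by (auto simp: \<delta>0_def min_def)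
  define S where "S = (\<lambda>\<delta>. {z. Re z \<ge> - \<delta>} \<inter> cball 0 (R + \<delta>))"
  have Sconv: "convex (S \<delta>)" "compact (S \<delta>)" for \<delta>
    unfolding S_def by (auto intro!: convex_Int convex_halfspace_Re_ge closed_Int_compact closed_halfspace_Re_ge)
  have SV: "S \<delta> \<subseteq> V'" if "\<delta> \<le> \<delta>0" for \<delta>
  proof
    fix z assume z: "z \<in> S \<delta>"
    define z' where "z' = Complex (max 0 (Re z)) (Im z)"
    have "cmod z' \<le> cmod z" unfolding z'_def cmod_def by (auto simp: max_def intro!: real_sqrt_le_mono)
    then have "z' \<in> K0" using z that \<delta>0 by (auto simp: K0_def S_def z'_def)
    moreover have "dist z' z < e"
    proof -
      have "z' - z = of_real (max 0 (Re z) - Re z)" by (simp add: z'_def complex_eq_iff)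
      then have "dist z' z = \<bar>max 0 (Re z) - Re z\<bar>" by (simp only: dist_norm norm_of_real)
      also have "\<dots> \<le> \<delta>0" using z that \<delta>0 by (auto simp: S_def max_def)
      finally show ?thesis using \<delta>0 by linarith
    qed
    ultimately have "z \<in> (\<Union>x\<in>K0. ball x e)" by (auto simp: mem_ball)
    then show "z \<in> V'" using e(2) by (rule subsetD[rotated])
  qed
  have "compact ((\<lambda>z. q z * (1 + z\<^sup>2 / of_real (R\<^sup>2))) ` S \<delta>0)"
    by (intro compact_continuous_image Sconv holomorphic_on_imp_continuous_on holomorphic_intros
        holomorphic_on_subset[OF qhol SV[OF order_refl]]) (use R in auto)
  then obtain C where C: "C > 0" "\<And>z. z \<in> S \<delta>0 \<Longrightarrow> cmod (q z * (1 + z\<^sup>2 / of_real (R\<^sup>2))) \<le> C"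
    using compact_imp_bounded bounded_pos by (metis (no_types, lifting) imageI)
  \<comment> \<open>\<open>C\<close> was obtained on the larger region and stays fixed while
    \<delta> shrinks, so the two short sides of length \<delta> cost at most \<epsilon> / 2
    each.\<close>
  define \<delta> where "\<delta> = min \<delta>0 (\<epsilon> / (2 * C))"
  have \<delta>: "0 < \<delta>" "\<delta> \<le> \<delta>0" "C * \<delta> \<le> \<epsilon> / 2" using \<delta>0 C \<epsilon> by (auto simp: \<delta>_def min_def field_simps)
  have SS: "S \<delta> \<subseteq> S \<delta>0" using \<delta> by (auto simp: S_def)
  have "((\<lambda>N. 2 * R * C * real N powr (- \<delta>)) \<longlongrightarrow> 0) sequentially"
    using \<delta>(1) by real_asymp
  then have "\<forall>\<^sub>F N in sequentially. 2 * R * C * real N powr (- \<delta>) < \<epsilon>"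
    using \<epsilon> by (rule order_tendstoD(2))
  moreover have "\<forall>\<^sub>F N in sequentially. real N \<ge> 2 * R" by real_asymp
  moreover have "\<forall>\<^sub>F N in sequentially. N \<ge> (1::nat)" by (rule eventually_ge_at_top)
  ultimately show ?thesis
  proof eventually_elim
    case (elim N)
    define SN where "SN = (\<lambda>z. \<Sum>k<N. a (Suc k) * of_nat (Suc k) powr (- 1 - z))"
    define Nz where "Nz = (\<lambda>z. of_nat N powr z :: complex)"
    have Nz: "cmod (Nz z) = real N powr Re z" for z by (simp add: Nz_def norm_of_nat_powr)
    define ker where "ker = (\<lambda>z::complex. 1 + z\<^sup>2 / of_real (R\<^sup>2))"
    define W where "W = (\<lambda>z. SN z * Nz z * ker z)"
    have SNhol: "SN holomorphic_on UNIV" unfolding SN_def by (intro holomorphic_intros)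
    have Nzhol: "Nz holomorphic_on X" for X unfolding Nz_def by (intro holomorphic_intros)
    have kerhol: "ker holomorphic_on X" for X unfolding ker_def using R by (intro holomorphic_intros) auto
    have Whol: "W holomorphic_on UNIV" unfolding W_def by (intro holomorphic_intros SNhol Nzhol kerhol)
    \<comment> \<open>\<open>SN\<close> is entire, so its contour may be closed by the left half
      circle. \<open>w\<close> is W z / z without its pole, hence entire; the two arcs of W 0 / z
      supply 2 * pi * i * W 0.\<close>
    define w where "w = (\<lambda>z. if z = 0 then deriv W 0 else (W z - W 0) / z)"
    have whol: "w holomorphic_on UNIV" unfolding w_def by (intro holomorphic_difference_quotient Whol) auto
    \<comment> \<open>The contribution of \<open>G\<close>, holomorphic at 0 thanks to
      \<open>q\<close>. Its integral along \<open>\<rho>\<close>, \<open>l1\<close>,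
      \<open>l2\<close>, \<open>l3\<close> is 0, which trades the right arc for three
      segments.\<close>
    define \<Phi> where "\<Phi> = (\<lambda>z. q z * Nz z * ker z)"
    have \<Phi>hol: "\<Phi> holomorphic_on S \<delta>" unfolding \<Phi>_def
      by (intro holomorphic_intros Nzhol kerhol holomorphic_on_subset[OF qhol SV[OF \<delta>(2)]])
    define \<rho> where "\<rho> = part_circlepath 0 R (- (pi / 2)) (pi / 2)"
    define l where "l = part_circlepath 0 R (pi / 2) (3 * pi / 2)"
    define c1 where "c1 = Complex (- \<delta>) R"
    define c2 where "c2 = Complex (- \<delta>) (- R)"
    define l1 where "l1 = linepath (\<i> * of_real R) c1"
    define l2 where "l2 = linepath c1 c2"
    define l3 where "l3 = linepath c2 (- \<i> * of_real R)"
    have exps: "exp (\<i> * of_real (pi / 2)) = \<i>" "exp (\<i> * of_real (- (pi / 2))) = - \<i>" "exp (\<i> * of_real (3 * pi / 2)) = - \<i>"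
    proof -
      have c: "exp (\<i> * of_real x) = cis x" for x by (simp add: cis_conv_exp)
      have "sin (3 * pi / 2) = - 1" "cos (3 * pi / 2) = 0"
        using sin_periodic_pi[of "pi / 2"] cos_periodic_pi[of "pi / 2"] by (simp_all add: field_simps)
      then show "exp (\<i> * of_real (pi / 2)) = \<i>" "exp (\<i> * of_real (- (pi / 2))) = - \<i>" "exp (\<i> * of_real (3 * pi / 2)) = - \<i>"
        unfolding c by (simp_all add: complex_eq_iff)
    qed
    have ends: "pathstart \<rho> = - \<i> * of_real R" "pathfinish \<rho> = \<i> * of_real R" "pathstart l = \<i> * of_real R" "pathfinish l = - \<i> * of_real R"
      unfolding \<rho>_def l_def pathstart_part_circlepath pathfinish_part_circlepath exps by simp_all
    have img: "cmod z = R" if "z \<in> path_image \<rho> \<or> z \<in> path_image l" for z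
      using that path_image_part_circlepath_subset'[of R 0 "- (pi / 2)" "pi / 2"] path_image_part_circlepath_subset'[of R 0 "pi / 2" "3 * pi / 2"] R
      by (auto simp: \<rho>_def l_def sphere_def)
    have imgr: "Re z \<ge> 0" if "z \<in> path_image \<rho>" for z
    proof -
      have seg: "closed_segment (- (pi / 2)) (pi / 2) = {- (pi / 2)..pi / 2}"
        by (rule closed_segment_eq_real_ivl1) simp
      have "z \<in> (\<lambda>x. 0 + of_real R * cis x) ` {- (pi / 2)..pi / 2}"
        using that by (simp only: \<rho>_def path_image_part_circlepath' seg)
      then obtain x where x: "x \<in> {- (pi / 2)..pi / 2}" "z = 0 + of_real R * cis x"
        by (rule imageE)
      then have "Re z = R * cos x" by simp
      then show ?thesis using R x cos_ge_zero[of x] by auto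
    qed
    have imgl: "Re z \<le> 0" if "z \<in> path_image l" for z
    proof -
      have seg: "closed_segment (pi / 2) (3 * pi / 2) = {pi / 2..3 * pi / 2}"
        by (rule closed_segment_eq_real_ivl1) simp
      have "z \<in> (\<lambda>x. 0 + of_real R * cis x) ` {pi / 2..3 * pi / 2}"
        using that by (simp only: l_def path_image_part_circlepath' seg)
      then obtain x where x: "x \<in> {pi / 2..3 * pi / 2}" "z = 0 + of_real R * cis x"
        by (rule imageE)
      then have "Re z = R * cos x" by simp
      moreover have "cos x \<le> 0"
      proof -
        have "cos x = - cos (x - pi)" by (simp add: cos_diff)
        moreover have "cos (x - pi) \<ge> 0" using x by (intro cos_ge_zero) auto
        ultimately show ?thesis by simp
      qed
      ultimately show ?thesis using R by (simp add: mult_nonneg_nonpos)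
    qed
    have \<rho>S: "path_image \<rho> \<subseteq> S \<delta>" using img imgr \<delta> by (fastforce simp: S_def)
    have corners: "\<i> * of_real R \<in> S \<delta>" "- \<i> * of_real R \<in> S \<delta>" "c1 \<in> S \<delta>" "c2 \<in> S \<delta>"
    proof -
      have "sqrt (\<delta>\<^sup>2 + R\<^sup>2) \<le> R + \<delta>" using sqrt_sum_squares_le_sum[of \<delta> R] \<delta> R by simp
      then show "\<i> * of_real R \<in> S \<delta>" "- \<i> * of_real R \<in> S \<delta>" "c1 \<in> S \<delta>" "c2 \<in> S \<delta>"
        using \<delta> R by (auto simp: S_def c1_def c2_def norm_mult cmod_def)
    qed
    have lS: "path_image l1 \<subseteq> S \<delta>" "path_image l2 \<subseteq> S \<delta>" "path_image l3 \<subseteq> S \<delta>"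
      unfolding l1_def l2_def l3_def path_image_linepath
      using corners Sconv(1) by (auto intro: closed_segment_subset[THEN subsetD])
    have vp: "valid_path \<rho>" "valid_path l" "valid_path l1" "valid_path l2" "valid_path l3"
      by (auto simp: \<rho>_def l_def l1_def l2_def l3_def)
    have cint: "f contour_integrable_on \<rho>" if "continuous_on (path_image \<rho>) f" for f
      using that unfolding \<rho>_def by (rule contour_integrable_continuous_part_circlepath)
    have cintl: "f contour_integrable_on l" if "continuous_on (path_image l) f" for f
      using that unfolding l_def by (rule contour_integrable_continuous_part_circlepath)
    have \<Phi>cont: "continuous_on X \<Phi>" if "X \<subseteq> S \<delta>" for X
      using \<Phi>hol that holomorphic_on_imp_continuous_on continuous_on_subset by blast
    have i\<Phi>: "\<Phi> contour_integrable_on \<rho>" "\<Phi> contour_integrable_on l1" "\<Phi> contour_integrable_on l2" "\<Phi> contour_integrable_on l3"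
      using \<rho>S lS by (auto intro!: cint \<Phi>cont contour_integrable_continuous_linepath simp: l1_def l2_def l3_def)
    have sum\<Phi>: "contour_integral \<rho> \<Phi> + (contour_integral l1 \<Phi> + (contour_integral l2 \<Phi> + contour_integral l3 \<Phi>)) = 0"
    proof -
      define \<Gamma> where "\<Gamma> = \<rho> +++ l1 +++ l2 +++ l3"
      have "(\<Phi> has_contour_integral 0) \<Gamma>"
      proof (rule Cauchy_theorem_convex_simple[OF \<Phi>hol Sconv(1)])
        show "valid_path \<Gamma>" unfolding \<Gamma>_def
          by (intro valid_path_join vp) (simp_all add: ends l1_def l2_def l3_def)
        show "path_image \<Gamma> \<subseteq> S \<delta>" unfolding \<Gamma>_def
          by (intro subset_path_image_join \<rho>S lS)
        show "pathfinish \<Gamma> = pathstart \<Gamma>" unfolding \<Gamma>_def by (simp add: ends l3_def)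
      qed
      then have "contour_integral \<Gamma> \<Phi> = 0" by (rule contour_integral_unique)
      moreover have "contour_integral \<Gamma> \<Phi> = contour_integral \<rho> \<Phi> + (contour_integral l1 \<Phi> + (contour_integral l2 \<Phi> + contour_integral l3 \<Phi>))"
        unfolding \<Gamma>_def using i\<Phi> vp
        by (simp add: contour_integral_join contour_integrable_joinI valid_path_join l1_def l2_def l3_def)
      ultimately show ?thesis by simp
    qed
    have wcont: "continuous_on X w" for X
      using whol holomorphic_on_imp_continuous_on continuous_on_subset by blast
    have sumw: "contour_integral \<rho> w + contour_integral l w = 0"
    proof -
      have "(w has_contour_integral 0) (\<rho> +++ l)"
        by (rule Cauchy_theorem_convex_simple[OF whol]) (auto intro!: valid_path_join vp simp: ends)
      then have "contour_integral (\<rho> +++ l) w = 0" by (rule contour_integral_unique)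
      then show ?thesis using vp cint[OF wcont] cintl[OF wcont] by (simp add: contour_integral_join)
    qed
    have z0: "z \<noteq> 0" if "cmod z = R" for z using that R by auto
    have wW: "W z / z = w z + W 0 / z" if "z \<noteq> 0" for z
      using that by (simp add: w_def diff_divide_distrib)
    have h\<rho>: "((\<lambda>z. W z / z) has_contour_integral (contour_integral \<rho> w + W 0 * (\<i> * of_real pi))) \<rho>"
    proof -
      have "((\<lambda>z. w z + W 0 / z) has_contour_integral (contour_integral \<rho> w + W 0 * (\<i> * of_real (pi / 2 - - (pi / 2))))) \<rho>"
        unfolding \<rho>_def
        by (intro has_contour_integral_add has_contour_integral_integral contour_integral_inverse_arc R cint[unfolded \<rho>_def] wcont) simp
      then have "((\<lambda>z. w z + W 0 / z) has_contour_integral (contour_integral \<rho> w + W 0 * (\<i> * of_real pi))) \<rho>" by simp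
      then show ?thesis by (rule has_contour_integral_eq) (use wW z0 img in auto)
    qed
    have hl: "((\<lambda>z. W z / z) has_contour_integral (contour_integral l w + W 0 * (\<i> * of_real pi))) l"
    proof -
      have "((\<lambda>z. w z + W 0 / z) has_contour_integral (contour_integral l w + W 0 * (\<i> * of_real (3 * pi / 2 - pi / 2)))) l"
        unfolding l_def
        by (intro has_contour_integral_add has_contour_integral_integral contour_integral_inverse_arc R cintl[unfolded l_def] wcont) simp
      then have "((\<lambda>z. w z + W 0 / z) has_contour_integral (contour_integral l w + W 0 * (\<i> * of_real pi))) l" by simp
      then show ?thesis by (rule has_contour_integral_eq) (use wW z0 img in auto)
    qed
    \<comment> \<open>With x = Re z, the tail beyond \<open>N\<close> is at most A * N^(- x) / x;
      the factor N^x and the kernel 2 * x / R^2 cancel all dependence on z.\<close>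
    have bound\<rho>: "cmod (W z / z - \<Phi> z) \<le> 2 * A / R\<^sup>2" if z: "z \<in> path_image \<rho>" for z
    proof -
      have zR: "cmod z = R" using img z by blast
      have "W z / z - \<Phi> z = (SN z - g z) * Nz z * (ker z / z)"
        using z0[OF zR] by (simp add: W_def \<Phi>_def q_def g0 field_simps)
      also have "ker z / z = of_real (2 * Re z / R\<^sup>2)" unfolding ker_def by (rule arc_kernel[OF zR R])
      finally have eqz: "cmod (W z / z - \<Phi> z) = cmod (SN z - g z) * real N powr Re z * \<bar>2 * Re z / R\<^sup>2\<bar>"
        by (simp only: norm_mult Nz norm_of_real)
      show ?thesis
      proof (cases "Re z = 0")
        case True
        then show ?thesis unfolding eqz using A0 R by simp
      next
        case False
        then have x: "Re z > 0" using imgr[OF z] by simp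
        define x where "x = Re z"
        have x0: "x > 0" using x by (simp add: x_def)
        have sums: "(\<lambda>k. a (Suc k) * of_nat (Suc k) powr (- 1 - z)) sums g z"
          using dirichlet_series_sums[of a A "1 + z"] a eq[of "1 + z"] x by (simp add: g_def algebra_simps)
        let ?f = "\<lambda>k. a (Suc k) * of_nat (Suc k) powr (- 1 - z)"
        have tail: "g z - SN z = (\<Sum>k. ?f (k + N))"
          using suminf_minus_initial_segment[of ?f N] sums by (simp add: sums_iff SN_def)
        have nb: "cmod (?f (k + N)) \<le> A * real (k + Suc N) powr (- 1 - x)" for k
          unfolding norm_mult norm_of_nat_powr using a[of "Suc (k + N)"] by (simp add: x_def mult_right_mono del: of_nat_Suc)
        have s2: "summable (\<lambda>k. A * real (k + Suc N) powr (- 1 - x))"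
          by (intro summable_mult suminf_powr_tail_le(1) x0 elim)
        have "cmod (SN z - g z) = cmod (\<Sum>k. ?f (k + N))" using tail by (metis norm_minus_commute)
        also have "\<dots> \<le> (\<Sum>k. A * real (k + Suc N) powr (- 1 - x))"
          by (rule norm_suminf_le[OF nb s2])
        also have "\<dots> = A * (\<Sum>k. real (k + Suc N) powr (- 1 - x))"
          by (intro suminf_mult suminf_powr_tail_le(1) x0 elim)
        also have "\<dots> \<le> A * (real N powr (- x) / x)"
          using A0 by (intro mult_left_mono suminf_powr_tail_le(2) x0 elim)
        finally have "cmod (SN z - g z) * real N powr x * \<bar>2 * x / R\<^sup>2\<bar> \<le> A * (real N powr (- x) / x) * real N powr x * \<bar>2 * x / R\<^sup>2\<bar>"
          by (intro mult_right_mono) auto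
        also have "\<dots> = 2 * A / R\<^sup>2 * (real N powr (- x) * real N powr x)"
          using x0 R by (simp add: field_simps)
        also have "real N powr (- x) * real N powr x = 1"
          using elim(3) by (simp add: powr_add[symmetric])
        finally show ?thesis unfolding eqz x_def by simp
      qed
    qed
    \<comment> \<open>On the left arc the partial sum itself is estimated; the factor 2 lost in
      \<open>sum_powr_le\<close> doubles the constant.\<close>
    have boundl: "cmod (W z / z) \<le> 4 * A / R\<^sup>2" if z: "z \<in> path_image l" for z
    proof -
      have zR: "cmod z = R" using img z by blast
      have "W z / z = SN z * Nz z * (ker z / z)" by (simp add: W_def)
      also have "ker z / z = of_real (2 * Re z / R\<^sup>2)" unfolding ker_def by (rule arc_kernel[OF zR R])
      finally have eqz: "cmod (W z / z) = cmod (SN z) * real N powr Re z * \<bar>2 * Re z / R\<^sup>2\<bar>"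
        by (simp only: norm_mult Nz norm_of_real)
      show ?thesis
      proof (cases "Re z = 0")
        case True
        then show ?thesis unfolding eqz using A0 R by simp
      next
        case False
        define y where "y = - Re z"
        have y: "y > 0" using imgl[OF z] False by (simp add: y_def)
        have yR: "y \<le> R" using abs_Re_le_cmod[of z] zR by (simp add: y_def)
        have "cmod (SN z) \<le> (\<Sum>k<N. A * real (Suc k) powr (y - 1))"
          unfolding SN_def
        proof (rule sum_norm_le)
          fix k
          have re: "Re (- 1 - z) = y - 1" by (simp add: y_def)
          show "cmod (a (Suc k) * of_nat (Suc k) powr (- 1 - z)) \<le> A * real (Suc k) powr (y - 1)"
            unfolding norm_mult norm_of_nat_powr re by (intro mult_right_mono a) simp
        qed
        also have "\<dots> = A * (\<Sum>k<N. real (Suc k) powr (y - 1))" by (simp only: sum_distrib_left)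
        also have "\<dots> \<le> A * (2 * (real N powr y / y))"
          using A0 by (intro mult_left_mono sum_powr_le[OF y yR] elim)
        finally have "cmod (SN z) * real N powr (- y) * \<bar>2 * Re z / R\<^sup>2\<bar> \<le> A * (2 * (real N powr y / y)) * real N powr (- y) * \<bar>2 * Re z / R\<^sup>2\<bar>"
          by (intro mult_right_mono) auto
        also have "\<bar>2 * Re z / R\<^sup>2\<bar> = 2 * y / R\<^sup>2"
        proof -
          have "2 * Re z / R\<^sup>2 = - (2 * y / R\<^sup>2)" by (simp add: y_def)
          moreover have "0 \<le> 2 * y / R\<^sup>2" using y by simp
          ultimately show ?thesis by (simp only: abs_minus_cancel abs_of_nonneg)
        qed
        also have "A * (2 * (real N powr y / y)) * real N powr (- y) * (2 * y / R\<^sup>2) = 4 * A / R\<^sup>2 * (real N powr y * real N powr (- y))"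
          using y R by (simp add: field_simps)
        also have "real N powr y * real N powr (- y) = 1"
          using elim(3) by (simp add: powr_add[symmetric])
        finally show ?thesis unfolding eqz y_def using y by (simp add: y_def)
      qed
    qed
    have I1: "cmod (contour_integral \<rho> (\<lambda>z. W z / z) - contour_integral \<rho> \<Phi>) \<le> 2 * A / R\<^sup>2 * R * pi"
    proof -
      have "((\<lambda>z. W z / z - \<Phi> z) has_contour_integral (contour_integral \<rho> (\<lambda>z. W z / z) - contour_integral \<rho> \<Phi>)) \<rho>"
        using h\<rho> i\<Phi>(1) by (intro has_contour_integral_diff has_contour_integral_integral) (auto simp: contour_integrable_on_def)
      then have "cmod (contour_integral \<rho> (\<lambda>z. W z / z) - contour_integral \<rho> \<Phi>) \<le> 2 * A / R\<^sup>2 * R * (pi / 2 - - (pi / 2))"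
        unfolding \<rho>_def
        by (rule has_contour_integral_bound_part_circlepath) (use A0 R bound\<rho> in \<open>auto simp: \<rho>_def\<close>)
      then show ?thesis by simp
    qed
    have I2: "cmod (contour_integral l (\<lambda>z. W z / z)) \<le> 4 * A / R\<^sup>2 * R * pi"
    proof -
      have "((\<lambda>z. W z / z) has_contour_integral (contour_integral l (\<lambda>z. W z / z))) l"
        using hl by (intro has_contour_integral_integral) (auto simp: contour_integrable_on_def)
      then have "cmod (contour_integral l (\<lambda>z. W z / z)) \<le> 4 * A / R\<^sup>2 * R * (3 * pi / 2 - pi / 2)"
        unfolding l_def
        by (rule has_contour_integral_bound_part_circlepath) (use A0 R boundl in \<open>auto simp: l_def\<close>)
      then show ?thesis by simp
    qed
    have \<Phi>b: "cmod (\<Phi> z) \<le> C * real N powr Re z" if "z \<in> S \<delta>" for z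
    proof -
      have "cmod (\<Phi> z) = cmod (q z * (1 + z\<^sup>2 / of_real (R\<^sup>2))) * real N powr Re z"
        unfolding \<Phi>_def ker_def norm_mult Nz by simp
      also have "\<dots> \<le> C * real N powr Re z" using C(2) SS that by (intro mult_right_mono) auto
      finally show ?thesis .
    qed
    have horiz: "cmod (contour_integral (linepath u v) \<Phi>) \<le> C * \<delta>"
      if uv: "closed_segment u v \<subseteq> S \<delta>" "Re u \<le> 0" "Re v \<le> 0" "cmod (v - u) = \<delta>" "\<Phi> contour_integrable_on linepath u v" for u v
    proof -
      have "cmod (\<Phi> z) \<le> C" if "z \<in> closed_segment u v" for z
      proof -
        have "Re z \<le> 0"
        proof -
          have "closed_segment u v \<subseteq> {z. Re z \<le> 0}"
            using uv by (intro closed_segment_subset convex_halfspace_Re_le) auto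
          then show ?thesis using that by blast
        qed
        then have "real N powr Re z \<le> 1" using elim(3) powr_mono[of "Re z" 0 "real N"] by simp
        then have "C * real N powr Re z \<le> C * 1" using C(1) by (intro mult_left_mono) auto
        then show ?thesis using \<Phi>b uv(1) that by fastforce
      qed
      then have "cmod (contour_integral (linepath u v) \<Phi>) \<le> C * cmod (v - u)"
        using C(1) by (intro has_contour_integral_bound_linepath[OF has_contour_integral_integral[OF uv(5)]]) auto
      then show ?thesis using uv(4) by simp
    qed
    have J1: "cmod (contour_integral l1 \<Phi>) \<le> C * \<delta>"
      unfolding l1_def
    proof (rule horiz)
      have "c1 - \<i> * of_real R = of_real (- \<delta>)" by (simp add: c1_def complex_eq_iff)
      then show "cmod (c1 - \<i> * of_real R) = \<delta>" using \<delta> by simp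
    qed (use lS i\<Phi> \<delta> in \<open>auto simp: l1_def c1_def\<close>)
    have J3: "cmod (contour_integral l3 \<Phi>) \<le> C * \<delta>"
      unfolding l3_def
    proof (rule horiz)
      have "- \<i> * of_real R - c2 = of_real \<delta>" by (simp add: c2_def complex_eq_iff)
      then show "cmod (- \<i> * of_real R - c2) = \<delta>" using \<delta> by simp
    qed (use lS i\<Phi> \<delta> in \<open>auto simp: l3_def c2_def\<close>)
    have J2: "cmod (contour_integral l2 \<Phi>) \<le> 2 * R * C * real N powr (- \<delta>)"
    proof -
      have "cmod (\<Phi> z) \<le> C * real N powr (- \<delta>)" if "z \<in> closed_segment c1 c2" for z
      proof -
        have "closed_segment c1 c2 \<subseteq> {z. Re z \<le> - \<delta>} \<inter> {z. Re z \<ge> - \<delta>}"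
          by (intro closed_segment_subset convex_Int convex_halfspace_Re_le convex_halfspace_Re_ge) (auto simp: c1_def c2_def)
        then have "Re z = - \<delta>" using that by force
        moreover have "z \<in> S \<delta>" using that lS(2) by (auto simp: l2_def)
        ultimately show ?thesis using \<Phi>b[of z] by simp
      qed
      then have "cmod (contour_integral l2 \<Phi>) \<le> C * real N powr (- \<delta>) * cmod (c2 - c1)"
        unfolding l2_def using C(1) i\<Phi>(3)
        by (intro has_contour_integral_bound_linepath[OF has_contour_integral_integral]) (auto simp: l2_def)
      also have "c2 - c1 = - (\<i> * of_real (2 * R))" by (simp add: c1_def c2_def complex_eq_iff)
      then have "cmod (c2 - c1) = 2 * R" using R by (simp add: norm_mult)
      finally show ?thesis by (simp add: mult_ac)
    qed
    have "W 0 * (2 * \<i> * of_real pi) = (contour_integral \<rho> w + W 0 * (\<i> * of_real pi)) + (contour_integral l w + W 0 * (\<i> * of_real pi)) - (contour_integral \<rho> w + contour_integral l w)"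
      by (simp add: algebra_simps)
    also have "\<dots> = contour_integral \<rho> (\<lambda>z. W z / z) + contour_integral l (\<lambda>z. W z / z)"
      using contour_integral_unique[OF h\<rho>] contour_integral_unique[OF hl] sumw by simp
    also have "\<dots> = (contour_integral \<rho> (\<lambda>z. W z / z) - contour_integral \<rho> \<Phi>) + contour_integral l (\<lambda>z. W z / z)
        - (contour_integral l1 \<Phi> + (contour_integral l2 \<Phi> + contour_integral l3 \<Phi>))"
      using sum\<Phi> by (simp add: algebra_simps)
    finally have key: "W 0 * (2 * \<i> * of_real pi) = \<dots>" .
    have tri: "cmod (u + v - (x + (y + z))) \<le> cmod u + cmod v + (cmod x + (cmod y + cmod z))" for u v x y z :: complex
      using norm_triangle_ineq4[of "u + v" "x + (y + z)"] norm_triangle_ineq[of u v] norm_triangle_ineq[of x "y + z"] norm_triangle_ineq[of y z]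
      by linarith
    have "cmod (W 0) * (2 * pi) = cmod (W 0 * (2 * \<i> * of_real pi))" by (simp add: norm_mult)
    also have "\<dots> \<le> cmod (contour_integral \<rho> (\<lambda>z. W z / z) - contour_integral \<rho> \<Phi>) + cmod (contour_integral l (\<lambda>z. W z / z))
        + (cmod (contour_integral l1 \<Phi>) + (cmod (contour_integral l2 \<Phi>) + cmod (contour_integral l3 \<Phi>)))"
      unfolding key by (rule tri)
    \<comment> \<open>The right arc gives 2 and the left arc 4, each times A * pi / R; division by 2
      * pi leaves 3 * A / R.\<close>
    also have "\<dots> \<le> 2 * A / R\<^sup>2 * R * pi + 4 * A / R\<^sup>2 * R * pi + (C * \<delta> + (\<epsilon> + C * \<delta>))"
      using I1 I2 J1 J2 J3 elim(1) by linarith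
    also have "\<dots> \<le> 6 * A / R * pi + 2 * \<epsilon>"
    proof -
      have "2 * A / R\<^sup>2 * R * pi + 4 * A / R\<^sup>2 * R * pi = 6 * A / R * pi" using R by (simp add: power2_eq_square field_simps)
      then show ?thesis using \<delta>(3) by linarith
    qed
    also have "\<dots> \<le> (3 * A / R + \<epsilon>) * (2 * pi)"
    proof -
      have "2 * \<epsilon> \<le> \<epsilon> * (2 * pi)" using pi_ge_two \<epsilon> by simp
      then show ?thesis by (simp add: algebra_simps)
    qed
    finally have "cmod (W 0) \<le> 3 * A / R + \<epsilon>" using pi_gt_zero by simp
    moreover have "W 0 = (\<Sum>k<N. a (Suc k) / of_nat (Suc k))"
    proof -
      have "(of_nat (Suc k) :: complex) powr (- 1) = inverse (of_nat (Suc k))" for k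
        by (simp add: powr_minus del: of_nat_Suc)
      then show ?thesis using elim(3) by (simp add: W_def SN_def Nz_def ker_def divide_inverse del: of_nat_Suc)
    qed
    ultimately show ?case by simp
  qed
qed

lemma newman_tauberian:
  fixes a :: "nat \<Rightarrow> complex"
  assumes a: "\<And>n. cmod (a n) \<le> A" and V: "open V" "{s. Re s \<ge> 1} \<subseteq> V" and G: "G holomorphic_on V" "G 1 = 0"
    and eq: "\<And>s. Re s > 1 \<Longrightarrow> G s = dirichlet_series a s"
  shows "(\<lambda>N. \<Sum>k<N. a (Suc k) / of_nat (Suc k)) \<longlonglongrightarrow> 0"
proof (rule tendstoI)
  fix \<epsilon> :: real assume \<epsilon>: "\<epsilon> > 0"
  have A0: "A \<ge> 0" using order_trans[OF norm_ge_zero a[of 0]] .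
  define R where "R = 6 * (A + 1) / \<epsilon>"
  have R: "R > 0" using \<epsilon> A0 by (simp add: R_def)
  have "3 * A / R < \<epsilon> / 2"
    using \<epsilon> A0 by (simp add: R_def field_simps)
  then have "3 * A / R + \<epsilon> / 4 < \<epsilon>" using \<epsilon> by linarith
  moreover have "\<forall>\<^sub>F N in sequentially. cmod (\<Sum>k<N. a (Suc k) / of_nat (Suc k)) \<le> 3 * A / R + \<epsilon> / 4"
    using \<epsilon> by (intro newman_bound[OF a V G eq R]) auto
  ultimately show "\<forall>\<^sub>F N in sequentially. dist (\<Sum>k<N. a (Suc k) / of_nat (Suc k)) 0 < \<epsilon>"
    by (auto elim!: eventually_mono)
qed

section \<open>Moebius sums of periodic functions\<close>

lemma sublinear_add:
  assumes "sublinear S" "sublinear T"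
  shows "sublinear (\<lambda>N. S N + T N)"
proof (rule sublinearI)
  fix \<epsilon> :: real assume "\<epsilon> > 0"
  then have "\<epsilon> / 2 > 0" by simp
  from sublinearD[OF assms(1) this] sublinearD[OF assms(2) this]
  show "\<forall>\<^sub>F N in sequentially. cmod (S N + T N) \<le> \<epsilon> * real N"
  proof eventually_elim
    case (elim N)
    then show ?case using norm_triangle_ineq[of "S N" "T N"] by simp
  qed
qed

lemma sublinear_cmult:
  assumes "sublinear S"
  shows "sublinear (\<lambda>N. c * S N)"
proof (rule sublinearI)
  fix \<epsilon> :: real assume "\<epsilon> > 0"
  then have "\<epsilon> / (cmod c + 1) > 0" by (simp add: add_nonneg_pos)
  from sublinearD[OF assms this]
  show "\<forall>\<^sub>F N in sequentially. cmod (c * S N) \<le> \<epsilon> * real N"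
  proof eventually_elim
    case (elim N)
    have "cmod (c * S N) \<le> (cmod c + 1) * cmod (S N)" by (simp add: norm_mult mult_right_mono)
    also have "\<dots> \<le> (cmod c + 1) * (\<epsilon> / (cmod c + 1) * real N)" using elim by (intro mult_left_mono) auto
    also have "\<dots> = \<epsilon> * real N"
    proof -
      have "1 + cmod c \<noteq> 0" using norm_ge_zero[of c] by linarith
      then show ?thesis by (simp add: field_simps)
    qed
    finally show ?case .
  qed
qed

lemma sublinear_0: "sublinear (\<lambda>_. 0)"
  by (rule sublinearI) simp

lemma sublinear_sum:
  assumes "\<And>i. i \<in> I \<Longrightarrow> sublinear (S i)"
  shows "sublinear (\<lambda>N. \<Sum>i\<in>I. S i N)"
proof (cases "finite I")
  case True
  then show ?thesis using assms
    by (induction I rule: finite_induct) (auto intro: sublinear_0 sublinear_add)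
qed (simp add: sublinear_0)

lemma sublinear_compose_le:
  assumes S: "sublinear S" and h: "\<And>N. h N \<le> N"
  shows "sublinear (\<lambda>N. S (h N))"
proof (rule sublinearI)
  fix \<epsilon> :: real assume \<epsilon>: "\<epsilon> > 0"
  obtain N0 where N0: "\<And>N. N \<ge> N0 \<Longrightarrow> cmod (S N) \<le> \<epsilon> * real N"
    using sublinearD[OF S \<epsilon>] by (auto simp: eventually_sequentially)
  define C where "C = (\<Sum>n<N0. cmod (S n))"
  have "\<forall>\<^sub>F N in sequentially. C / \<epsilon> \<le> real N" by real_asymp
  then show "\<forall>\<^sub>F N in sequentially. cmod (S (h N)) \<le> \<epsilon> * real N"
  proof eventually_elim
    case (elim N)
    show ?case
    proof (cases "h N \<ge> N0")
      case True
      have "cmod (S (h N)) \<le> \<epsilon> * real (h N)" using N0[OF True] .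
      also have "\<dots> \<le> \<epsilon> * real N" using h[of N] \<epsilon> by simp
      finally show ?thesis .
    next
      case False
      then have "cmod (S (h N)) \<le> C" unfolding C_def by (intro member_le_sum) auto
      also have "\<dots> \<le> \<epsilon> * real N" using elim \<epsilon> by (simp add: field_simps)
      finally show ?thesis .
    qed
  qed
qed

text \<open>By partial summation the sum is N * T N minus the sum of T k over k < N; as
  \<open>T\<close> tends to 0, so do its Cesaro means.\<close>

lemma sublinear_sum_if_weighted_tendsto_0:
  assumes a: "(\<lambda>N. \<Sum>k<N. a (Suc k) / of_nat (Suc k)) \<longlonglongrightarrow> (0::complex)"
  shows "sublinear (\<lambda>N. \<Sum>n<N. a n)"
proof (rule sublinearI)
  fix \<epsilon> :: real assume \<epsilon>: "\<epsilon> > 0"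
  define T where "T = (\<lambda>N. \<Sum>k<N. a (Suc k) / of_nat (Suc k))"
  have abel: "(\<Sum>k<N. a (Suc k)) = of_nat N * T N - (\<Sum>k<N. T k)" for N
  proof (induction N)
    case (Suc N)
    have "of_nat (Suc N) * T (Suc N) = of_nat (Suc N) * T N + a (Suc N)"
      by (simp add: T_def distrib_left del: of_nat_Suc)
    then show ?case using Suc by (simp add: algebra_simps)
  qed simp
  obtain N0 where N0: "\<And>n. n \<ge> N0 \<Longrightarrow> cmod (T n) < \<epsilon> / 4"
    using LIMSEQ_D[OF a, of "\<epsilon> / 4"] \<epsilon> by (auto simp: T_def)
  define C where "C = (\<Sum>k<N0. cmod (T k))"
  have bound: "cmod (\<Sum>k<N. a (Suc k)) \<le> real N * (\<epsilon> / 2) + C" if N: "N \<ge> N0" for N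
  proof -
    have "cmod (\<Sum>k<N. T k) \<le> (\<Sum>k<N. (if k < N0 then cmod (T k) else 0) + \<epsilon> / 4)"
      using N0 \<epsilon> by (intro sum_norm_le) (auto simp: not_less less_imp_le)
    also have "\<dots> = C + real N * (\<epsilon> / 4)"
    proof -
      have "(\<Sum>k<N. if k < N0 then cmod (T k) else 0) = C"
        unfolding C_def using N by (intro sum.mono_neutral_cong_right) auto
      then show ?thesis by (simp add: sum.distrib)
    qed
    finally have 1: "cmod (\<Sum>k<N. T k) \<le> C + real N * (\<epsilon> / 4)" .
    have "cmod (of_nat N * T N) \<le> real N * (\<epsilon> / 4)"
      unfolding norm_mult norm_of_nat by (intro mult_left_mono less_imp_le[OF N0[OF N]]) simp
    then show ?thesis
      unfolding abel using norm_triangle_ineq4[of "of_nat N * T N" "\<Sum>k<N. T k"] 1 by (simp add: field_simps)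
  qed
  have "\<forall>\<^sub>F N in sequentially. real N \<ge> 2 * (C + cmod (a 0)) / \<epsilon>" by real_asymp
  moreover have "\<forall>\<^sub>F N in sequentially. N \<ge> Suc N0" by (rule eventually_ge_at_top)
  ultimately show "\<forall>\<^sub>F N in sequentially. cmod (\<Sum>n<N. a n) \<le> \<epsilon> * real N"
  proof eventually_elim
    case (elim N)
    then obtain N' where N': "N = Suc N'" "N' \<ge> N0" by (cases N) auto
    have "cmod (\<Sum>n<N. a n) \<le> cmod (a 0) + cmod (\<Sum>k<N'. a (Suc k))"
      unfolding N'(1) sum.lessThan_Suc_shift by (rule norm_triangle_ineq)
    also have "\<dots> \<le> cmod (a 0) + (real N' * (\<epsilon> / 2) + C)" using bound[OF N'(2)] by simp
    also have "real N' * (\<epsilon> / 2) \<le> real N * (\<epsilon> / 2)" using N' \<epsilon> by (intro mult_right_mono) auto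
    also have "cmod (a 0) + (real N * (\<epsilon> / 2) + C) \<le> \<epsilon> * real N"
      using elim(1) \<epsilon> by (simp add: field_simps)
    finally show ?case by simp
  qed
qed

text \<open>The normalisation \<open>G 1 = 0\<close> is reached by changing the single coefficient
  at n = 1, which alters \<open>G\<close> by a constant and the partial sums by a bounded
  amount.\<close>

lemma sublinear_sum_if_continuation:
  assumes a: "\<And>n. cmod (a n) \<le> A" and V: "open V" "{s. Re s \<ge> 1} \<subseteq> V" and G: "G holomorphic_on V"
    and eq: "\<And>s. Re s > 1 \<Longrightarrow> G s = dirichlet_series a s"
  shows "sublinear (\<lambda>N. \<Sum>n<N. a n)"
proof -
  define c where "c = G 1"
  define \<delta> where "\<delta> = (\<lambda>n::nat. if n = 1 then c else 0)"
  define a' where "a' = (\<lambda>n. a n - \<delta> n)"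
  have a': "cmod (a' n) \<le> A + cmod c" for n
    using norm_triangle_ineq4[of "a n" "\<delta> n"] a[of n] unfolding a'_def \<delta>_def by (auto split: if_splits intro: add_increasing2)
  have ser: "dirichlet_series a' s = G s - c" if s: "Re s > 1" for s
  proof -
    have "(\<lambda>k. a (Suc k) * of_nat (Suc k) powr (- s) - (if k = 0 then c else 0)) sums (dirichlet_series a s - c)"
      by (intro sums_diff dirichlet_series_sums[OF a s] sums_single)
    moreover have "a (Suc k) * of_nat (Suc k) powr (- s) - (if k = 0 then c else 0) = a' (Suc k) * of_nat (Suc k) powr (- s)" for k
      by (simp add: a'_def \<delta>_def algebra_simps)
    ultimately have "(\<lambda>k. a' (Suc k) * of_nat (Suc k) powr (- s)) sums (dirichlet_series a s - c)" by simp
    then have "dirichlet_series a' s = dirichlet_series a s - c"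
      using dirichlet_series_sums[of a' "A + cmod c" s] a' s sums_unique2 by blast
    then show ?thesis using eq[OF s] by simp
  qed
  have "(\<lambda>N. \<Sum>k<N. a' (Suc k) / of_nat (Suc k)) \<longlonglongrightarrow> 0"
    by (rule newman_tauberian[of a' "A + cmod c" V "\<lambda>s. G s - c"])
      (use a' V G ser in \<open>auto intro!: holomorphic_intros simp: c_def\<close>)
  then have 1: "sublinear (\<lambda>N. \<Sum>n<N. a' n)" by (rule sublinear_sum_if_weighted_tendsto_0)
  have 2: "sublinear (\<lambda>N. \<Sum>n<N. \<delta> n)"
  proof (rule sublinearI)
    fix \<epsilon> :: real assume \<epsilon>: "\<epsilon> > 0"
    have "\<forall>\<^sub>F N in sequentially. cmod c \<le> \<epsilon> * real N" using \<epsilon> by real_asymp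
    then show "\<forall>\<^sub>F N in sequentially. cmod (\<Sum>n<N. \<delta> n) \<le> \<epsilon> * real N"
    proof eventually_elim
      case (elim N)
      have "(\<Sum>n<N. \<delta> n) = (if 1 < N then c else 0)" by (simp add: \<delta>_def sum.delta)
      then show ?case using elim \<epsilon> by auto
    qed
  qed
  have "(\<lambda>N. \<Sum>n<N. a n) = (\<lambda>N. (\<Sum>n<N. a' n) + (\<Sum>n<N. \<delta> n))"
    by (simp add: a'_def sum_subtractf)
  then show ?thesis using sublinear_add[OF 1 2] by simp
qed

lemma sublinear_moebius_char:
  assumes \<theta>: "dirichlet_char M \<theta>"
  shows "sublinear (\<lambda>N. \<Sum>n<N. of_int (moebius_mu n) * \<theta> n)"
proof -
  let ?a = "\<lambda>n. of_int (moebius_mu n) * \<theta> n"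
  let ?c = "char_mean M \<theta>"
  have a: "cmod (?a n) \<le> 1" for n
    unfolding norm_mult by (intro mult_le_one cmod_moebius_mu_le cmod_dirichlet_char_le[OF \<theta>]) auto
  define H where "H = {s::complex. Re s > 0}"
  have Ho: "open H" by (simp add: H_def open_halfspace_Re_gt)
  have inv: "dirichlet_series ?a s * L_function M \<theta> s = 1" if s: "Re s > 1" for s
  proof -
    have "infsum (\<lambda>n. of_int (moebius_mu n) * (\<theta> n * of_nat n powr (- s))) UNIV * infsum (\<lambda>n. \<theta> n * of_nat n powr (- s)) UNIV = 1"
      using s by (intro infsum_moebius_mult_infsum completely_multiplicative_dirichlet[OF \<theta>] norm_dirichlet_summable[of _ 1]) (auto intro: cmod_dirichlet_char_le[OF \<theta>])
    then show ?thesis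
      unfolding dirichlet_series_eq_L_function[OF \<theta> s, symmetric] dirichlet_series_def by (simp add: mult.assoc)
  qed
  have nz: "L_function M \<theta> s \<noteq> 0" if "Re s \<ge> 1" "s \<noteq> 1 \<or> ?c = 0" for s
  proof (cases "Re s = 1")
    case False
    then show ?thesis using inv[of s] that by auto
  qed (use L_function_nonzero[OF \<theta>] that in auto)
  show ?thesis
  proof (cases "?c = 0")
    case True
    have L: "L_function M \<theta> holomorphic_on H" unfolding H_def by (rule L_function_holomorphic(2)[OF \<theta> True])
    define V where "V = H \<inter> L_function M \<theta> -` (- {0})"
    have "open V" unfolding V_def
      by (rule continuous_open_preimage[OF holomorphic_on_imp_continuous_on[OF L] Ho]) auto
    moreover have "{s. Re s \<ge> 1} \<subseteq> V" using nz True by (auto simp: V_def H_def)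
    moreover have "(\<lambda>s. 1 / L_function M \<theta> s) holomorphic_on V"
      by (intro holomorphic_intros holomorphic_on_subset[OF L]) (auto simp: V_def)
    moreover have "1 / L_function M \<theta> s = dirichlet_series ?a s" if "Re s > 1" for s
    proof -
      have "L_function M \<theta> s \<noteq> 0" using nz[of s] that True by simp
      then show ?thesis using inv[OF that] by (simp add: divide_eq_eq)
    qed
    ultimately show ?thesis by (rule sublinear_sum_if_continuation[OF a])
  next
    case False
    \<comment> \<open>Multiplication by s - 1 removes the pole of the principal character; the value
      at 1 is the nonzero mean, since \<open>zeta_numerator\<close> is 1 there.\<close>
    define P where "P = (\<lambda>s. ?c * zeta_numerator s + (s - 1) * L_regular M \<theta> s)"
    have PL: "P s = (s - 1) * L_function M \<theta> s" if "s \<noteq> 1" for s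
      using that by (simp add: P_def L_function_def distrib_left)
    have L: "P holomorphic_on H" unfolding P_def H_def
      by (intro holomorphic_intros zeta_numerator_holomorphic L_regular_holomorphic(1)[OF \<theta>])
    define V where "V = H \<inter> P -` (- {0})"
    have "open V" unfolding V_def
      by (rule continuous_open_preimage[OF holomorphic_on_imp_continuous_on[OF L] Ho]) auto
    moreover have "{s. Re s \<ge> 1} \<subseteq> V"
    proof
      fix s assume "s \<in> {s::complex. Re s \<ge> 1}"
      then have s: "Re s \<ge> 1" by simp
      have "P s \<noteq> 0"
      proof (cases "s = 1")
        case True
        then show ?thesis using False by (simp add: P_def zeta_numerator_1)
      qed (use PL nz s in simp)
      then show "s \<in> V" using s by (auto simp: V_def H_def)
    qed
    moreover have "(\<lambda>s. (s - 1) / P s) holomorphic_on V"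
      by (intro holomorphic_intros holomorphic_on_subset[OF L]) (auto simp: V_def)
    moreover have "(s - 1) / P s = dirichlet_series ?a s" if s: "Re s > 1" for s
    proof -
      have "s \<noteq> 1" using s by auto
      then have eq1: "(s - 1) / P s = 1 / L_function M \<theta> s" using PL by simp
      have "L_function M \<theta> s \<noteq> 0" using nz[of s] s \<open>s \<noteq> 1\<close> by simp
      then show ?thesis unfolding eq1 using inv[OF s] by (simp add: divide_eq_eq)
    qed
    ultimately show ?thesis by (rule sublinear_sum_if_continuation[OF a])
  qed
qed

text \<open>Projecting onto the eigenspaces of the commuting dilations \<open>n \<mapsto> x n\<close>, one unit at a time,
  writes a function on the units as a combination of characters.\<close>

lemma sublinear_moebius_coprime_periodic:
  fixes \<psi> :: "nat \<Rightarrow> complex"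
  assumes M: "M > 0" and per: "\<And>n. \<psi> (n + M) = \<psi> n" and supp: "\<And>n. \<not> coprime n M \<Longrightarrow> \<psi> n = 0"
  shows "sublinear (\<lambda>N. \<Sum>n<N. of_int (moebius_mu n) * \<psi> n)"
proof -
  define F where "F = {\<psi> :: nat \<Rightarrow> complex. (\<forall>n. \<psi> (n + M) = \<psi> n) \<and> (\<forall>n. \<not> coprime n M \<longrightarrow> \<psi> n = 0)}"
  define eig where "eig = (\<lambda>(\<psi> :: nat \<Rightarrow> complex) x. \<exists>\<omega>. \<forall>n. \<psi> (x * n) = \<omega> * \<psi> n)"
  define unit_set where "unit_set = {x. x < M \<and> coprime x M}"
  have cong: "\<psi> m = \<psi> n" if "\<psi> \<in> F" "[m = n] (mod M)" for \<psi> :: "nat \<Rightarrow> complex" and m n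
    using periodic_mod[of \<psi> M m] periodic_mod[of \<psi> M n] that by (simp add: F_def cong_def)
  have base: "sublinear (\<lambda>N. \<Sum>n<N. of_int (moebius_mu n) * \<psi> n)" if \<psi>: "\<psi> \<in> F" "\<And>x. x \<in> unit_set \<Longrightarrow> eig \<psi> x" for \<psi>
  proof -
    have eigc: "\<exists>\<omega>. \<forall>n. \<psi> (m * n) = \<omega> * \<psi> n" if m: "coprime m M" for m
    proof -
      have "m mod M \<in> unit_set" using m M by (simp add: unit_set_def)
      then obtain \<omega> where \<omega>: "\<And>n. \<psi> (m mod M * n) = \<omega> * \<psi> n" using \<psi>(2) by (auto simp: eig_def)
      moreover have "\<psi> (m mod M * n) = \<psi> (m * n)" for n
        by (intro cong \<psi>(1)) (simp add: cong_def mod_mult_left_eq)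
      ultimately show ?thesis by auto
    qed
    \<comment> \<open>A common eigenfunction is a multiple of a character: its values on units are
      eigenvalues times \<psi> 1, so it vanishes identically when \<psi> 1 = 0.\<close>
    show ?thesis
    proof (cases "\<psi> 1 = 0")
      case True
      have "\<psi> n = 0" for n
      proof (cases "coprime n M")
        case True
        then obtain \<omega> where "\<And>k. \<psi> (n * k) = \<omega> * \<psi> k" using eigc by blast
        from this[of 1] show ?thesis using \<open>\<psi> 1 = 0\<close> by simp
      qed (use \<psi>(1) in \<open>auto simp: F_def\<close>)
      then show ?thesis by (simp add: sublinear_0)
    next
      case False
      define \<theta> where "\<theta> = (\<lambda>n. \<psi> n / \<psi> 1)"
      have "dirichlet_char M \<theta>"
        unfolding dirichlet_char_def
      proof (intro conjI allI impI)
        fix m n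
        show "\<theta> (m * n) = \<theta> m * \<theta> n"
        proof (cases "coprime m M")
          case True
          then obtain \<omega> where \<omega>: "\<And>k. \<psi> (m * k) = \<omega> * \<psi> k" using eigc by blast
          show ?thesis using \<omega>[of 1] \<omega>[of n] False by (simp add: \<theta>_def)
        next
          case nc: False
          then have "\<not> coprime (m * n) M" by simp
          then show ?thesis using nc \<psi>(1) by (simp add: \<theta>_def F_def)
        qed
      qed (use M False \<psi>(1) in \<open>auto simp: \<theta>_def F_def\<close>)
      then have "sublinear (\<lambda>N. \<psi> 1 * (\<Sum>n<N. of_int (moebius_mu n) * \<theta> n))"
        by (intro sublinear_cmult sublinear_moebius_char)
      then show ?thesis using False by (simp add: \<theta>_def sum_distrib_left)
    qed
  qed
  \<comment> \<open>\<open>X\<close> holds the units whose dilation need not act by a scalar yet.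
    Decomposing for one of them preserves the eigenvalue relations already present, because
    dilations commute.\<close>
  have "finite X \<Longrightarrow> X \<subseteq> unit_set \<Longrightarrow> \<psi> \<in> F \<Longrightarrow> (\<And>x. x \<in> unit_set - X \<Longrightarrow> eig \<psi> x) \<Longrightarrow>
      sublinear (\<lambda>N. \<Sum>n<N. of_int (moebius_mu n) * \<psi> n)" for X \<psi>
  proof (induction X arbitrary: \<psi> rule: finite_induct)
    case empty
    then show ?case using base by auto
  next
    case (insert x X)
    have x: "coprime x M" "x \<in> unit_set" using insert by (auto simp: unit_set_def)
    define k where "k = totient M"
    have k: "k > 0" using M by (simp add: k_def)
    have xk: "[x ^ k = 1] (mod M)" unfolding k_def using x(1) by (rule euler_theorem)
    \<comment> \<open>Discrete Fourier projection onto the eigenvalue unit_exp (j / k), available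
      since x^k = 1 modulo \<open>M\<close> for k = totient M.\<close>
    define \<psi>j where "\<psi>j = (\<lambda>j n. (\<Sum>i<k. unit_exp (- (real i * real j / real k)) * \<psi> (x ^ i * n)) / of_nat k)"
    have \<psi>F: "\<psi> \<in> F" by (rule insert.prems)
    have jF: "\<psi>j j \<in> F" for j
      unfolding F_def
    proof (intro CollectI conjI allI impI)
      fix n
      have "\<psi> (x ^ i * (n + M)) = \<psi> (x ^ i * n)" for i
        by (intro cong \<psi>F) (simp add: cong_def distrib_left)
      then show "\<psi>j j (n + M) = \<psi>j j n" by (simp add: \<psi>j_def)
      assume "\<not> coprime n M"
      then have "\<not> coprime (x ^ i * n) M" for i by simp
      then show "\<psi>j j n = 0" using \<psi>F by (simp add: \<psi>j_def F_def)
    qed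
    have dec: "\<psi> n = (\<Sum>j<k. \<psi>j j n)" for n
    proof -
      have orth: "(\<Sum>j<k. unit_exp (- (real i * real j / real k))) = (if i = 0 then of_nat k else 0)" if "i < k" for i
      proof (cases "i = 0")
        case False
        have "\<not> int k dvd - int i" using that False by (auto dest: zdvd_imp_le)
        then show ?thesis using sum_unit_exp_eq_0[OF k, of "- int i"] False by simp
      qed simp
      have "(\<Sum>j<k. \<psi>j j n) = (\<Sum>j<k. \<Sum>i<k. unit_exp (- (real i * real j / real k)) * \<psi> (x ^ i * n)) / of_nat k"
        by (simp add: \<psi>j_def sum_divide_distrib)
      also have "(\<Sum>j<k. \<Sum>i<k. unit_exp (- (real i * real j / real k)) * \<psi> (x ^ i * n)) =
          (\<Sum>i<k. (\<Sum>j<k. unit_exp (- (real i * real j / real k))) * \<psi> (x ^ i * n))"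
        by (subst sum.swap) (simp add: sum_distrib_right)
      also have "\<dots> = (\<Sum>i<k. if i = 0 then of_nat k * \<psi> n else 0)"
        by (intro sum.cong refl) (auto simp: orth)
      also have "\<dots> = of_nat k * \<psi> n" using k by simp
      finally show ?thesis using k by simp
    qed
    have "sublinear (\<lambda>N. \<Sum>n<N. of_int (moebius_mu n) * \<psi>j j n)" for j
    proof (rule insert.IH)
      fix y assume y: "y \<in> unit_set - X"
      show "eig (\<psi>j j) y"
      proof (cases "y = x")
        case False
        then obtain \<omega> where \<omega>: "\<And>n. \<psi> (y * n) = \<omega> * \<psi> n" using insert.prems(3)[of y] y by (auto simp: eig_def)
        have "\<psi> (x ^ i * (y * n)) = \<omega> * \<psi> (x ^ i * n)" for i n
          using \<omega>[of "x ^ i * n"] by (simp add: mult_ac)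
        then have "\<psi>j j (y * n) = \<omega> * \<psi>j j n" for n
          by (simp add: \<psi>j_def sum_distrib_left mult_ac)
        then show ?thesis by (auto simp: eig_def)
      next
        case True
        define \<omega> where "\<omega> = unit_exp (real j / real k)"
        have "\<psi>j j (x * n) = \<omega> * \<psi>j j n" for n
        proof -
          define t where "t = (\<lambda>i. unit_exp (- (real i * real j / real k)) * \<psi> (x ^ i * n))"
          have tk: "t (i + k) = t i" for i
          proof -
            have "- (real (i + k) * real j / real k) = - (real i * real j / real k) + of_int (- int j)"
              using k by (simp add: field_simps)
            then have "unit_exp (- (real (i + k) * real j / real k)) = unit_exp (- (real i * real j / real k))"
              by (simp only: unit_exp_add unit_exp_of_int mult_1_right)
            moreover have "\<psi> (x ^ (i + k) * n) = \<psi> (x ^ i * n)"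
            proof (rule cong[OF \<psi>F])
              have "[x ^ k * (x ^ i * n) = 1 * (x ^ i * n)] (mod M)" using xk by (rule cong_scalar_right)
              then show "[x ^ (i + k) * n = x ^ i * n] (mod M)" by (simp add: power_add mult_ac)
            qed
            ultimately show ?thesis by (simp add: t_def)
          qed
          have "unit_exp (- (real i * real j / real k)) * \<psi> (x ^ i * (x * n)) = \<omega> * t (i + 1)" for i
          proof -
            have "real j / real k + - (real (i + 1) * real j / real k) = - (real i * real j / real k)"
              using k by (simp add: field_simps)
            then have "\<omega> * unit_exp (- (real (i + 1) * real j / real k)) = unit_exp (- (real i * real j / real k))"
              unfolding \<omega>_def unit_exp_add[symmetric] by simp
            then show ?thesis by (simp add: t_def mult_ac)
          qed
          then have "\<psi>j j (x * n) = \<omega> * (\<Sum>i<k. t (i + 1)) / of_nat k"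
            by (simp add: \<psi>j_def sum_distrib_left)
          also have "(\<Sum>i<k. t (i + 1)) = (\<Sum>i<k. t i)"
            by (rule sum_periodic_shift) (rule tk)
          finally show ?thesis by (simp add: \<psi>j_def t_def)
        qed
        then show ?thesis using True by (auto simp: eig_def)
      qed
    qed (use insert jF in auto)
    then have "sublinear (\<lambda>N. \<Sum>j<k. \<Sum>n<N. of_int (moebius_mu n) * \<psi>j j n)"
      by (intro sublinear_sum)
    moreover have "(\<Sum>j<k. \<Sum>n<N. of_int (moebius_mu n) * \<psi>j j n) = (\<Sum>n<N. of_int (moebius_mu n) * \<psi> n)" for N
      by (subst sum.swap) (simp add: dec sum_distrib_left)
    ultimately show ?case by simp
  qed
  from this[of unit_set \<psi>] show ?thesis
    using per supp by (auto simp: F_def unit_set_def)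
qed

section \<open>From functions on the units to all periodic functions\<close>

lemma moebius_mu_mult_coprime:
  assumes "coprime m n"
  shows "moebius_mu (m * n) = moebius_mu m * moebius_mu n"
proof (cases "squarefree m \<and> squarefree n")
  case True
  then have "m \<noteq> 0" "n \<noteq> 0" by (metis not_squarefree_0)+
  then have "prime_factors (m * n) = prime_factors m \<union> prime_factors n" by (rule prime_factors_product)
  moreover have "prime_factors m \<inter> prime_factors n = {}"
  proof (rule ccontr)
    assume "prime_factors m \<inter> prime_factors n \<noteq> {}"
    then obtain p where "prime p" "p dvd m" "p dvd n" by auto
    then show False using assms coprime_common_divisor[of m n p] not_prime_unit[of p] by blast
  qed
  ultimately have "card (prime_factors (m * n)) = card (prime_factors m) + card (prime_factors n)"
    by (simp add: card_Un_disjoint)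
  moreover have "squarefree (m * n)" using True assms squarefree_mult_coprime by blast
  ultimately show ?thesis using True by (simp add: moebius_mu_def power_add)
next
  case False
  then have "\<not> squarefree (m * n)" using squarefree_multD by blast
  then show ?thesis using False by (auto simp: moebius_mu_def)
qed

text \<open>A squarefree n factors in just one way as d * m with d dividing \<open>M\<close> and m
  coprime to \<open>M\<close>; this splits a sum over n by its common part with
  \<open>M\<close>.\<close>

lemma squarefree_gcd_split:
  assumes n: "squarefree (n::nat)" and M: "M > 0"
  shows "{d. d dvd M \<and> d dvd n \<and> coprime (n div d) M} = {gcd n M}"
proof (intro equalityI subsetI)
  fix d assume "d \<in> {d. d dvd M \<and> d dvd n \<and> coprime (n div d) M}"
  then have d: "d dvd M" "d dvd n" "coprime (n div d) M" by auto
  have "gcd n M = gcd (d * (n div d)) M" using d by simp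
  also have "\<dots> = gcd d M" using d(3) by (simp add: gcd_mult_left_right_cancel coprime_commute)
  also have "\<dots> = d" using d(1) by (simp add: gcd_nat.absorb1)
  finally show "d \<in> {gcd n M}" by simp
next
  fix d assume "d \<in> {gcd n M}"
  then have d: "d = gcd n M" by simp
  have "coprime (n div d) M"
  proof (rule ccontr)
    assume "\<not> coprime (n div d) M"
    then have "gcd (n div d) M \<noteq> 1" by (simp add: coprime_iff_gcd_eq_1)
    then obtain p where p: "prime p" "p dvd gcd (n div d) M" using prime_factor_nat by blast
    then have pd: "p dvd n div d" "p dvd M" by auto
    have "n = d * (n div d)" using d by simp
    moreover have "p dvd n" using pd(1) \<open>n = d * (n div d)\<close> by (metis dvd_mult)
    then have "p dvd d" using d pd by simp
    ultimately have "p * p dvd n" using pd(1) by (metis mult_dvd_mono)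
    then show False using n p(1) squarefreeD[of n p] not_prime_unit by (auto simp: power2_eq_square)
  qed
  then show "d \<in> {d. d dvd M \<and> d dvd n \<and> coprime (n div d) M}" using d by simp
qed

text \<open>For n = d * m split as above \<mu>(n) = \<mu>(d) * \<mu>(m), and m \<mapsto> \<psi> (d *
  m), cut down to m coprime to \<open>M\<close>, is periodic and supported on the units. Other n
  have \<mu>(n) = 0.\<close>

lemma sublinear_moebius_periodic:
  fixes \<psi> :: "nat \<Rightarrow> complex"
  assumes M: "M > 0" and per: "\<And>n. \<psi> (n + M) = \<psi> n"
  shows "sublinear (\<lambda>N. \<Sum>n<N. of_int (moebius_mu n) * \<psi> n)"
proof -
  let ?\<mu> = "\<lambda>n. complex_of_int (moebius_mu n)"
  define \<psi>d where "\<psi>d = (\<lambda>d m. if coprime m M then \<psi> (d * m) else 0)"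
  define D where "D = {d. d dvd M}"
  have Dfin: "finite D" unfolding D_def using M by simp
  have Dpos: "d > 0" if "d \<in> D" for d using that M by (auto simp: D_def intro!: Nat.gr0I)
  have sub: "sublinear (\<lambda>N. \<Sum>m<N. ?\<mu> m * \<psi>d d m)" for d
  proof (rule sublinear_moebius_coprime_periodic[OF M])
    fix n
    have "\<psi> (d * (n + M)) = \<psi> (d * n)"
      using periodic_add_mult[of \<psi> M "d * n" d] per by (simp add: algebra_simps)
    then show "\<psi>d d (n + M) = \<psi>d d n" by (simp add: \<psi>d_def coprime_iff_gcd_eq_1)
  qed (simp add: \<psi>d_def)
  \<comment> \<open>N / d rounded up, so that m < h d N means d * m < N.\<close>
  define h :: "nat \<Rightarrow> nat \<Rightarrow> nat" where "h = (\<lambda>d N. (N + d - 1) div d)"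
  have hle: "h d N \<le> N" if "d \<in> D" for d N
  proof -
    have "N + d - 1 \<le> d * N \<or> N = 0"
      using Dpos[OF that] by (cases d; cases N) auto
    then show ?thesis
    proof
      assume "N + d - 1 \<le> d * N"
      then have "h d N \<le> d * N div d" unfolding h_def by (rule div_le_mono)
      then show ?thesis using Dpos[OF that] by simp
    next
      assume "N = 0"
      then show ?thesis using Dpos[OF that] by (simp add: h_def)
    qed
  qed
  have hiff: "m < h d N \<longleftrightarrow> d * m < N" if "d \<in> D" for d m N
    unfolding h_def Suc_le_eq[symmetric, of m] less_eq_div_iff_mult_less_eq[OF Dpos[OF that]]
    using Dpos[OF that] by (auto simp: mult.commute)
  have "sublinear (\<lambda>N. \<Sum>d\<in>D. ?\<mu> d * (\<Sum>m<h d N. ?\<mu> m * \<psi>d d m))"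
    by (intro sublinear_sum sublinear_cmult sublinear_compose_le[OF sub] hle)
  moreover have "(\<Sum>n<N. ?\<mu> n * \<psi> n) = (\<Sum>d\<in>D. ?\<mu> d * (\<Sum>m<h d N. ?\<mu> m * \<psi>d d m))" for N
  proof -
    have gcd_term: "?\<mu> n * \<psi> n = (\<Sum>d\<in>D. of_bool (d dvd n \<and> coprime (n div d) M) * (?\<mu> n * \<psi> n))" for n
    proof (cases "squarefree n")
      case True
      have "(\<Sum>d\<in>D. of_bool (d dvd n \<and> coprime (n div d) M) * (?\<mu> n * \<psi> n)) =
          (\<Sum>d\<in>{d. d dvd M \<and> d dvd n \<and> coprime (n div d) M}. ?\<mu> n * \<psi> n)"
        using Dfin by (intro sum.mono_neutral_cong_right) (auto simp: D_def)
      also have "\<dots> = ?\<mu> n * \<psi> n" unfolding squarefree_gcd_split[OF True M] by simp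
      finally show ?thesis by simp
    qed (simp add: moebius_mu_def)
    have "(\<Sum>n<N. ?\<mu> n * \<psi> n) = (\<Sum>n<N. \<Sum>d\<in>D. of_bool (d dvd n \<and> coprime (n div d) M) * (?\<mu> n * \<psi> n))"
      by (intro sum.cong refl gcd_term)
    also have "\<dots> = (\<Sum>d\<in>D. \<Sum>n<N. of_bool (d dvd n \<and> coprime (n div d) M) * (?\<mu> n * \<psi> n))"
      by (rule sum.swap)
    also have "\<dots> = (\<Sum>d\<in>D. ?\<mu> d * (\<Sum>m<h d N. ?\<mu> m * \<psi>d d m))"
    proof (rule sum.cong[OF refl])
      fix d assume d: "d \<in> D"
      have "(\<Sum>n<N. of_bool (d dvd n \<and> coprime (n div d) M) * (?\<mu> n * \<psi> n)) =
          (\<Sum>n\<in>{n. n < N \<and> d dvd n}. of_bool (coprime (n div d) M) * (?\<mu> n * \<psi> n))"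
        by (intro sum.mono_neutral_cong_right) auto
      also have "\<dots> = (\<Sum>m<h d N. of_bool (coprime m M) * (?\<mu> (d * m) * \<psi> (d * m)))"
        by (rule sum.reindex_bij_witness[of _ "\<lambda>m. d * m" "\<lambda>n. n div d"])
          (use Dpos[OF d] in \<open>auto simp: hiff[OF d]\<close>)
      also have "\<dots> = (\<Sum>m<h d N. ?\<mu> d * (?\<mu> m * \<psi>d d m))"
      proof (rule sum.cong[OF refl])
        fix m
        have "moebius_mu (d * m) = moebius_mu d * moebius_mu m" if "coprime m M"
        proof (rule moebius_mu_mult_coprime)
          show "coprime d m" using that d by (auto simp: D_def intro: coprime_divisors[of d M m m] simp: coprime_commute)
        qed
        then show "of_bool (coprime m M) * (?\<mu> (d * m) * \<psi> (d * m)) = ?\<mu> d * (?\<mu> m * \<psi>d d m)"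
          by (simp add: \<psi>d_def)
      qed
      also have "\<dots> = ?\<mu> d * (\<Sum>m<h d N. ?\<mu> m * \<psi>d d m)" by (simp only: sum_distrib_left)
      finally show "(\<Sum>n<N. of_bool (d dvd n \<and> coprime (n div d) M) * (?\<mu> n * \<psi> n)) = ?\<mu> d * (\<Sum>m<h d N. ?\<mu> m * \<psi>d d m)" .
    qed
    finally show ?thesis .
  qed
  ultimately show ?thesis by simp
qed

text \<open>Euler's argument: bounded sums of 1 / p would keep the Euler product, hence
  zeta(\<sigma>), bounded as \<sigma> tends to 1, whereas (\<sigma> - 1) * zeta(\<sigma>) tends to
  1. The primes dividing \<open>b\<close> change the sums by a bounded amount.\<close>

lemma sum_prime_reciprocals_unbounded:
  fixes b :: nat
  assumes "b > 0"
  shows "\<exists>Q. finite Q \<and> Q \<subseteq> {p. prime p \<and> \<not> p dvd b} \<and> x \<le> (\<Sum>p\<in>Q. 1 / real p)"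
proof (rule ccontr)
  assume neg: "\<not> ?thesis"
  define X where "X = x + (\<Sum>p\<in>prime_factors b. 1 / real p)"
  have all: "(\<Sum>p\<in>Q. 1 / real p) \<le> X" if Q: "finite Q" "\<And>p. p \<in> Q \<Longrightarrow> prime p" for Q :: "nat set"
  proof -
    have "(\<Sum>p\<in>Q. 1 / real p) = (\<Sum>p\<in>Q - prime_factors b. 1 / real p) + (\<Sum>p\<in>Q \<inter> prime_factors b. 1 / real p)"
      using sum.Int_Diff[OF Q(1), of "\<lambda>p. 1 / real p" "prime_factors b"] by simp
    also have "(\<Sum>p\<in>Q - prime_factors b. 1 / real p) \<le> x"
    proof -
      have "Q - prime_factors b \<subseteq> {p. prime p \<and> \<not> p dvd b}" using Q assms by (auto simp: prime_factors_dvd)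
      then show ?thesis using neg Q(1) by (meson finite_Diff linear)
    qed
    also have "(\<Sum>p\<in>Q \<inter> prime_factors b. 1 / real p) \<le> (\<Sum>p\<in>prime_factors b. 1 / real p)"
      by (intro sum_mono2) auto
    finally show ?thesis by (simp add: X_def)
  qed
  have bound: "cmod (dirichlet_series (\<lambda>_. 1) (of_real \<sigma>)) \<le> exp (2 * X)" if \<sigma>: "\<sigma> > 1" for \<sigma>
  proof -
    let ?f = "\<lambda>n. 1 * (of_nat n :: complex) powr (- of_real \<sigma>)"
    let ?Q = "\<lambda>y. {p. prime p \<and> p \<le> y}"
    have fin: "finite (?Q y)" for y :: nat by simp
    have "(\<lambda>y. cmod ((\<Prod>p\<in>?Q y. 1 - ?f p) * dirichlet_series (\<lambda>_. 1) (of_real \<sigma>))) \<longlonglongrightarrow> cmod 1"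
      unfolding dirichlet_series_def using \<sigma>
      by (intro tendsto_norm euler_product_tendsto(1) completely_multiplicative_dirichlet[OF dirichlet_char_trivial] norm_dirichlet_summable[of _ 1]) auto
    moreover have "exp (- (2 * X)) * cmod (dirichlet_series (\<lambda>_. 1) (of_real \<sigma>)) \<le>
        cmod ((\<Prod>p\<in>?Q y. 1 - ?f p) * dirichlet_series (\<lambda>_. 1) (of_real \<sigma>))" for y
    proof -
      have "exp (- (2 * X)) \<le> exp (\<Sum>p\<in>?Q y. - 2 * (1 / real p))"
      proof -
        have "(\<Sum>p\<in>?Q y. 1 / real p) \<le> X" by (rule all) auto
        then have "- (2 * X) \<le> - 2 * (\<Sum>p\<in>?Q y. 1 / real p)" by linarith
        then show ?thesis by (simp only: sum_distrib_left exp_le_cancel_iff)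
      qed
      also have "\<dots> = (\<Prod>p\<in>?Q y. exp (- 2 * (1 / real p)))" by (rule exp_sum[OF fin])
      also have "\<dots> \<le> (\<Prod>p\<in>?Q y. cmod (1 - ?f p))"
      proof (intro prod_mono conjI)
        fix p assume "p \<in> ?Q y"
        then have p: "prime p" by simp
        define t where "t = real p powr (- \<sigma>)"
        have p2: "real p \<ge> 2" using prime_ge_2_nat[OF p] by simp
        have "t \<le> real p powr (- 1)" unfolding t_def using p2 \<sigma> by (intro powr_mono) auto
        then have t: "0 \<le> t" "t \<le> 1 / real p" using p2 by (auto simp: t_def powr_minus_divide)
        have "1 / real p \<le> 1 / 2" using p2 by (intro divide_left_mono) auto
        then have t2: "t \<le> 1 / 2" using t by linarith
        \<comment> \<open>For t \<le> 1 / 2 the lower bound - t - 2 * t^2 for ln (1 - t) is at least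
          - 2 * t, whence the factor 2 in exp (2 * X).\<close>
        have "t * t \<le> t * (1 / 2)" using t t2 by (intro mult_left_mono) auto
        then have "- (2 * t) \<le> - t - 2 * t\<^sup>2" by (simp add: power2_eq_square)
        also have "\<dots> \<le> ln (1 - t)" using t(1) t2 by (rule ln_one_minus_pos_lower_bound)
        finally have "exp (- (2 * t)) \<le> 1 - t" using t2 by (simp add: ln_ge_iff)
        moreover have "exp (- 2 * (1 / real p)) \<le> exp (- (2 * t))" using t by simp
        moreover have "1 - t \<le> cmod (1 - ?f p)"
          using norm_triangle_ineq2[of 1 "?f p"] by (simp add: t_def norm_of_nat_powr)
        ultimately show "exp (- 2 * (1 / real p)) \<le> cmod (1 - ?f p)" by linarith
      qed simp
      finally have "exp (- (2 * X)) \<le> cmod (\<Prod>p\<in>?Q y. 1 - ?f p)" by (simp only: prod_norm)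
      then show ?thesis unfolding norm_mult by (rule mult_right_mono) simp
    qed
    ultimately have "exp (- (2 * X)) * cmod (dirichlet_series (\<lambda>_. 1) (of_real \<sigma>)) \<le> cmod 1"
      by (intro LIMSEQ_le_const) auto
    then show ?thesis by (simp add: exp_minus field_simps)
  qed
  have "isCont zeta_numerator 1"
    using holomorphic_on_imp_differentiable_at[OF zeta_numerator_holomorphic open_halfspace_Re_gt]
    by (intro field_differentiable_imp_continuous_at) auto
  then have "((\<lambda>\<sigma>::real. cmod (zeta_numerator (of_real \<sigma>))) \<longlongrightarrow> cmod (zeta_numerator 1)) (at_right 1)"
    by (intro tendsto_norm isCont_tendsto_compose[of 1 zeta_numerator]) (auto intro!: tendsto_eq_intros)
  moreover have "((\<lambda>\<sigma>::real. (\<sigma> - 1) * exp (2 * X)) \<longlongrightarrow> (1 - 1) * exp (2 * X)) (at_right 1)"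
    by (intro tendsto_intros)
  moreover have "eventually (\<lambda>\<sigma>::real. cmod (zeta_numerator (of_real \<sigma>)) \<le> (\<sigma> - 1) * exp (2 * X)) (at_right 1)"
    unfolding eventually_at_filter
  proof (intro always_eventually allI impI)
    fix \<sigma> :: real assume "\<sigma> \<in> {1<..}"
    then have \<sigma>: "\<sigma> > 1" by simp
    have "cmod (of_real \<sigma> - 1) = \<sigma> - 1"
      using \<sigma> by (metis abs_of_pos diff_gt_0_iff_gt norm_of_real of_real_1 of_real_diff)
    then show "cmod (zeta_numerator (of_real \<sigma>)) \<le> (\<sigma> - 1) * exp (2 * X)"
      using zeta_numerator_eq[of "of_real \<sigma>"] bound[OF \<sigma>] \<sigma> by (simp add: norm_mult mult_left_mono)
  qed
  ultimately have "cmod (zeta_numerator 1) \<le> (1 - 1) * exp (2 * X)"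
    by (intro tendsto_le[of "at_right (1::real)"]) auto
  then show False by (simp add: zeta_numerator_1)
qed

section \<open>Application to digit functions\<close>

context digit_function
begin

lemma sublinear_moebius_linear:
  assumes linear: "\<And>m. g (Suc m) = g 1 * g m"
  shows "sublinear (\<lambda>N. \<Sum>n<N. of_int (moebius_mu n) * g (n\<^sup>2))"
proof -
  define \<zeta> where "\<zeta> = g 1"
  have g: "g m = \<zeta> ^ m" for m
  proof (induction m)
    case (Suc m)
    then show ?case using linear[of m] by (simp only: \<zeta>_def power_Suc)
  qed simp
  have "g b = g 1" using g_split[of 0 1 1] base by simp
  then have "\<zeta> ^ b = \<zeta>" by (simp add: g)
  moreover have "\<zeta> \<noteq> 0" by (simp add: \<zeta>_def)
  moreover have "\<zeta> ^ b = \<zeta> * \<zeta> ^ (b - 1)" using base by (cases b) auto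
  ultimately have \<zeta>1: "\<zeta> ^ (b - 1) = 1" by simp
  show ?thesis
  proof (rule sublinear_moebius_periodic[of "b - 1" "\<lambda>n. g (n\<^sup>2)"])
    fix n
    have "(n + (b - 1))\<^sup>2 = n\<^sup>2 + (b - 1) * (2 * n + (b - 1))" by (simp add: power2_eq_square algebra_simps)
    then show "g ((n + (b - 1))\<^sup>2) = g (n\<^sup>2)"
      by (simp only: g power_add power_mult[of \<zeta> "b - 1"] \<zeta>1 power_one mult_1_right)
  qed (use base in simp)
qed

text \<open>\<open>linear_dilate_quotient_imp_linear\<close> requires the first dilation to be the
  larger one; exchanging p and q conjugates the sum, which settles the other order.\<close>

lemma sublinear_dilates:
  assumes nonlinear: "g (Suc m) \<noteq> g 1 * g m"
    and p: "prime p" "\<not> p dvd b" and q: "prime q" "\<not> q dvd b" and "p \<noteq> q"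
  shows "sublinear (\<lambda>N. \<Sum>n<N. g ((p * n)\<^sup>2) * cnj (g ((q * n)\<^sup>2)))"
proof -
  have gt: "sublinear (\<lambda>N. \<Sum>n<N. g ((p * n)\<^sup>2) * cnj (g ((q * n)\<^sup>2)))"
    if p: "prime p" "\<not> p dvd b" and q: "prime q" "\<not> q dvd b" and less: "q < p" for p q :: nat
  proof -
    have pq: "q\<^sup>2 < p\<^sup>2" "0 < p\<^sup>2" "0 < q\<^sup>2"
      using less p q by (auto simp: power_strict_mono prime_gt_0_nat)
    have cop: "coprime (p\<^sup>2) b" "coprime (q\<^sup>2) b"
      using p q by (auto simp: prime_imp_coprime)
    obtain n where n: "dilate_quotient (p\<^sup>2) (q\<^sup>2) (Suc n) \<noteq> dilate_quotient (p\<^sup>2) (q\<^sup>2) n * dilate_quotient (p\<^sup>2) (q\<^sup>2) 1"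
      using linear_dilate_quotient_imp_linear[OF pq(1) cop(1)] nonlinear by blast
    have "sublinear (\<lambda>N. \<Sum>n<N. dilate_quotient (p\<^sup>2) (q\<^sup>2) (n\<^sup>2))"
    proof (rule sublinear_dilate_quotient_squares[OF pq(2,3) cop])
      fix \<delta> :: real assume "\<delta> > 0"
      obtain w0 where "\<And>w c c' \<omega>. w \<ge> w0 \<Longrightarrow> c < p\<^sup>2 \<Longrightarrow> c' < q\<^sup>2 \<Longrightarrow> cmod (window_sum (p\<^sup>2) (q\<^sup>2) w c c' \<omega>) \<le> \<delta> * real (b ^ w)"
        using window_sum_decay[OF pq(2,3) n \<open>\<delta> > 0\<close>] by blast
      then show "\<exists>w0. \<forall>w\<ge>w0. \<forall>c<p\<^sup>2. \<forall>c'<q\<^sup>2. \<forall>\<omega>. cmod (window_sum (p\<^sup>2) (q\<^sup>2) w c c' \<omega>) \<le> \<delta> * real (b ^ w)"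
        by blast
    qed
    then show ?thesis by (simp add: dilate_quotient_def power_mult_distrib)
  qed
  show ?thesis
  proof (cases "q < p")
    case False
    then have "p < q" using \<open>p \<noteq> q\<close> by simp
    from gt[OF q p this] show ?thesis
      unfolding sublinear_def by (subst (asm) cmod_sum_cnj_commute)
  qed (use gt p q in blast)
qed

end

theorem theorem2:
  fixes b :: nat and g :: "nat \<Rightarrow> complex"
  assumes "b \<ge> 2"
    and "strongly_multiplicative b g"
    and "\<And>n. cmod (g n) = 1"
  shows "(\<lambda>N::nat. \<Sum>n<N. of_int (moebius_mu n) * g (n\<^sup>2)) \<in> o(\<lambda>N. of_nat N)"
proof -
  interpret digit_function b g
    using assms by unfold_locales
  show ?thesis
  proof (rule sublinear_imp_smallo, cases "\<forall>m. g (Suc m) = g 1 * g m")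
    case True
    then show "sublinear (\<lambda>N. \<Sum>n<N. of_int (moebius_mu n) * g (n\<^sup>2))"
      by (intro sublinear_moebius_linear) blast
  next
    case False
    then obtain m where m: "g (Suc m) \<noteq> g 1 * g m" by blast
    show "sublinear (\<lambda>N. \<Sum>n<N. of_int (moebius_mu n) * g (n\<^sup>2))"
    proof (rule katai[where P = "{p. prime p \<and> \<not> p dvd b}"])
      fix x :: real
      show "\<exists>Q. finite Q \<and> Q \<subseteq> {p. prime p \<and> \<not> p dvd b} \<and> x \<le> (\<Sum>p\<in>Q. 1 / real p)"
        by (rule sum_prime_reciprocals_unbounded) (use assms(1) in simp)
    next
      fix p q assume "p \<in> {p. prime p \<and> \<not> p dvd b}" "q \<in> {p. prime p \<and> \<not> p dvd b}" "p \<noteq> q"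
      then show "sublinear (\<lambda>N. \<Sum>n<N. g ((p * n)\<^sup>2) * cnj (g ((q * n)\<^sup>2)))"
        by (intro sublinear_dilates[OF m]) auto
    qed auto
  qed
qed

end
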